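(* There exists a deterministic absolutely continuous compactly supported probability measure $\mu(x)\,dx$ on $\mathbb R$ with $0\le\mu(x)\le\theta^{-1}$ such that the random measures $\mu_N$ (see context) converge to $\mu(x)dx$ as $N\to\infty$, in the sense that for any compactly supported Lipschitz function $f$ on $\mathbb R$ the following convergence in probability holds: $$\lim_{N\to\infty}\int_{\mathbb R}f(x)\,\mu_N(dx)=\int_{\mathbb R}f(x)\mu(x)\,dx.$$
   Context: Fix $\theta>0$. Let $V:\mathbb R\to\mathbb R$ be a real-analytic function such that for $|z|$ large enough $V$ is monotone (on each of the two half-lines) and satisfies $V(z)>c\ln|z|$ with a constant $c>2\theta$. Set $w(x;N)=\exp\left(-NV\left(\frac xN\right)\right)$. For (large) $N$ let $\mathbb P_N$ be the probability distribution $$\mathbb P_N(\ell_1,\dots,\ell_N)=\frac1{Z_N}\prod_{1\le i<j\le N}\frac{\Gamma(\ell_j-\ell_i+1)\Gamma(\ell_j-\ell_i+\theta)}{\Gamma(\ell_j-\ell_i)\Gamma(\ell_j-\ell_i+1-\theta)}\prod_{i=1}^N w(\ell_i;N)$$ on ordered $N$-tuples $\ell_1<\dots<\ell_N$ such that $\ell_i=\lambda_i+\theta i$, where $\lambda_1\le\dots\le\lambda_N$ are integers, and let $\mu_N=\frac1N\sum_{i=1}^N\delta_{\ell_i/N}$ be the (random) empirical measure, with $(\ell_1,\dots,\ell_N)$ distributed according to $\mathbb P_N$. *)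

theory Defs
  imports "HOL-Probability.Probability"
begin

definition real_analytic_on :: "(real \<Rightarrow> real) \<Rightarrow> real set \<Rightarrow> bool" where
  "real_analytic_on f S \<longleftrightarrow>
     (\<forall>x\<in>S. \<exists>a r. r > 0 \<and> (\<forall>y. \<bar>y - x\<bar> < r \<longrightarrow> (\<lambda>n. a n * (y - x) ^ n) sums f y))"

(* An N-tuple is a function on the indices 1..N, made extensional so that distinct elements of
   this set are distinct tuples. The strict ordering l 1 < ... < l N follows from \<theta> > 0. *)
definition particle_configs :: "real \<Rightarrow> nat \<Rightarrow> (nat \<Rightarrow> real) set" where
  "particle_configs \<theta> N =
     {l \<in> extensional {1..N}. \<exists>lam :: nat \<Rightarrow> int. mono_on {1..N} lam \<and>
        (\<forall>i\<in>{1..N}. l i = of_int (lam i) + \<theta> * real i)}"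

definition config_weight :: "real \<Rightarrow> (real \<Rightarrow> real) \<Rightarrow> nat \<Rightarrow> (nat \<Rightarrow> real) \<Rightarrow> real" where
  "config_weight \<theta> V N l =
     (\<Prod>(i, j) \<in> {(i, j). 1 \<le> i \<and> i < j \<and> j \<le> N}.
        (Gamma (l j - l i + 1) * Gamma (l j - l i + \<theta>)) /
        (Gamma (l j - l i) * Gamma (l j - l i + 1 - \<theta>))) *
     (\<Prod>i = 1..N. exp (- real N * V (l i / real N)))"

definition partition_function :: "real \<Rightarrow> (real \<Rightarrow> real) \<Rightarrow> nat \<Rightarrow> real" where
  "partition_function \<theta> V N = (\<Sum>\<^sub>\<infinity>l\<in>particle_configs \<theta> N. config_weight \<theta> V N l)"

(* If the weights are not summable (possible only for small N under the growth assumption on V),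
   the partition function is 0 by convention and this is the zero measure. *)
definition beta_ensemble :: "real \<Rightarrow> (real \<Rightarrow> real) \<Rightarrow> nat \<Rightarrow> (nat \<Rightarrow> real) measure" where
  "beta_ensemble \<theta> V N =
     point_measure (particle_configs \<theta> N)
       (\<lambda>l. ennreal (config_weight \<theta> V N l / partition_function \<theta> V N))"

definition empirical_measure :: "nat \<Rightarrow> (nat \<Rightarrow> real) \<Rightarrow> real measure" where
  "empirical_measure N l = distr (uniform_count_measure {1..N}) borel (\<lambda>i. l i / real N)"

(* Only the tail of the sequence matters; for all large N, X N has to be a random variable on a
   genuine probability space, which excludes the degenerate case of zero measures. *)
definition converges_in_probability ::
    "(nat \<Rightarrow> 'a measure) \<Rightarrow> (nat \<Rightarrow> 'a \<Rightarrow> real) \<Rightarrow> real \<Rightarrow> bool" where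
  "converges_in_probability M X a \<longleftrightarrow>
     (\<forall>\<^sub>F N in sequentially. prob_space (M N) \<and> X N \<in> borel_measurable (M N)) \<and>
     (\<forall>\<epsilon>>0. (\<lambda>N. measure (M N) {\<omega> \<in> space (M N). \<bar>X N \<omega> - a\<bar> > \<epsilon>}) \<longlonglongrightarrow> 0)"

end

theory Submission
  imports Defs "HOL-Real_Asymp.Real_Asymp"
begin

text \<open>
  Put \<open>x i = l i / N\<close>. Up to a factor that depends on \<open>N\<close> only and an error \<open>exp (o(N\<^sup>2))\<close>, the weight of a
  configuration is \<open>exp (N\<^sup>2 * E x)\<close> with
  \<open>E x = \<theta> / N\<^sup>2 * (\<Sum>i \<noteq> j. ln \<bar>x i - x j\<bar>) - 1 / N * (\<Sum>i. V (x i))\<close>,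
  because the pair interaction \<open>\<Gamma>(u + 1) \<Gamma>(u + \<theta>) / (\<Gamma>(u) \<Gamma>(u + 1 - \<theta>))\<close> behaves like \<open>u powr (2 * \<theta>)\<close>
  (\<open>ln_config_weight\<close>). The points \<open>x i\<close> are at least \<open>\<theta> / N\<close> apart, so on a macroscopic scale a
  configuration looks like a probability density \<open>\<rho>\<close> with values in \<open>[0, 1 / \<theta>]\<close>, and \<open>E x\<close> looks like
  \<open>I \<rho> = \<theta> * (\<integral>x. \<integral>y. ln \<bar>x - y\<bar> * \<rho> x * \<rho> y) - (\<integral>x. V x * \<rho> x)\<close>.
  Configurations whose energy stays below the supremum of \<open>I\<close> by a fixed amount have a total weight that
  is smaller than the partition function by a factor \<open>exp (- const * N\<^sup>2)\<close>. The configurations that remain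
  are near maximizers of \<open>I\<close>. As \<open>I\<close> is strictly concave, near maximizers nearly agree when they are
  integrated against Lipschitz functions, and the law of large numbers follows.

  To avoid singular integrals, the logarithm is replaced by \<open>trunc_log r\<close>, which is linear on \<open>[0, r]\<close>. It
  dominates the logarithm, and for points with gaps \<open>\<theta> / N\<close> it changes the energy by at most a constant
  times \<open>sqrt r\<close>. Near maximizers of the truncated energy for a fixed small \<open>r\<close> take the role of the
  maximizer of \<open>I\<close>.

  Strict concavity comes from a representation of the truncated logarithm: for \<open>r \<le> R\<close> and \<open>\<bar>u\<bar> \<le> R\<close>,
  \<open>- trunc_log r u\<close> is a positive mixture of the tents \<open>max 0 (s - \<bar>u\<bar>)\<close> with \<open>r \<le> s \<le> R\<close>, plus a constant,
  minus \<open>\<bar>u\<bar> / R\<close> (\<open>trunc_log_eq_tent_integral\<close>). A tent measures the overlap of two intervals of length \<open>s\<close>,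
  so it is positive definite. On densities of total mass \<open>0\<close> with cumulative function \<open>F\<close> the constant
  drops out, and \<open>- \<bar>u\<bar> / R\<close> contributes \<open>2 / R\<close> times the integral of \<open>F\<^sup>2\<close>, which controls integrals against
  Lipschitz functions uniformly in \<open>r\<close> (\<open>near_maximizers_close\<close>).

  The quantiles of a density of height at most \<open>1 / \<theta>\<close> have gaps \<open>\<theta> / N\<close> and can be rounded to the lattice
  (\<open>config_of_density\<close>); this bounds the partition function from below. Conversely, a configuration becomes
  a density by spreading each particle over the interval of length \<open>\<theta> / N\<close> to its right. Particles outside
  a fixed interval are moved into unoccupied room near the origin instead, which raises the energy by at
  least the moved mass, since \<open>V\<close> grows faster than \<open>2 * \<theta> * ln\<close> (\<open>density_of_config\<close>). All densities thus
  live on one interval \<open>[-B, B]\<close>, which is also why the limit has compact support.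

  The number of configurations is infinite. A weight is therefore split as \<open>w powr (1 - \<eta>) * w powr \<eta>\<close>. The
  first factor is bounded through the energy. The second one is bounded through the growth of \<open>V\<close>, and its
  sum over all configurations, relative to the factor common to all weights, is at most
  \<open>exp (O(\<eta> * N\<^sup>2) + O(N * ln N))\<close> (\<open>far_from_maximum_negligible\<close>).

  Near maximizers for the truncations \<open>r = 1 / (n + 1)\<close> have a weakly convergent subsequence by Helly's
  theorem. As \<open>N\<close> tends to infinity, the empirical measures concentrate near the \<open>n\<close>-th near maximizer, up
  to an error that vanishes as \<open>n\<close> grows; hence the limit of the subsequence is the limit of the empirical
  measures. It gives every Borel set \<open>X\<close> at most the mass \<open>\<bar>X \<inter> [-B, B]\<bar> / \<theta>\<close>, so it has a density bounded by
  \<open>1 / \<theta>\<close>.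
\<close>

section \<open>The truncated logarithm\<close>

text \<open>
  The tangent to the logarithm at \<open>r\<close> replaces it below \<open>r\<close>. So the function is of class \<open>C\<^sup>1\<close> and
  concave in \<open>\<bar>u\<bar>\<close>; concavity is what makes it negative definite on densities of total mass \<open>0\<close>.
\<close>

definition trunc_log :: "real \<Rightarrow> real \<Rightarrow> real" where
  "trunc_log r u = (if \<bar>u\<bar> < r then ln r - 1 + \<bar>u\<bar> / r else ln \<bar>u\<bar>)"

lemma trunc_log_ge_ln:
  assumes "r > 0" "u \<noteq> 0"
  shows "ln \<bar>u\<bar> \<le> trunc_log r u"
proof -
  have "ln (\<bar>u\<bar> / r) \<le> \<bar>u\<bar> / r - 1"
    using assms by (intro ln_le_minus_one) auto
  then show ?thesis
    using assms by (auto simp: trunc_log_def ln_div)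
qed

text \<open>
  The error is written as a power of \<open>r / \<bar>u\<bar>\<close> with exponent below \<open>1\<close>: such a bound stays summable
  over points that are separated by \<open>\<theta>/N\<close>, and the sum is small with \<open>r\<close>.
\<close>

lemma trunc_log_le_ln_add_sqrt:
  assumes "r > 0" "u \<noteq> 0"
  shows "trunc_log r u \<le> ln \<bar>u\<bar> + 2 * sqrt (r / \<bar>u\<bar>)"
proof -
  have "ln (sqrt (r / \<bar>u\<bar>)) \<le> sqrt (r / \<bar>u\<bar>) - 1"
    using assms by (intro ln_le_minus_one) auto
  then have "ln r - ln \<bar>u\<bar> \<le> 2 * sqrt (r / \<bar>u\<bar>)"
    using assms by (simp add: ln_sqrt ln_div)
  moreover have "trunc_log r u \<le> ln r" if "\<bar>u\<bar> < r"
    using that assms by (simp add: trunc_log_def)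
  moreover have "0 \<le> sqrt (r / \<bar>u\<bar>)" "trunc_log r u = ln \<bar>u\<bar>" if "\<not> \<bar>u\<bar> < r"
    using that assms by (auto simp: trunc_log_def)
  ultimately show ?thesis
    by (cases "\<bar>u\<bar> < r") (fastforce, fastforce)
qed

lemma trunc_log_diff_nonneg:
  assumes "r > 0" "0 \<le> v" "v \<le> u"
  shows "trunc_log r v \<le> trunc_log r u \<and> trunc_log r u - trunc_log r v \<le> (u - v) / r"
proof -
  have *: "ln b - ln a \<le> (b - a) / r" if "r \<le> a" "a \<le> b" for a b
  proof -
    have "ln (b / a) \<le> b / a - 1" using that assms by (intro ln_le_minus_one) auto
    moreover have "b / a - 1 = (b - a) / a" using that assms by (simp add: field_simps)
    moreover have "(b - a) / a \<le> (b - a) / r" using that assms by (intro divide_left_mono) auto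
    ultimately show ?thesis using that assms by (simp add: ln_div)
  qed
  consider "u < r" | "v < r" "r \<le> u" | "r \<le> v" by linarith
  then show ?thesis
  proof cases
    case 1
    then show ?thesis using assms by (auto simp: trunc_log_def divide_right_mono diff_divide_distrib)
  next
    case 2
    have "ln r \<le> ln u" "v / r \<le> 1" using 2 assms by auto
    moreover have "ln u - ln r \<le> u / r - 1" using *[of r u] 2 assms by (simp add: diff_divide_distrib)
    moreover have "trunc_log r v = ln r - 1 + v / r" "trunc_log r u = ln u"
      using 2 assms by (auto simp: trunc_log_def)
    ultimately show ?thesis unfolding diff_divide_distrib by linarith
  next
    case 3
    then show ?thesis using assms *[of v u] by (auto simp: trunc_log_def)
  qed
qed

lemma trunc_log_abs: "trunc_log r \<bar>u\<bar> = trunc_log r u"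
  by (simp add: trunc_log_def)

lemma trunc_log_mono:
  assumes "r > 0" "\<bar>u\<bar> \<le> \<bar>v\<bar>"
  shows "trunc_log r u \<le> trunc_log r v"
  using trunc_log_diff_nonneg[of r "\<bar>u\<bar>" "\<bar>v\<bar>"] assms by (simp add: trunc_log_abs)

lemma trunc_log_lipschitz:
  assumes "r > 0"
  shows "\<bar>trunc_log r u - trunc_log r v\<bar> \<le> \<bar>u - v\<bar> / r"
proof -
  have "\<bar>trunc_log r u - trunc_log r v\<bar> \<le> \<bar>\<bar>u\<bar> - \<bar>v\<bar>\<bar> / r"
    using trunc_log_diff_nonneg[of r "\<bar>u\<bar>" "\<bar>v\<bar>"] trunc_log_diff_nonneg[of r "\<bar>v\<bar>" "\<bar>u\<bar>"] assms
    by (cases "\<bar>u\<bar> \<le> \<bar>v\<bar>") (auto simp: trunc_log_abs)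
  also have "\<dots> \<le> \<bar>u - v\<bar> / r"
    using assms by (intro divide_right_mono) auto
  finally show ?thesis .
qed

lemma borel_measurable_trunc_log [measurable]: "trunc_log r \<in> borel_measurable borel"
  unfolding trunc_log_def by measurable

text \<open>
  A lower bound with an elementary primitive. It yields bounds on logarithmic potentials that do not
  depend on \<open>r\<close>.
\<close>

lemma trunc_log_ge_ln_add:
  assumes "r > 0"
  shows "ln (\<bar>u\<bar> + r) - 1 \<le> trunc_log r u"
proof (cases "\<bar>u\<bar> < r")
  case True
  have "ln (1 + \<bar>u\<bar> / r) \<le> \<bar>u\<bar> / r"
    using assms by (intro ln_add_one_self_le_self) auto
  moreover have "ln (1 + \<bar>u\<bar> / r) = ln (\<bar>u\<bar> + r) - ln r"
    using assms ln_div[of "\<bar>u\<bar> + r" r] by (simp add: add_divide_distrib add.commute)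
  ultimately show ?thesis using True by (simp add: trunc_log_def)
next
  case False
  have "ln ((\<bar>u\<bar> + r) / \<bar>u\<bar>) \<le> (\<bar>u\<bar> + r) / \<bar>u\<bar> - 1"
    using assms False by (intro ln_le_minus_one) auto
  moreover have "(\<bar>u\<bar> + r) / \<bar>u\<bar> - 1 \<le> 1" using assms False by (simp add: field_simps)
  moreover have "ln ((\<bar>u\<bar> + r) / \<bar>u\<bar>) = ln (\<bar>u\<bar> + r) - ln \<bar>u\<bar>"
    using assms False ln_div[of "\<bar>u\<bar> + r" "\<bar>u\<bar>"] by simp
  ultimately show ?thesis using False by (simp add: trunc_log_def)
qed

text \<open>
  A function that is concave in \<open>\<bar>u\<bar>\<close> is a mixture of tents with its negative second derivative as
  mixing measure; here that derivative is \<open>1 / s\<^sup>2\<close> on \<open>[r, R]\<close> and \<open>0\<close> below \<open>r\<close>.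
\<close>

lemma trunc_log_eq_tent_integral:
  assumes "0 < r" "r \<le> R" "\<bar>u\<bar> \<le> R"
  shows "(\<integral>s. max 0 (s - \<bar>u\<bar>) / s\<^sup>2 \<partial>restrict_space lborel {r..R})
    = ln R - trunc_log r u - 1 + \<bar>u\<bar> / R"
proof -
  \<comment> \<open>the integrand vanishes below \<open>\<bar>u\<bar>\<close>\<close>
  define a where "a = max r \<bar>u\<bar>"
  have a: "0 < a" "a \<le> R" "r \<le> a" "\<bar>u\<bar> \<le> a" using assms by (auto simp: a_def)
  have "(\<integral>s. max 0 (s - \<bar>u\<bar>) / s\<^sup>2 \<partial>restrict_space lborel {r..R})
    = (\<integral>s. indicator {r..R} s *\<^sub>R (max 0 (s - \<bar>u\<bar>) / s\<^sup>2) \<partial>lborel)"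
    by (subst integral_restrict_space) (auto simp: set_lebesgue_integral_def)
  also have "\<dots> = (\<integral>s. (1 / s - \<bar>u\<bar> / s\<^sup>2) * indicator {a..R} s \<partial>lborel)"
  proof (intro Bochner_Integration.integral_cong refl)
    fix s :: real
    show "indicator {r..R} s *\<^sub>R (max 0 (s - \<bar>u\<bar>) / s\<^sup>2) = (1 / s - \<bar>u\<bar> / s\<^sup>2) * indicator {a..R} s"
      using assms by (auto simp: indicator_def a_def field_simps power2_eq_square max_def split: if_splits)
  qed
  also have "\<dots> = (ln R + \<bar>u\<bar> / R) - (ln a + \<bar>u\<bar> / a)"
    using a
    by (intro integral_FTC_Icc_real)
       (auto intro!: derivative_eq_intros continuous_intros simp: field_simps power2_eq_square)
  also have "\<dots> = ln R - trunc_log r u - 1 + \<bar>u\<bar> / R"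
    using assms by (auto simp: a_def trunc_log_def max_def)
  finally show ?thesis .
qed

section \<open>The pair interaction of the ensemble\<close>

definition pair_interaction :: "real \<Rightarrow> real \<Rightarrow> real" where
  "pair_interaction \<theta> u = (Gamma (u + 1) * Gamma (u + \<theta>)) / (Gamma u * Gamma (u + 1 - \<theta>))"

text \<open>
  By the mean value theorem \<open>ln x = ln_Gamma (x + 1) - ln_Gamma x\<close> is a value of Digamma between \<open>x\<close> and
  \<open>x + 1\<close>, and Digamma is increasing.
\<close>

lemma Digamma_real_bounds:
  fixes x :: real
  assumes "x > 1"
  shows "ln (x - 1) \<le> Digamma x \<and> Digamma x \<le> ln x"
proof -
  have *: "\<exists>z. x < z \<and> z < x + 1 \<and> ln x = Digamma z" if "x > 0" for x :: real
  proof -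
    have "\<exists>z. x < z \<and> z < x + 1 \<and> ln_Gamma (x + 1) - ln_Gamma x = (x + 1 - x) * Digamma z"
      using that by (intro MVT2) (auto intro!: has_field_derivative_ln_Gamma_real)
    moreover have "ln_Gamma (x + 1) - ln_Gamma x = ln x"
    proof -
      have G: "Gamma x > 0" "Gamma (x + 1) = x * Gamma x"
        using that by (auto intro!: Gamma_plus1 Gamma_real_pos elim: nonpos_Ints_cases)
      have "ln_Gamma (x + 1) = ln (x * Gamma x)"
        using that by (simp add: ln_Gamma_real_pos G(2))
      also have "\<dots> = ln x + ln_Gamma x"
        using that G(1) by (simp add: ln_Gamma_real_pos ln_mult_pos)
      finally show ?thesis by simp
    qed
    ultimately show ?thesis by simp
  qed
  obtain z1 where "x - 1 < z1" "z1 < x" "ln (x - 1) = Digamma z1" using *[of "x - 1"] assms by auto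
  moreover obtain z2 where "x < z2" "z2 < x + 1" "ln x = Digamma z2" using *[of x] assms by auto
  ultimately show ?thesis
    using assms Digamma_real_mono[of z1 x] Digamma_real_mono[of x z2] by auto
qed

lemma pair_interaction_pos:
  assumes "\<theta> > 0" "u \<ge> \<theta>"
  shows "pair_interaction \<theta> u > 0"
  using assms unfolding pair_interaction_def
  by (auto intro!: divide_pos_pos mult_pos_pos Gamma_real_pos)

lemma ln_pair_interaction:
  assumes "\<theta> > 0" "u \<ge> \<theta>"
  shows "ln (pair_interaction \<theta> u) = ln u + ln_Gamma (u + \<theta>) - ln_Gamma (u + 1 - \<theta>)"
proof -
  have u: "u > 0" "u + \<theta> > 0" "u + 1 - \<theta> > 0" using assms by auto
  have G: "Gamma u > 0" "Gamma (u + \<theta>) > 0" "Gamma (u + 1 - \<theta>) > 0"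
    using u by (auto intro!: Gamma_real_pos)
  have "Gamma (u + 1) = u * Gamma u" using u by (intro Gamma_plus1) (auto elim: nonpos_Ints_cases)
  then have "pair_interaction \<theta> u = u * Gamma (u + \<theta>) / Gamma (u + 1 - \<theta>)"
    using G(1) by (simp add: pair_interaction_def)
  then have "ln (pair_interaction \<theta> u) = ln u + ln (Gamma (u + \<theta>)) - ln (Gamma (u + 1 - \<theta>))"
    using u(1) G(2,3) ln_mult_pos[of u "Gamma (u + \<theta>)"] by (simp add: ln_div)
  then show ?thesis using u by (simp only: ln_Gamma_real_pos)
qed

text \<open>
  After cancelling \<open>\<Gamma>(u+1) / \<Gamma>(u) = u\<close>, the mean value theorem for \<open>ln_Gamma\<close> on the interval between
  \<open>u + 1 - \<theta>\<close> and \<open>u + \<theta>\<close>, of signed length \<open>2\<theta> - 1\<close>, leaves a value of Digamma that differs from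
  \<open>ln u\<close> by \<open>O(1/u)\<close>.
\<close>

lemma ln_pair_interaction_asymp_large:
  assumes "\<theta> > 0" "D = \<theta> + 2" "u \<ge> 2 * D"
  shows "\<bar>ln (pair_interaction \<theta> u) - 2 * \<theta> * ln u\<bar> \<le> (2 * \<theta> + 1) * (2 * D / u)"
proof -
  have dig: "\<bar>Digamma z - ln u\<bar> \<le> 2 * D / u" if "u + 1 - D \<le> z" "z \<le> u + D" for z
  proof -
    have z1: "z > 1" using that assms by auto
    have "Digamma z \<le> ln (u + D)"
      using Digamma_real_bounds[OF z1] that z1 assms by (meson ln_mono order_trans less_trans zero_less_one)
    also have "ln (u + D) = ln u + ln (1 + D / u)"
    proof -
      have "u > 0" "1 + D / u > 0" "u + D = u * (1 + D / u)"
        using assms by (auto simp: field_simps intro!: add_pos_nonneg)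
      then show ?thesis by (metis ln_mult_pos)
    qed
    also have "ln (1 + D / u) \<le> D / u" using assms by (intro ln_add_one_self_le_self) auto
    finally have 1: "Digamma z \<le> ln u + D / u" by simp
    have "ln (u - D) \<le> Digamma z"
      using Digamma_real_bounds[OF z1] that z1 assms by (smt (verit) ln_mono)
    moreover have "ln (u / (u - D)) \<le> u / (u - D) - 1" using assms by (intro ln_le_minus_one) auto
    moreover have "ln (u / (u - D)) = ln u - ln (u - D)" using assms by (simp add: ln_div)
    moreover have "u / (u - D) - 1 = D / (u - D)" using assms by (simp add: field_simps)
    moreover have "D / (u - D) \<le> 2 * D / u"
    proof -
      have "D / (u - D) \<le> D / (u / 2)" using assms by (intro divide_left_mono) auto
      then show ?thesis by (simp add: mult.commute)
    qed
    ultimately have 2: "ln u - 2 * D / u \<le> Digamma z" by linarith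
    have "D / u \<le> 2 * D / u" using assms by (intro divide_right_mono) auto
    then show ?thesis using 1 2 by linarith
  qed
  have mvt: "\<exists>z. a \<le> z \<and> z \<le> b \<and> ln_Gamma b - ln_Gamma a = (b - a) * Digamma z"
    if "0 < a" "a \<le> b" for a b :: real
  proof (cases "a = b")
    case False
    have "\<exists>z. a < z \<and> z < b \<and> ln_Gamma b - ln_Gamma a = (b - a) * Digamma z"
      using that False by (intro MVT2) (auto intro!: has_field_derivative_ln_Gamma_real)
    then show ?thesis by (auto intro: less_imp_le)
  qed auto
  obtain z where z: "u + 1 - D \<le> z" "z \<le> u + D"
    "ln_Gamma (u + \<theta>) - ln_Gamma (u + 1 - \<theta>) = (2 * \<theta> - 1) * Digamma z"
  proof (cases "u + 1 - \<theta> \<le> u + \<theta>")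
    case True
    then obtain z where "u + 1 - \<theta> \<le> z" "z \<le> u + \<theta>"
      "ln_Gamma (u + \<theta>) - ln_Gamma (u + 1 - \<theta>) = (u + \<theta> - (u + 1 - \<theta>)) * Digamma z"
      using mvt[of "u + 1 - \<theta>" "u + \<theta>"] assms by auto
    then show ?thesis using assms that[of z] by auto
  next
    case False
    then obtain z where "u + \<theta> \<le> z" "z \<le> u + 1 - \<theta>"
      "ln_Gamma (u + 1 - \<theta>) - ln_Gamma (u + \<theta>) = (u + 1 - \<theta> - (u + \<theta>)) * Digamma z"
      using mvt[of "u + \<theta>" "u + 1 - \<theta>"] assms by auto
    then show ?thesis using assms that[of z] by (auto simp: algebra_simps)
  qed
  have "ln (pair_interaction \<theta> u) - 2 * \<theta> * ln u = (2 * \<theta> - 1) * (Digamma z - ln u)"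
    using ln_pair_interaction[of \<theta> u] assms z(3) by (simp add: algebra_simps)
  then have "\<bar>ln (pair_interaction \<theta> u) - 2 * \<theta> * ln u\<bar> = \<bar>2 * \<theta> - 1\<bar> * \<bar>Digamma z - ln u\<bar>"
    by (simp add: abs_mult)
  also have "\<dots> \<le> (2 * \<theta> + 1) * (2 * D / u)"
    using dig[OF z(1,2)] assms by (intro mult_mono) auto
  finally show ?thesis .
qed

text \<open>
  The exact order of the error is \<open>1/u\<close>. The weaker \<open>1 / sqrt u\<close> is kept because sums of it over
  separated points are needed anyway for the error of \<open>trunc_log\<close>.
\<close>

lemma ln_pair_interaction_asymp:
  assumes "\<theta> > 0"
  obtains C where "C \<ge> 0"
    "\<And>u. u \<ge> \<theta> \<Longrightarrow> \<bar>ln (pair_interaction \<theta> u) - 2 * \<theta> * ln u\<bar> \<le> C / sqrt u"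
proof -
  define D where "D = \<theta> + 2"
  define h where "h u = sqrt u * (ln (pair_interaction \<theta> u) - 2 * \<theta> * ln u)" for u
  define h' where "h' u = sqrt u * (ln u + ln_Gamma (u + \<theta>) - ln_Gamma (u + 1 - \<theta>) - 2 * \<theta> * ln u)" for u
  have ln_Gamma_cont: "continuous_on {0<..} (ln_Gamma :: real \<Rightarrow> real)"
    by (intro continuous_at_imp_continuous_on ballI DERIV_isCont[OF has_field_derivative_ln_Gamma_real]) auto
  have "continuous_on {\<theta>..2 * D} h'"
    unfolding h'_def using assms
    by (intro continuous_intros continuous_on_compose2[OF ln_Gamma_cont]) auto
  then have "bounded (h' ` {\<theta>..2 * D})"
    by (intro compact_imp_bounded compact_continuous_image) auto
  then obtain B where B: "\<forall>u\<in>{\<theta>..2 * D}. \<bar>h' u\<bar> \<le> B"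
    by (auto simp: bounded_iff)
  have hh': "h u = h' u" if "u \<ge> \<theta>" for u
    using that assms by (simp add: h_def h'_def ln_pair_interaction)
  define C where "C = max 0 B + (2 * \<theta> + 1) * (2 * D)"
  have C0: "C \<ge> 0" using assms by (auto simp: C_def D_def intro!: add_nonneg_nonneg)
  have "\<bar>h u\<bar> \<le> C" if "u \<ge> \<theta>" for u
  proof (cases "u \<le> 2 * D")
    case True
    then have "\<bar>h u\<bar> \<le> B" using B hh'[of u] that by auto
    moreover have "(2 * \<theta> + 1) * (2 * D) \<ge> 0" using assms by (auto simp: D_def)
    ultimately show ?thesis unfolding C_def by linarith
  next
    case False
    have u1: "u \<ge> 1" using False assms by (auto simp: D_def)
    have "\<bar>h u\<bar> = sqrt u * \<bar>ln (pair_interaction \<theta> u) - 2 * \<theta> * ln u\<bar>"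
      using u1 by (simp add: h_def abs_mult)
    also have "\<dots> \<le> sqrt u * ((2 * \<theta> + 1) * (2 * D / u))"
      using ln_pair_interaction_asymp_large[OF assms D_def, of u] False u1 by (intro mult_left_mono) auto
    also have "\<dots> = (sqrt u / u) * ((2 * \<theta> + 1) * (2 * D))"
      by simp
    also have "\<dots> \<le> 1 * ((2 * \<theta> + 1) * (2 * D))"
    proof (intro mult_right_mono)
      show "sqrt u / u \<le> 1" using u1 real_le_lsqrt[of u u] by (simp add: power2_eq_square mult_le_cancel_left1)
    qed (use assms in \<open>auto simp: D_def\<close>)
    finally show ?thesis unfolding C_def by simp
  qed
  then have "\<bar>ln (pair_interaction \<theta> u) - 2 * \<theta> * ln u\<bar> \<le> C / sqrt u" if "u \<ge> \<theta>" for u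
  proof -
    have "sqrt u > 0" using that assms by simp
    then show ?thesis using \<open>\<And>u. u \<ge> \<theta> \<Longrightarrow> \<bar>h u\<bar> \<le> C\<close>[OF that]
      by (simp add: h_def abs_mult pos_le_divide_eq mult.commute)
  qed
  with C0 show ?thesis using that by blast
qed

lemma sum_inverse_sqrt_le: "(\<Sum>k = 1..n. 1 / sqrt (real k)) \<le> 2 * sqrt (real n)"
proof (induction n)
  case (Suc n)
  have "1 / sqrt (real (Suc n)) \<le> 2 * (sqrt (real (Suc n)) - sqrt (real n))"
  proof -
    have "(sqrt (real (Suc n)) - sqrt (real n)) * (sqrt (real (Suc n)) + sqrt (real n)) = 1"
      by (simp add: algebra_simps)
    moreover have "sqrt (real n) \<le> sqrt (real (Suc n))" by simp
    ultimately have "1 \<le> (sqrt (real (Suc n)) - sqrt (real n)) * (2 * sqrt (real (Suc n)))"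
      by (smt (verit, best) mult_left_mono)
    then show ?thesis by (simp add: field_simps del: of_nat_Suc)
  qed
  with Suc show ?case by (simp del: of_nat_Suc)
qed simp

text \<open>
  The point \<open>x j\<close> is at distance at least \<open>g * \<bar>i - j\<bar>\<close> from \<open>x i\<close>, so each inner sum is at most twice
  the sum of \<open>1 / sqrt (g * k)\<close> over \<open>k \<le> N\<close>.
\<close>

lemma sum_inverse_sqrt_gaps_le:
  fixes x :: "nat \<Rightarrow> real"
  assumes "g > 0" and gap: "\<And>i j. i \<in> {1..N} \<Longrightarrow> j \<in> {1..N} \<Longrightarrow> i < j \<Longrightarrow> g * real (j - i) \<le> x j - x i"
  shows "(\<Sum>i\<in>{1..N}. \<Sum>j\<in>{1..N} - {i}. 1 / sqrt \<bar>x i - x j\<bar>) \<le> 4 * real N * sqrt (real N) / sqrt g"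
proof -
  define f where "f k = 1 / sqrt (g * real k)" for k :: nat
  have f0: "f k \<ge> 0" for k using assms(1) by (simp add: f_def)
  have le: "1 / sqrt \<bar>x i - x j\<bar> \<le> f (if i < j then j - i else i - j)"
    if "i \<in> {1..N}" "j \<in> {1..N} - {i}" for i j
  proof -
    have "g * real (if i < j then j - i else i - j) \<le> \<bar>x i - x j\<bar>"
      using gap[of i j] gap[of j i] that by (auto simp: abs_if)
    moreover have "0 < g * real (if i < j then j - i else i - j)" using that assms(1) by auto
    ultimately show ?thesis unfolding f_def by (intro divide_left_mono mult_pos_pos) auto
  qed
  have fsum: "(\<Sum>k\<in>{1..N}. f k) \<le> 2 * sqrt (real N) / sqrt g"
  proof -
    have "(\<Sum>k\<in>{1..N}. f k) = (\<Sum>k = 1..N. 1 / sqrt (real k)) / sqrt g"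
      by (simp add: f_def real_sqrt_mult sum_divide_distrib field_simps)
    also have "\<dots> \<le> 2 * sqrt (real N) / sqrt g"
      using assms(1) by (intro divide_right_mono sum_inverse_sqrt_le) auto
    finally show ?thesis .
  qed
  have "(\<Sum>j\<in>{1..N} - {i}. 1 / sqrt \<bar>x i - x j\<bar>) \<le> 4 * sqrt (real N) / sqrt g" if i: "i \<in> {1..N}" for i
  proof -
    have "(\<Sum>j\<in>{1..N} - {i}. 1 / sqrt \<bar>x i - x j\<bar>) \<le> (\<Sum>j\<in>{1..N} - {i}. f (if i < j then j - i else i - j))"
      using le i by (intro sum_mono) auto
    also have "\<dots> = (\<Sum>j\<in>{i<..N} \<union> {1..<i}. f (if i < j then j - i else i - j))"
      using i by (intro sum.cong) auto
    also have "(\<Sum>j\<in>{i<..N} \<union> {1..<i}. f (if i < j then j - i else i - j))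
      = (\<Sum>j\<in>{i<..N}. f (j - i)) + (\<Sum>j\<in>{1..<i}. f (i - j))"
      by (subst sum.union_disjoint) (auto intro!: sum.cong arg_cong2[where f="(+)"])
    also have "(\<Sum>j\<in>{i<..N}. f (j - i)) = (\<Sum>k\<in>{1..N - i}. f k)"
      by (rule sum.reindex_bij_witness[of _ "\<lambda>k. k + i" "\<lambda>j. j - i"]) auto
    also have "(\<Sum>j\<in>{1..<i}. f (i - j)) = (\<Sum>k\<in>{1..<i}. f k)"
      by (rule sum.reindex_bij_witness[of _ "\<lambda>k. i - k" "\<lambda>j. i - j"]) auto
    also have "(\<Sum>k\<in>{1..N - i}. f k) \<le> (\<Sum>k\<in>{1..N}. f k)" using f0 by (intro sum_mono2) auto
    also have "(\<Sum>k\<in>{1..<i}. f k) \<le> (\<Sum>k\<in>{1..N}. f k)" using f0 i by (intro sum_mono2) auto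
    finally have "(\<Sum>j\<in>{1..N} - {i}. 1 / sqrt \<bar>x i - x j\<bar>) \<le> (\<Sum>k\<in>{1..N}. f k) + (\<Sum>k\<in>{1..N}. f k)"
      by simp
    moreover have "4 * sqrt (real N) / sqrt g = 2 * (2 * sqrt (real N) / sqrt g)" by simp
    ultimately show ?thesis using fsum by linarith
  qed
  then have "(\<Sum>i\<in>{1..N}. \<Sum>j\<in>{1..N} - {i}. 1 / sqrt \<bar>x i - x j\<bar>) \<le> (\<Sum>i\<in>{1..N}. 4 * sqrt (real N) / sqrt g)"
    by (rule sum_mono)
  then show ?thesis by (simp add: mult_ac)
qed

section \<open>Integrals over compact intervals\<close>

abbreviation lebesgue_Icc :: "real \<Rightarrow> real \<Rightarrow> real measure" where
  "lebesgue_Icc a b \<equiv> restrict_space lborel {a..b}"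

lemma space_lebesgue_Icc [simp]: "space (lebesgue_Icc a b) = {a..b}"
  by (simp add: space_restrict_space)

lemma finite_measure_lebesgue_Icc: "finite_measure (lebesgue_Icc a b)"
  by (rule finite_measureI) (simp add: emeasure_restrict_space emeasure_lborel_Icc_eq)

lemma measurable_lebesgue_Icc:
  "f \<in> borel_measurable borel \<Longrightarrow> f \<in> borel_measurable (lebesgue_Icc a b)"
  by (intro measurable_restrict_space1) simp

text \<open>
  Measurability on products of restricted spaces is inherited from the plane, where the measurability
  prover applies directly.
\<close>

lemma measurable_pair_lebesgue_Icc:
  assumes "(\<lambda>p. f (fst p) (snd p)) \<in> borel_measurable (borel \<Otimes>\<^sub>M borel)"
  shows "(\<lambda>p. f (fst p) (snd p)) \<in> borel_measurable (lebesgue_Icc a b \<Otimes>\<^sub>M lebesgue_Icc c d)"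
proof -
  have 1: "(\<lambda>x. x) \<in> borel_measurable (lebesgue_Icc u v)" for u v
    by (rule measurable_lebesgue_Icc) simp
  have "(\<lambda>p. (fst p, snd p)) \<in> (lebesgue_Icc a b \<Otimes>\<^sub>M lebesgue_Icc c d) \<rightarrow>\<^sub>M (borel \<Otimes>\<^sub>M borel)"
    by (intro measurable_Pair measurable_compose[OF measurable_fst 1] measurable_compose[OF measurable_snd 1])
  from measurable_compose[OF this assms] show ?thesis by simp
qed

lemma integrable_lebesgue_Icc:
  fixes f :: "real \<Rightarrow> real"
  assumes "f \<in> borel_measurable borel" "\<And>x. x \<in> {a..b} \<Longrightarrow> \<bar>f x\<bar> \<le> C"
  shows "integrable (lebesgue_Icc a b) f"
proof -
  interpret finite_measure "lebesgue_Icc a b" by (rule finite_measure_lebesgue_Icc)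
  show ?thesis
    using assms by (intro integrable_const_bound[where B=C] measurable_lebesgue_Icc AE_I2) auto
qed

lemma integral_lebesgue_Icc_lborel:
  "(\<integral>x. f x \<partial>lebesgue_Icc a b) = (\<integral>x. indicator {a..b} x * (f x :: real) \<partial>lborel)"
  by (subst integral_restrict_space) (auto simp: set_lebesgue_integral_def)

lemma measurable_integral_lebesgue_Icc:
  fixes f :: "'a \<Rightarrow> real \<Rightarrow> real"
  assumes "(\<lambda>p. f (fst p) (snd p)) \<in> borel_measurable (N \<Otimes>\<^sub>M borel)"
  shows "(\<lambda>x. \<integral>y. f x y \<partial>lebesgue_Icc a b) \<in> borel_measurable N"
proof -
  have "(\<lambda>p. indicator {a..b} (snd p) * f (fst p) (snd p)) \<in> borel_measurable (N \<Otimes>\<^sub>M borel)"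
    using assms by measurable
  then have "(\<lambda>p. indicator {a..b} (snd p) * f (fst p) (snd p)) \<in> borel_measurable (N \<Otimes>\<^sub>M lborel)"
    by (simp cong: measurable_cong_sets add: sets_pair_measure_cong[OF refl sets_lborel])
  then have "case_prod (\<lambda>x y. indicator {a..b} y * f x y) \<in> borel_measurable (N \<Otimes>\<^sub>M lborel)"
    by (simp add: case_prod_beta')
  from lborel.borel_measurable_lebesgue_integral[OF this]
  show ?thesis by (simp add: integral_lebesgue_Icc_lborel)
qed

lemma integral_lebesgue_Icc_abs_le:
  fixes f :: "real \<Rightarrow> real"
  assumes "f \<in> borel_measurable borel" "\<And>x. x \<in> {a..b} \<Longrightarrow> \<bar>f x\<bar> \<le> C" "a \<le> b"
  shows "\<bar>\<integral>x. f x \<partial>lebesgue_Icc a b\<bar> \<le> (b - a) * C"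
proof -
  have "\<bar>\<integral>x. f x \<partial>lebesgue_Icc a b\<bar> \<le> (\<integral>x. \<bar>f x\<bar> \<partial>lebesgue_Icc a b)"
    by (rule integral_abs_bound)
  also have "\<dots> \<le> (\<integral>x. C \<partial>lebesgue_Icc a b)"
    using assms by (intro integral_mono integrable_lebesgue_Icc[where C=C] integrable_lebesgue_Icc[where C="\<bar>C\<bar>"]) auto
  also have "\<dots> = (b - a) * C"
    using assms by (simp add: measure_restrict_space)
  finally show ?thesis .
qed

lemma Fubini_lebesgue_Icc:
  fixes f :: "real \<Rightarrow> real \<Rightarrow> real"
  assumes "(\<lambda>p. f (fst p) (snd p)) \<in> borel_measurable (borel \<Otimes>\<^sub>M borel)"
    and "\<And>x y. x \<in> {a..b} \<Longrightarrow> y \<in> {c..d} \<Longrightarrow> \<bar>f x y\<bar> \<le> C"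
  shows "(\<integral>x. \<integral>y. f x y \<partial>lebesgue_Icc c d \<partial>lebesgue_Icc a b)
    = (\<integral>y. \<integral>x. f x y \<partial>lebesgue_Icc a b \<partial>lebesgue_Icc c d)"
proof -
  interpret A: finite_measure "lebesgue_Icc a b" by (rule finite_measure_lebesgue_Icc)
  interpret C: finite_measure "lebesgue_Icc c d" by (rule finite_measure_lebesgue_Icc)
  interpret pair_sigma_finite "lebesgue_Icc a b" "lebesgue_Icc c d" ..
  interpret P: finite_measure "lebesgue_Icc a b \<Otimes>\<^sub>M lebesgue_Icc c d"
    by (rule finite_measure_pair_measure) (rule A.finite_measure_axioms C.finite_measure_axioms)+
  have "integrable (lebesgue_Icc a b \<Otimes>\<^sub>M lebesgue_Icc c d) (\<lambda>p. f (fst p) (snd p))"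
    using assms(2) by (intro P.integrable_const_bound[where B=C] AE_I2 measurable_pair_lebesgue_Icc assms(1))
      (auto simp: space_pair_measure)
  then have "integrable (lebesgue_Icc a b \<Otimes>\<^sub>M lebesgue_Icc c d) (case_prod f)"
    by (simp add: case_prod_beta')
  from Fubini_integral[OF this] show ?thesis by simp
qed

lemma integrable_integral_lebesgue_Icc:
  fixes f :: "real \<Rightarrow> real \<Rightarrow> real"
  assumes "(\<lambda>p. f (fst p) (snd p)) \<in> borel_measurable (borel \<Otimes>\<^sub>M borel)"
    and "\<And>x y. x \<in> {a..b} \<Longrightarrow> y \<in> {c..d} \<Longrightarrow> \<bar>f x y\<bar> \<le> C" "c \<le> d"
  shows "integrable (lebesgue_Icc a b) (\<lambda>x. \<integral>y. f x y \<partial>lebesgue_Icc c d)"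
proof (rule integrable_lebesgue_Icc)
  show "(\<lambda>x. \<integral>y. f x y \<partial>lebesgue_Icc c d) \<in> borel_measurable borel"
    by (rule measurable_integral_lebesgue_Icc) fact
  fix x assume x: "x \<in> {a..b}"
  have "(\<lambda>y. f x y) \<in> borel_measurable borel"
    using measurable_compose[OF measurable_Pair1' assms(1), of x] by simp
  then show "\<bar>\<integral>y. f x y \<partial>lebesgue_Icc c d\<bar> \<le> (d - c) * C"
    using assms x by (intro integral_lebesgue_Icc_abs_le) auto
qed

lemma continuous_bounded_on_Icc:
  fixes f :: "real \<Rightarrow> real"
  assumes "continuous_on UNIV f"
  obtains C where "C \<ge> 0" "\<And>x. x \<in> {a..b} \<Longrightarrow> \<bar>f x\<bar> \<le> C"
proof -
  have "compact (f ` {a..b})"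
    using assms by (intro compact_continuous_image) (auto intro: continuous_on_subset)
  then obtain C where C: "\<forall>x\<in>{a..b}. \<bar>f x\<bar> \<le> C"
    by (auto dest!: compact_imp_bounded simp: bounded_iff)
  show thesis
    by (rule that[of "max 0 C"]) (use C in \<open>auto intro: max.coboundedI2\<close>)
qed

lemma lipschitz_measurable_bounded:
  fixes g :: "real \<Rightarrow> real"
  assumes lip: "\<And>x y. \<bar>g x - g y\<bar> \<le> K * \<bar>x - y\<bar>"
  shows "K \<ge> 0" "g \<in> borel_measurable borel" "x \<in> {-B..B} \<Longrightarrow> \<bar>g x\<bar> \<le> \<bar>g 0\<bar> + K * B"
    "continuous_on A g"
proof -
  show K: "K \<ge> 0" using lip[of 0 1] by auto
  have "K-lipschitz_on UNIV g" using lip K by (intro lipschitz_onI) (auto simp: dist_real_def)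
  then have gc: "continuous_on UNIV g" by (rule lipschitz_on_continuous_on)
  then show "g \<in> borel_measurable borel" by (rule borel_measurable_continuous_onI)
  show "continuous_on A g" using gc continuous_on_subset by blast
  assume "x \<in> {-B..B}"
  then have "K * \<bar>x\<bar> \<le> K * B" using K by (intro mult_left_mono) auto
  then show "\<bar>g x\<bar> \<le> \<bar>g 0\<bar> + K * B" using lip[of x 0] by simp
qed

lemma measurable_section:
  assumes "(\<lambda>p. f (fst p) (snd p)) \<in> borel_measurable (borel \<Otimes>\<^sub>M borel)"
  shows "(\<lambda>y. f (x :: real) (y :: real) :: real) \<in> borel_measurable borel"
  using measurable_compose[OF measurable_Pair1' assms, of x] by simp

lemma mult3_abs_le: "\<bar>u\<bar> \<le> A \<Longrightarrow> \<bar>v\<bar> \<le> D \<Longrightarrow> \<bar>w\<bar> \<le> D \<Longrightarrow> \<bar>u * v * w\<bar> \<le> A * D * (D :: real)"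
  unfolding abs_mult by (intro mult_mono mult_nonneg_nonneg) auto

text \<open>
  By Fubini's theorem, the energy of a mixture of kernels is the mixture of their energies.
\<close>

lemma double_integral_swap_parameter:
  fixes k :: "real \<Rightarrow> real \<Rightarrow> real \<Rightarrow> real" and \<sigma> \<tau> :: "real \<Rightarrow> real"
  assumes k: "(\<lambda>q. k (fst q) (fst (snd q)) (snd (snd q))) \<in> borel_measurable (borel \<Otimes>\<^sub>M (borel \<Otimes>\<^sub>M borel))"
    and kb: "\<And>t x y. t \<in> {c..d} \<Longrightarrow> x \<in> {a..b} \<Longrightarrow> y \<in> {a..b} \<Longrightarrow> \<bar>k t x y\<bar> \<le> C"
    and [measurable]: "\<sigma> \<in> borel_measurable borel" "\<tau> \<in> borel_measurable borel"
    and b: "\<And>x. x \<in> {a..b} \<Longrightarrow> \<bar>\<sigma> x\<bar> \<le> D" "\<And>x. x \<in> {a..b} \<Longrightarrow> \<bar>\<tau> x\<bar> \<le> D"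
    and ab: "a \<le> b"
  shows "(\<integral>x. \<integral>y. (\<integral>t. k t x y \<partial>lebesgue_Icc c d) * \<sigma> x * \<tau> y \<partial>lebesgue_Icc a b \<partial>lebesgue_Icc a b)
    = (\<integral>t. \<integral>x. \<integral>y. k t x y * \<sigma> x * \<tau> y \<partial>lebesgue_Icc a b \<partial>lebesgue_Icc a b \<partial>lebesgue_Icc c d)"
proof -
  have km [measurable]: "(\<lambda>x. k (f x) (g x) (h x)) \<in> borel_measurable N"
    if [measurable]: "f \<in> borel_measurable N" "g \<in> borel_measurable N" "h \<in> borel_measurable N"
    for f g h and N :: "'n measure"
  proof -
    have "(\<lambda>x. (f x, g x, h x)) \<in> N \<rightarrow>\<^sub>M (borel \<Otimes>\<^sub>M (borel \<Otimes>\<^sub>M borel))" by measurable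
    from measurable_compose[OF this k] show ?thesis by simp
  qed
  have kb': "\<bar>k t x y * \<sigma> x * \<tau> y\<bar> \<le> C * D * D"
    if "t \<in> {c..d}" "x \<in> {a..b}" "y \<in> {a..b}" for t x y
    using kb[OF that] b that by (intro mult3_abs_le) auto
  have "(\<integral>x. \<integral>y. (\<integral>t. k t x y \<partial>lebesgue_Icc c d) * \<sigma> x * \<tau> y \<partial>lebesgue_Icc a b \<partial>lebesgue_Icc a b)
    = (\<integral>x. \<integral>y. \<integral>t. k t x y * \<sigma> x * \<tau> y \<partial>lebesgue_Icc c d \<partial>lebesgue_Icc a b \<partial>lebesgue_Icc a b)"
    by simp
  also have "\<dots> = (\<integral>x. \<integral>t. \<integral>y. k t x y * \<sigma> x * \<tau> y \<partial>lebesgue_Icc a b \<partial>lebesgue_Icc c d \<partial>lebesgue_Icc a b)"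
    using kb' by (intro Bochner_Integration.integral_cong refl Fubini_lebesgue_Icc[where C="C * D * D"])
      (auto intro!: borel_measurable_times km measurable_compose[OF _ \<open>\<tau> \<in> _\<close>])
  also have "\<dots> = (\<integral>t. \<integral>x. \<integral>y. k t x y * \<sigma> x * \<tau> y \<partial>lebesgue_Icc a b \<partial>lebesgue_Icc a b \<partial>lebesgue_Icc c d)"
  proof (rule Fubini_lebesgue_Icc[where C="(b - a) * (C * D * D)"])
    have "(\<lambda>q. k (snd (fst q)) (fst (fst q)) (snd q) * \<sigma> (fst (fst q)) * \<tau> (snd q))
      \<in> borel_measurable ((borel \<Otimes>\<^sub>M borel) \<Otimes>\<^sub>M borel)"
      by measurable
    then show "(\<lambda>p. \<integral>y. k (snd p) (fst p) y * \<sigma> (fst p) * \<tau> y \<partial>lebesgue_Icc a b) \<in> borel_measurable (borel \<Otimes>\<^sub>M borel)"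
      by (rule measurable_integral_lebesgue_Icc[of "\<lambda>p y. k (snd p) (fst p) y * \<sigma> (fst p) * \<tau> y"])
    fix x t assume "x \<in> {a..b}" "t \<in> {c..d}"
    then show "\<bar>\<integral>y. k t x y * \<sigma> x * \<tau> y \<partial>lebesgue_Icc a b\<bar> \<le> (b - a) * (C * D * D)"
      using kb' ab by (intro integral_lebesgue_Icc_abs_le) measurable
  qed
  finally show ?thesis .
qed

lemma double_integral_linear:
  fixes f g :: "real \<Rightarrow> real \<Rightarrow> real"
  assumes "(\<lambda>p. f (fst p) (snd p)) \<in> borel_measurable (borel \<Otimes>\<^sub>M borel)"
    "(\<lambda>p. g (fst p) (snd p)) \<in> borel_measurable (borel \<Otimes>\<^sub>M borel)"
    "\<And>x y. x \<in> {a..b} \<Longrightarrow> y \<in> {a..b} \<Longrightarrow> \<bar>f x y\<bar> \<le> C"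
    "\<And>x y. x \<in> {a..b} \<Longrightarrow> y \<in> {a..b} \<Longrightarrow> \<bar>g x y\<bar> \<le> C" "a \<le> b"
  shows "(\<integral>x. \<integral>y. s * f x y + t * g x y \<partial>lebesgue_Icc a b \<partial>lebesgue_Icc a b)
    = s * (\<integral>x. \<integral>y. f x y \<partial>lebesgue_Icc a b \<partial>lebesgue_Icc a b)
      + t * (\<integral>x. \<integral>y. g x y \<partial>lebesgue_Icc a b \<partial>lebesgue_Icc a b)"
proof -
  have "integrable (lebesgue_Icc a b) (\<lambda>x. \<integral>y. f x y \<partial>lebesgue_Icc a b)"
    "integrable (lebesgue_Icc a b) (\<lambda>x. \<integral>y. g x y \<partial>lebesgue_Icc a b)"
    using assms by (auto intro!: integrable_integral_lebesgue_Icc[where C=C])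
  moreover have "(\<integral>y. s * f x y + t * g x y \<partial>lebesgue_Icc a b)
    = s * (\<integral>y. f x y \<partial>lebesgue_Icc a b) + t * (\<integral>y. g x y \<partial>lebesgue_Icc a b)"
    if "x \<in> {a..b}" for x
  proof -
    have "integrable (lebesgue_Icc a b) (f x)" "integrable (lebesgue_Icc a b) (g x)"
      using assms that by (auto intro!: integrable_lebesgue_Icc[where C=C] measurable_section[of f x] measurable_section[of g x])
    then show ?thesis by simp
  qed
  moreover have "(\<integral>x. \<integral>y. s * f x y + t * g x y \<partial>lebesgue_Icc a b \<partial>lebesgue_Icc a b)
    = (\<integral>x. s * (\<integral>y. f x y \<partial>lebesgue_Icc a b) + t * (\<integral>y. g x y \<partial>lebesgue_Icc a b) \<partial>lebesgue_Icc a b)"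
    using calculation(3) by (intro Bochner_Integration.integral_cong refl) auto
  ultimately show ?thesis by simp
qed

section \<open>Negative definiteness of the truncated logarithm\<close>

text \<open>
  Models the difference of two probability densities of height at most \<open>D\<close> on \<open>[-B, B]\<close>.
\<close>

locale neutral_density =
  fixes B D :: real and \<sigma> :: "real \<Rightarrow> real"
  assumes meas [measurable]: "\<sigma> \<in> borel_measurable borel"
    and bounded: "\<And>x. x \<in> {-B..B} \<Longrightarrow> \<bar>\<sigma> x\<bar> \<le> D"
    and neutral: "(\<integral>x. \<sigma> x \<partial>lebesgue_Icc (-B) B) = 0"
    and B_pos: "B > 0"
begin

definition cumulative :: "real \<Rightarrow> real" where
  "cumulative t = (\<integral>x. indicator {x..} t * \<sigma> x \<partial>lebesgue_Icc (-B) B)"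

lemma D_nonneg: "D \<ge> 0"
  using bounded[of 0] B_pos by auto

lemma measurable_cumulative [measurable]: "cumulative \<in> borel_measurable borel"
  unfolding cumulative_def
  by (rule measurable_integral_lebesgue_Icc) (simp add: indicator_def, measurable)

text \<open>
  The tent \<open>max 0 (s - \<bar>x - y\<bar>)\<close> is the length of the set of \<open>z\<close> for which the interval \<open>[z, z + s]\<close>
  contains both \<open>x\<close> and \<open>y\<close>. Its energy is therefore the integral over \<open>z\<close> of the squared mass of
  \<open>[z, z + s]\<close>.
\<close>

lemma tent_energy_nonneg:
  assumes "0 \<le> s"
  shows "0 \<le> (\<integral>x. \<integral>y. max 0 (s - \<bar>x - y\<bar>) * \<sigma> x * \<sigma> y \<partial>lebesgue_Icc (-B) B \<partial>lebesgue_Icc (-B) B)"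
proof -
  let ?M = "lebesgue_Icc (-B) B"
  define k where "k z x y = (of_bool (z \<le> x \<and> x \<le> z + s) * of_bool (z \<le> y \<and> y \<le> z + s) :: real)" for z x y :: real
  have tent: "max 0 (s - \<bar>x - y\<bar>) = (\<integral>z. k z x y \<partial>lebesgue_Icc (-B - s) B)"
    if "x \<in> {-B..B}" "y \<in> {-B..B}" for x y
  proof -
    have "(\<integral>z. k z x y \<partial>lebesgue_Icc (-B - s) B) = (\<integral>z. indicator {max x y - s..min x y} z \<partial>lborel)"
      unfolding integral_lebesgue_Icc_lborel using that assms
      by (intro Bochner_Integration.integral_cong) (auto simp: k_def indicator_def)
    also have "\<dots> = max 0 (s - \<bar>x - y\<bar>)"
      using assms by (cases "x \<le> y"; cases "\<bar>x - y\<bar> \<le> s") (auto simp: min_def max_def)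
    finally show ?thesis by simp
  qed
  have "(\<integral>x. \<integral>y. max 0 (s - \<bar>x - y\<bar>) * \<sigma> x * \<sigma> y \<partial>?M \<partial>?M)
    = (\<integral>x. \<integral>y. (\<integral>z. k z x y \<partial>lebesgue_Icc (-B - s) B) * \<sigma> x * \<sigma> y \<partial>?M \<partial>?M)"
    using tent by (intro Bochner_Integration.integral_cong refl) auto
  also have "\<dots> = (\<integral>z. \<integral>x. \<integral>y. k z x y * \<sigma> x * \<sigma> y \<partial>?M \<partial>?M \<partial>lebesgue_Icc (-B - s) B)"
    using bounded B_pos
    by (intro double_integral_swap_parameter[where C=1 and D=D]) (auto simp: k_def)
  also have "\<dots> = (\<integral>z. (\<integral>x. of_bool (z \<le> x \<and> x \<le> z + s) * \<sigma> x \<partial>?M)\<^sup>2 \<partial>lebesgue_Icc (-B - s) B)"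
  proof (intro Bochner_Integration.integral_cong refl)
    fix z
    have "(\<integral>x. \<integral>y. k z x y * \<sigma> x * \<sigma> y \<partial>?M \<partial>?M)
      = (\<integral>x. \<integral>y. (of_bool (z \<le> x \<and> x \<le> z + s) * \<sigma> x) * (of_bool (z \<le> y \<and> y \<le> z + s) * \<sigma> y) \<partial>?M \<partial>?M)"
      by (simp add: k_def mult_ac)
    then show "(\<integral>x. \<integral>y. k z x y * \<sigma> x * \<sigma> y \<partial>?M \<partial>?M) = (\<integral>x. of_bool (z \<le> x \<and> x \<le> z + s) * \<sigma> x \<partial>?M)\<^sup>2"
      by (simp only: integral_mult_right_zero integral_mult_left_zero power2_eq_square)
  qed
  finally show ?thesis by (simp add: Bochner_Integration.integral_nonneg)
qed

text \<open>
  The distance \<open>\<bar>x - y\<bar>\<close> is the length of the set of \<open>t\<close> that separate \<open>x\<close> from \<open>y\<close>. Expanding the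
  square of the difference of the indicators of \<open>x \<le> t\<close> and \<open>y \<le> t\<close>, the terms that involve only one of
  the two points vanish, as the total mass is \<open>0\<close>.
\<close>

lemma distance_energy:
  "(\<integral>x. \<integral>y. \<bar>x - y\<bar> * \<sigma> x * \<sigma> y \<partial>lebesgue_Icc (-B) B \<partial>lebesgue_Icc (-B) B)
    = - 2 * (\<integral>t. (cumulative t)\<^sup>2 \<partial>lebesgue_Icc (-B) B)"
proof -
  let ?M = "lebesgue_Icc (-B) B"
  define h where "h x t = (of_bool (x \<le> t) :: real)" for x t :: real
  define k where "k t x y = h x t + h y t - 2 * (h x t * h y t)" for t x y :: real
  have hm [measurable]: "(\<lambda>x. h (f x) (g x)) \<in> borel_measurable N"
    if [measurable]: "f \<in> borel_measurable N" "g \<in> borel_measurable N" for f g and N :: "'n measure"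
    unfolding h_def by measurable
  have cum: "cumulative t = (\<integral>x. h x t * \<sigma> x \<partial>?M)" for t
    unfolding cumulative_def h_def by (intro Bochner_Integration.integral_cong refl) (auto simp: indicator_def)
  have dist: "\<bar>x - y\<bar> = (\<integral>t. k t x y \<partial>?M)" if "x \<in> {-B..B}" "y \<in> {-B..B}" for x y
  proof -
    have "(\<integral>t. k t x y \<partial>?M) = (\<integral>t. indicator {min x y..<max x y} t \<partial>lborel)"
      unfolding integral_lebesgue_Icc_lborel using that
      by (intro Bochner_Integration.integral_cong) (auto simp: k_def h_def indicator_def)
    also have "\<dots> = \<bar>x - y\<bar>"
      by (cases "x \<le> y") (auto simp: min_def max_def)
    finally show ?thesis by simp
  qed
  have "(\<integral>x. \<integral>y. \<bar>x - y\<bar> * \<sigma> x * \<sigma> y \<partial>?M \<partial>?M)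
    = (\<integral>x. \<integral>y. (\<integral>z. k z x y \<partial>?M) * \<sigma> x * \<sigma> y \<partial>?M \<partial>?M)"
    using dist by (intro Bochner_Integration.integral_cong refl) auto
  also have "\<dots> = (\<integral>z. \<integral>x. \<integral>y. k z x y * \<sigma> x * \<sigma> y \<partial>?M \<partial>?M \<partial>?M)"
  proof (intro double_integral_swap_parameter[where C=1 and D=D])
    show "(\<lambda>q. k (fst q) (fst (snd q)) (snd (snd q))) \<in> borel_measurable (borel \<Otimes>\<^sub>M borel \<Otimes>\<^sub>M borel)"
      unfolding k_def by measurable
  qed (use bounded B_pos in \<open>auto simp: k_def h_def\<close>)
  also have "\<dots> = (\<integral>t. - 2 * (cumulative t)\<^sup>2 \<partial>?M)"
  proof (intro Bochner_Integration.integral_cong refl)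
    fix t
    have int: "integrable ?M (\<lambda>y. h y t * \<sigma> y)" "integrable ?M \<sigma>"
      using bounded by (auto intro!: integrable_lebesgue_Icc[where C=D] simp: h_def)
         (use D_nonneg in \<open>auto simp: h_def\<close>)
    have 1: "(\<integral>y. k t x y * \<sigma> x * \<sigma> y \<partial>?M) = cumulative t * \<sigma> x - 2 * cumulative t * (h x t * \<sigma> x)" for x
    proof -
      have "(\<integral>y. k t x y * \<sigma> x * \<sigma> y \<partial>?M)
        = (\<integral>y. (h x t * \<sigma> x) * \<sigma> y + (\<sigma> x - 2 * (h x t * \<sigma> x)) * (h y t * \<sigma> y) \<partial>?M)"
        by (intro Bochner_Integration.integral_cong refl) (simp add: k_def algebra_simps)
      also have "\<dots> = (h x t * \<sigma> x) * 0 + (\<sigma> x - 2 * (h x t * \<sigma> x)) * cumulative t"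
        using int by (simp add: neutral cum)
      finally show ?thesis by (simp add: algebra_simps)
    qed
    have "(\<integral>x. \<integral>y. k t x y * \<sigma> x * \<sigma> y \<partial>?M \<partial>?M) = cumulative t * 0 - 2 * cumulative t * cumulative t"
      unfolding 1 using int by (simp add: neutral cum)
    then show "(\<integral>x. \<integral>y. k t x y * \<sigma> x * \<sigma> y \<partial>?M \<partial>?M) = - 2 * (cumulative t)\<^sup>2"
      by (simp add: power2_eq_square)
  qed
  finally show ?thesis by simp
qed

text \<open>
  In the tent representation the mixture of tents enters with a negative sign, the constant does not
  contribute, and the term \<open>\<bar>u\<bar> / (2 * B)\<close> gives the right-hand side.
\<close>

lemma trunc_log_energy_le:
  assumes "0 < r" "r \<le> 2 * B"
  shows "(\<integral>x. \<integral>y. trunc_log r (x - y) * \<sigma> x * \<sigma> y \<partial>lebesgue_Icc (-B) B \<partial>lebesgue_Icc (-B) B)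
    \<le> - (\<integral>t. (cumulative t)\<^sup>2 \<partial>lebesgue_Icc (-B) B) / B"
proof -
  let ?M = "lebesgue_Icc (-B) B"
  define k where "k s x y = max 0 (s - \<bar>x - y\<bar>) / s\<^sup>2" for s x y :: real
  define P where "P = (\<integral>x. \<integral>y. (\<integral>s. k s x y \<partial>lebesgue_Icc r (2 * B)) * \<sigma> x * \<sigma> y \<partial>?M \<partial>?M)"
  define a where "a = ln (2 * B) - 1"
  have kb: "\<bar>k s x y\<bar> \<le> 2 * B / r\<^sup>2" if "s \<in> {r..2 * B}" for s x y
  proof -
    have "max 0 (s - \<bar>x - y\<bar>) / s\<^sup>2 \<le> 2 * B / r\<^sup>2"
      using that assms by (intro frac_le power_mono) auto
    then show ?thesis by (simp add: k_def)
  qed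
  have km: "(\<lambda>q. k (fst q) (fst (snd q)) (snd (snd q))) \<in> borel_measurable (borel \<Otimes>\<^sub>M borel \<Otimes>\<^sub>M borel)"
    unfolding k_def by measurable
  have P_eq: "P = (\<integral>s. \<integral>x. \<integral>y. k s x y * \<sigma> x * \<sigma> y \<partial>?M \<partial>?M \<partial>lebesgue_Icc r (2 * B))"
    unfolding P_def using bounded B_pos kb
    by (intro double_integral_swap_parameter[OF km, where C="2 * B / r\<^sup>2" and D=D]) auto
  have P0: "P \<ge> 0"
    unfolding P_eq
  proof (rule Bochner_Integration.integral_nonneg)
    fix s assume "s \<in> space (lebesgue_Icc r (2 * B))"
    have "(\<integral>x. \<integral>y. k s x y * \<sigma> x * \<sigma> y \<partial>?M \<partial>?M)
      = (\<integral>x. \<integral>y. max 0 (s - \<bar>x - y\<bar>) * \<sigma> x * \<sigma> y \<partial>?M \<partial>?M) / s\<^sup>2"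
      unfolding k_def by simp
    moreover have "(\<integral>x. \<integral>y. max 0 (s - \<bar>x - y\<bar>) * \<sigma> x * \<sigma> y \<partial>?M \<partial>?M) / s\<^sup>2 \<ge> 0"
      using tent_energy_nonneg[of s] \<open>s \<in> _\<close> assms by (intro divide_nonneg_nonneg) auto
    ultimately show "0 \<le> (\<integral>x. \<integral>y. k s x y * \<sigma> x * \<sigma> y \<partial>?M \<partial>?M)" by simp
  qed
  have rep: "trunc_log r (x - y) = a + \<bar>x - y\<bar> / (2 * B) - (\<integral>s. k s x y \<partial>lebesgue_Icc r (2 * B))"
    if "x \<in> {-B..B}" "y \<in> {-B..B}" for x y
  proof -
    have "\<bar>x - y\<bar> \<le> 2 * B" using that by auto
    then show ?thesis
      using trunc_log_eq_tent_integral[of r "2 * B" "x - y"] assms by (simp add: k_def a_def)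
  qed
  define q where "q x y = (\<integral>s. k s x y \<partial>lebesgue_Icc r (2 * B))" for x y
  have qm: "(\<lambda>p. q (fst p) (snd p)) \<in> borel_measurable (borel \<Otimes>\<^sub>M borel)"
    unfolding q_def k_def by (rule measurable_integral_lebesgue_Icc) measurable
  have qb: "\<bar>q x y\<bar> \<le> (2 * B - r) * (2 * B / r\<^sup>2)" for x y
    unfolding q_def using kb assms
    by (intro integral_lebesgue_Icc_abs_le) (auto simp: k_def)
  define C where "C = max (\<bar>a\<bar> + 1) ((2 * B - r) * (2 * B / r\<^sup>2)) * D * D"
  have "(\<integral>x. \<integral>y. trunc_log r (x - y) * \<sigma> x * \<sigma> y \<partial>?M \<partial>?M)
    = (\<integral>x. \<integral>y. 1 * ((a + \<bar>x - y\<bar> / (2 * B)) * \<sigma> x * \<sigma> y) + (- 1) * (q x y * \<sigma> x * \<sigma> y) \<partial>?M \<partial>?M)"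
  proof (intro Bochner_Integration.integral_cong refl)
    fix x y assume "x \<in> space ?M" "y \<in> space ?M"
    then have "trunc_log r (x - y) = a + \<bar>x - y\<bar> / (2 * B) - q x y"
      unfolding q_def by (intro rep) auto
    then show "trunc_log r (x - y) * \<sigma> x * \<sigma> y
      = 1 * ((a + \<bar>x - y\<bar> / (2 * B)) * \<sigma> x * \<sigma> y) + (- 1) * (q x y * \<sigma> x * \<sigma> y)"
      by (simp only:) (simp add: algebra_simps)
  qed
  also have "\<dots> = 1 * (\<integral>x. \<integral>y. (a + \<bar>x - y\<bar> / (2 * B)) * \<sigma> x * \<sigma> y \<partial>?M \<partial>?M) + (-1) * P"
    unfolding P_def q_def[symmetric]
  proof (rule double_integral_linear)
    fix x y assume xy: "x \<in> {-B..B}" "y \<in> {-B..B}"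
    have "\<bar>x - y\<bar> / (2 * B) \<le> 1" using xy B_pos by (simp add: field_simps abs_if)
    then have "\<bar>a + \<bar>x - y\<bar> / (2 * B)\<bar> \<le> \<bar>a\<bar> + 1" using B_pos by (smt (verit) divide_nonneg_pos abs_ge_zero)
    then show "\<bar>(a + \<bar>x - y\<bar> / (2 * B)) * \<sigma> x * \<sigma> y\<bar> \<le> C"
      unfolding C_def using xy bounded by (intro mult3_abs_le) auto
    show "\<bar>q x y * \<sigma> x * \<sigma> y\<bar> \<le> C"
      unfolding C_def using xy bounded qb[of x y] by (intro mult3_abs_le) auto
  next
    show "(\<lambda>p. q (fst p) (snd p) * \<sigma> (fst p) * \<sigma> (snd p)) \<in> borel_measurable (borel \<Otimes>\<^sub>M borel)"
      using qm by measurable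
    show "- B \<le> B" using B_pos by simp
  qed measurable
  also have "\<dots> \<le> (\<integral>x. \<integral>y. (a + \<bar>x - y\<bar> / (2 * B)) * \<sigma> x * \<sigma> y \<partial>?M \<partial>?M)"
    using P0 by simp
  also have "\<dots> = (\<integral>x. \<integral>y. a * (\<sigma> x * \<sigma> y) + (1 / (2 * B)) * (\<bar>x - y\<bar> * \<sigma> x * \<sigma> y) \<partial>?M \<partial>?M)"
    by (intro Bochner_Integration.integral_cong refl) (auto simp: algebra_simps)
  also have "\<dots> = a * (\<integral>x. \<integral>y. \<sigma> x * \<sigma> y \<partial>?M \<partial>?M) + (1 / (2 * B)) * (\<integral>x. \<integral>y. \<bar>x - y\<bar> * \<sigma> x * \<sigma> y \<partial>?M \<partial>?M)"
  proof (rule double_integral_linear[where C = "max 1 (2 * B) * D * D"])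
    fix x y assume xy: "x \<in> {-B..B}" "y \<in> {-B..B}"
    show "\<bar>\<bar>x - y\<bar> * \<sigma> x * \<sigma> y\<bar> \<le> max 1 (2 * B) * D * D"
      using xy bounded by (intro mult3_abs_le) auto
    show "\<bar>\<sigma> x * \<sigma> y\<bar> \<le> max 1 (2 * B) * D * D"
      using mult3_abs_le[of 1 "max 1 (2 * B)" "\<sigma> x" D "\<sigma> y"] xy bounded by auto
  next
    show "- B \<le> B" using B_pos by simp
  qed measurable
  also have "\<dots> = - (\<integral>t. (cumulative t)\<^sup>2 \<partial>?M) / B"
    unfolding distance_energy by (simp add: neutral)
  finally show ?thesis .
qed

end

text \<open>
  An integration by parts for functions that are only Lipschitz. The average of \<open>f\<close> over \<open>[x, x + h]\<close>
  is differentiable in \<open>x\<close> with a derivative bounded by \<open>L\<close>, and differs from \<open>f\<close> by at most \<open>L * h\<close>.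
\<close>

lemma (in neutral_density) test_function_mollified:
  assumes lip: "\<And>x y. \<bar>f x - f y\<bar> \<le> L * \<bar>x - y\<bar>" and h: "h > 0"
  shows "\<bar>\<integral>x. f x * \<sigma> x \<partial>lebesgue_Icc (-B) B\<bar>
    \<le> 2 * B * (L * h * D) + L * (\<integral>t. \<bar>cumulative t\<bar> \<partial>lebesgue_Icc (-B) B)"
proof -
  let ?M = "lebesgue_Icc (-B) B"
  have L: "L \<ge> 0" using lip[of 0 1] by auto
  have fc: "continuous_on A f" for A by (rule lipschitz_measurable_bounded(4)[OF lip])
  have fm [measurable]: "f \<in> borel_measurable borel" by (rule lipschitz_measurable_bounded(2)[OF lip])
  have fint: "integrable lborel (\<lambda>t. indicator {a..<b} t * f t)" for a b
  proof -
    have "integrable lborel (\<lambda>t. indicator {a..b} t *\<^sub>R f t)"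
      by (intro borel_integrable_compact fc) auto
    then show ?thesis
      by (rule Bochner_Integration.integrable_bound) (auto simp: indicator_def)
  qed
  define G where "G a b = (\<integral>t. indicator {a..<b} t * f t \<partial>lborel)" for a b
  have G_avg: "\<bar>f x - G x (x + h) / h\<bar> \<le> L * h" for x
  proof -
    have "\<bar>h * f x - G x (x + h)\<bar> = \<bar>\<integral>t. indicator {x..<x + h} t * (f x - f t) \<partial>lborel\<bar>"
      using fint[of x "x + h"] h
      by (simp add: G_def right_diff_distrib Bochner_Integration.integral_diff)
    also have "\<dots> \<le> (\<integral>t. \<bar>indicator {x..<x + h} t * (f x - f t)\<bar> \<partial>lborel)"
      by (rule integral_abs_bound)
    also have "\<dots> \<le> (\<integral>t. indicator {x..<x + h} t * (L * h) \<partial>lborel)"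
    proof (rule integral_mono)
      have "integrable lborel (\<lambda>t. indicator {x..<x + h} t * f x - indicator {x..<x + h} t * f t)"
        using fint h by (intro Bochner_Integration.integrable_diff) auto
      then show "integrable lborel (\<lambda>t. \<bar>indicator {x..<x + h} t * (f x - f t)\<bar>)"
        by (intro Bochner_Integration.integrable_abs) (simp add: right_diff_distrib)
      fix t
      have "\<bar>f x - f t\<bar> \<le> L * h" if "t \<in> {x..<x + h}"
        using lip[of x t] mult_left_mono[of "\<bar>x - t\<bar>" h L] L that by auto
      then show "\<bar>indicator {x..<x + h} t * (f x - f t)\<bar> \<le> indicator {x..<x + h} t * (L * h)"
        by (auto simp: indicator_def)
    qed (use h in auto)
    also have "\<dots> = h * (L * h)" using h by simp
    finally have "\<bar>h * (f x - G x (x + h) / h)\<bar> \<le> h * (L * h)" using h by (simp add: right_diff_distrib)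
    then show ?thesis using h by (simp add: abs_mult)
  qed
  \<comment> \<open>the negative of the derivative of \<open>G t (t + h) / h\<close>, the average of \<open>f\<close> over \<open>[t, t + h]\<close>\<close>
  define \<phi> where "\<phi> t = (f t - f (t + h)) / h" for t
  have phi_b: "\<bar>\<phi> t\<bar> \<le> L" for t
    using lip[of t "t + h"] h by (simp add: \<phi>_def pos_divide_le_eq)
  have phi_m [measurable]: "\<phi> \<in> borel_measurable borel" unfolding \<phi>_def by measurable
  define k where "k x t = of_bool (x \<le> t) * \<phi> t" for x t
  have G_shift: "(\<integral>t. indicator {a..<b} t * f (t + h) \<partial>lborel) = G (a + h) (b + h)" for a b
    unfolding G_def
    by (subst lborel_integral_real_affine[where c=1 and t=h])
       (auto simp: indicator_def add.commute intro!: Bochner_Integration.integral_cong)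
  have G_shift_int: "integrable lborel (\<lambda>t. indicator {a..<b} t * f (t + h))" for a b
    using lborel_integrable_real_affine[OF fint[of "a + h" "b + h"], of 1 h]
    by (simp add: indicator_def add.commute)
  have kint: "(\<integral>t. k x t \<partial>?M) = G x (x + h) / h - G B (B + h) / h" if "x \<in> {-B..B}" for x
  proof -
    have split: "G x b + G b c = G x c" if "x \<le> b" "b \<le> c" for x b c
    proof -
      have "G x b + G b c = (\<integral>t. indicator {x..<b} t * f t + indicator {b..<c} t * f t \<partial>lborel)"
        unfolding G_def by (rule Bochner_Integration.integral_add[symmetric]) (rule fint)+
      also have "\<dots> = G x c"
        unfolding G_def using that
        by (intro Bochner_Integration.integral_cong) (auto simp: indicator_def)
      finally show ?thesis .
    qed
    have "(\<integral>t. k x t \<partial>?M) = (\<integral>t. indicator {x..B} t * \<phi> t \<partial>lborel)"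
      unfolding integral_lebesgue_Icc_lborel using that
      by (intro Bochner_Integration.integral_cong) (auto simp: k_def indicator_def)
    also have "\<dots> = (\<integral>t. indicator {x..<B} t * \<phi> t \<partial>lborel)"
      by (intro integral_cong_AE) (use AE_lborel_singleton[of B] in \<open>auto elim!: eventually_mono simp: indicator_def\<close>)
    also have "\<dots> = (\<integral>t. (indicator {x..<B} t * f t - indicator {x..<B} t * f (t + h)) / h \<partial>lborel)"
      by (simp add: \<phi>_def right_diff_distrib)
    also have "\<dots> = (G x B - G (x + h) (B + h)) / h"
      using fint[of x B] G_shift_int[of x B] G_shift[of x B] by (simp add: G_def)
    also have "G x B - G (x + h) (B + h) = G x (x + h) - G B (B + h)"
      using split[of x B "B + h"] split[of x "x + h" "B + h"] that h by auto
    finally show ?thesis by (simp add: diff_divide_distrib)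
  qed
  have km: "(\<lambda>p. k (fst p) (snd p)) \<in> borel_measurable (borel \<Otimes>\<^sub>M borel)"
    unfolding k_def by measurable
  define g where "g x = (\<integral>t. k x t \<partial>?M)" for x
  have gm [measurable]: "g \<in> borel_measurable borel"
    unfolding g_def by (rule measurable_integral_lebesgue_Icc[OF km])
  have gb: "\<bar>g x\<bar> \<le> (B - (-B)) * L" for x
    unfolding g_def using B_pos phi_b L
    by (intro integral_lebesgue_Icc_abs_le measurable_section[of k x] km) (auto simp: k_def)
  have gF: "(\<integral>x. g x * \<sigma> x \<partial>?M) = (\<integral>t. \<phi> t * cumulative t \<partial>?M)"
  proof -
    have "(\<integral>x. g x * \<sigma> x \<partial>?M) = (\<integral>x. \<integral>t. k x t * \<sigma> x \<partial>?M \<partial>?M)"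
      by (simp add: g_def)
    also have "\<dots> = (\<integral>t. \<integral>x. k x t * \<sigma> x \<partial>?M \<partial>?M)"
    proof (rule Fubini_lebesgue_Icc)
      show "(\<lambda>p. k (fst p) (snd p) * \<sigma> (fst p)) \<in> borel_measurable (borel \<Otimes>\<^sub>M borel)"
        using km by measurable
      show "\<bar>k x t * \<sigma> x\<bar> \<le> L * D" if "x \<in> {-B..B}" "t \<in> {-B..B}" for x t
        unfolding abs_mult using bounded[OF that(1)] phi_b[of t] L
        by (intro mult_mono) (auto simp: k_def)
    qed
    also have "\<dots> = (\<integral>t. \<phi> t * cumulative t \<partial>?M)"
    proof (intro Bochner_Integration.integral_cong refl)
      fix t
      have "(\<integral>x. k x t * \<sigma> x \<partial>?M) = (\<integral>x. \<phi> t * (indicator {x..} t * \<sigma> x) \<partial>?M)"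
        by (intro Bochner_Integration.integral_cong refl) (auto simp: k_def indicator_def)
      then show "(\<integral>x. k x t * \<sigma> x \<partial>?M) = \<phi> t * cumulative t"
        by (simp add: cumulative_def)
    qed
    finally show ?thesis .
  qed
  have cumb: "\<bar>cumulative t\<bar> \<le> (B - (-B)) * D" for t
    unfolding cumulative_def using bounded D_nonneg B_pos
    by (intro integral_lebesgue_Icc_abs_le) (auto simp: indicator_def)
  \<comment> \<open>\<open>g x\<close> is the average to the right of \<open>x\<close> minus the constant \<open>G B (B + h) / h\<close>; the constant is
    invisible to a density of total mass \<open>0\<close>\<close>
  define e where "e x = f x - G B (B + h) / h - g x" for x
  have e_b: "\<bar>e x\<bar> \<le> L * h" if "x \<in> {-B..B}" for x
    using kint[OF that] G_avg[of x] by (simp add: e_def g_def)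
  have em [measurable]: "e \<in> borel_measurable borel" unfolding e_def by measurable
  have "(\<integral>x. f x * \<sigma> x \<partial>?M) = (\<integral>x. e x * \<sigma> x + (G B (B + h) / h * \<sigma> x + g x * \<sigma> x) \<partial>?M)"
    by (intro Bochner_Integration.integral_cong refl) (simp add: e_def algebra_simps)
  also have "\<dots> = (\<integral>x. e x * \<sigma> x \<partial>?M) + (G B (B + h) / h * (\<integral>x. \<sigma> x \<partial>?M) + (\<integral>x. g x * \<sigma> x \<partial>?M))"
  proof -
    have "integrable ?M (\<lambda>x. e x * \<sigma> x)"
      using e_b bounded L h
      by (intro integrable_lebesgue_Icc[where C="L * h * D"]) (auto simp: abs_mult intro!: mult_mono)
    moreover have "integrable ?M \<sigma>"
      using bounded by (intro integrable_lebesgue_Icc[where C=D]) auto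
    moreover have "integrable ?M (\<lambda>x. g x * \<sigma> x)"
      using gb bounded L B_pos
      by (intro integrable_lebesgue_Icc[where C="(B - (-B)) * L * D"]) (auto simp: abs_mult intro!: mult_mono)
    ultimately show ?thesis by simp
  qed
  also have "\<dots> = (\<integral>x. e x * \<sigma> x \<partial>?M) + (\<integral>t. \<phi> t * cumulative t \<partial>?M)"
    by (simp add: neutral gF)
  finally have "\<bar>\<integral>x. f x * \<sigma> x \<partial>?M\<bar> \<le> \<bar>\<integral>x. e x * \<sigma> x \<partial>?M\<bar> + \<bar>\<integral>t. \<phi> t * cumulative t \<partial>?M\<bar>"
    by simp
  moreover have "\<bar>\<integral>x. e x * \<sigma> x \<partial>?M\<bar> \<le> (B - (-B)) * (L * h * D)"
    using e_b bounded L h B_pos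
    by (intro integral_lebesgue_Icc_abs_le) (auto simp: abs_mult intro!: mult_mono)
  moreover have "\<bar>\<integral>t. \<phi> t * cumulative t \<partial>?M\<bar> \<le> L * (\<integral>t. \<bar>cumulative t\<bar> \<partial>?M)"
  proof -
    have i: "integrable ?M cumulative"
      using cumb by (intro integrable_lebesgue_Icc) auto
    have "integrable ?M (\<lambda>t. \<phi> t * cumulative t)"
      using cumb phi_b L
      by (intro integrable_lebesgue_Icc[where C="L * ((B - (-B)) * D)"]) (auto simp: abs_mult intro!: mult_mono)
    then have "integrable ?M (\<lambda>t. \<bar>\<phi> t * cumulative t\<bar>)"
      by (rule Bochner_Integration.integrable_abs)
    moreover have "integrable ?M (\<lambda>t. L * \<bar>cumulative t\<bar>)"
      using i by simp
    moreover have "\<bar>\<phi> t * cumulative t\<bar> \<le> L * \<bar>cumulative t\<bar>" for t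
      unfolding abs_mult by (intro mult_right_mono phi_b) simp
    ultimately have "(\<integral>t. \<bar>\<phi> t * cumulative t\<bar> \<partial>?M) \<le> (\<integral>t. L * \<bar>cumulative t\<bar> \<partial>?M)"
      by (rule integral_mono)
    also have "\<dots> = L * (\<integral>t. \<bar>cumulative t\<bar> \<partial>?M)" by simp
    finally show ?thesis by (rule order_trans[OF integral_abs_bound])
  qed
  ultimately show ?thesis by simp
qed

text \<open>
  Let \<open>h\<close> tend to \<open>0\<close> in the mollified estimate. The free parameter \<open>a\<close> comes from
  \<open>\<bar>c\<bar> \<le> a / 2 + c\<^sup>2 / (2 * a)\<close>, which replaces the Cauchy-Schwarz inequality.
\<close>

lemma (in neutral_density) test_function_le:
  assumes lip: "\<And>x y. \<bar>f x - f y\<bar> \<le> L * \<bar>x - y\<bar>" and a: "a > 0"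
  shows "\<bar>\<integral>x. f x * \<sigma> x \<partial>lebesgue_Icc (-B) B\<bar>
    \<le> L * (a * B + (\<integral>t. (cumulative t)\<^sup>2 \<partial>lebesgue_Icc (-B) B) / (2 * a))"
proof -
  let ?M = "lebesgue_Icc (-B) B"
  have L: "L \<ge> 0" using lip[of 0 1] by auto
  have cumb: "\<bar>cumulative t\<bar> \<le> (B - (-B)) * D" for t
    unfolding cumulative_def using bounded D_nonneg B_pos
    by (intro integral_lebesgue_Icc_abs_le) (auto simp: indicator_def)
  have i1: "integrable ?M cumulative"
    using cumb by (intro integrable_lebesgue_Icc) auto
  have i2: "integrable ?M (\<lambda>t. (cumulative t)\<^sup>2)"
  proof (rule integrable_lebesgue_Icc)
    show "\<bar>(cumulative t)\<^sup>2\<bar> \<le> ((B - (-B)) * D)\<^sup>2" for t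
      using power_mono[OF cumb[of t], of 2] by simp
  qed simp
  have i3: "integrable ?M (\<lambda>t. c)" for c :: real
    by (intro integrable_lebesgue_Icc[where C="\<bar>c\<bar>"]) auto
  have "\<bar>\<integral>x. f x * \<sigma> x \<partial>?M\<bar> \<le> L * (\<integral>t. \<bar>cumulative t\<bar> \<partial>?M)"
  proof (rule field_le_epsilon)
    fix e :: real assume e: "e > 0"
    define c where "c = 2 * B * L * D + 1"
    have c: "c > 0" using B_pos L D_nonneg by (auto simp: c_def intro!: add_nonneg_pos)
    have "2 * B * (L * (e / c) * D) = e * ((c - 1) / c)"
      using c by (simp add: c_def)
    also have "e * ((c - 1) / c) \<le> e"
      using e c mult_left_mono[of "(c - 1) / c" 1 e] by simp
    finally have "2 * B * (L * (e / c) * D) \<le> e" .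
    then show "\<bar>\<integral>x. f x * \<sigma> x \<partial>?M\<bar> \<le> L * (\<integral>t. \<bar>cumulative t\<bar> \<partial>?M) + e"
      using test_function_mollified[OF lip, of "e / c"] e c by simp
  qed
  also have "(\<integral>t. \<bar>cumulative t\<bar> \<partial>?M) \<le> (\<integral>t. a / 2 + (cumulative t)\<^sup>2 / (2 * a) \<partial>?M)"
  proof (rule integral_mono)
    fix t
    have "0 \<le> (\<bar>cumulative t\<bar> - a)\<^sup>2" by simp
    then show "\<bar>cumulative t\<bar> \<le> a / 2 + (cumulative t)\<^sup>2 / (2 * a)"
      using a by (simp add: power2_eq_square field_simps)
  qed (use i1 i2 i3 in auto)
  also have "\<dots> = a * B + (\<integral>t. (cumulative t)\<^sup>2 \<partial>?M) / (2 * a)"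
    using i2 i3 B_pos by (simp add: measure_restrict_space)
  finally show ?thesis using L by (simp add: mult_left_mono)
qed

section \<open>The energy functional and its near maximizers\<close>

text \<open>
  Values outside \<open>[-B, B]\<close> are not constrained to vanish: a density is used only through
  integrals over that interval.
\<close>

definition admissible :: "real \<Rightarrow> real \<Rightarrow> (real \<Rightarrow> real) \<Rightarrow> bool" where
  "admissible \<theta> B \<rho> \<longleftrightarrow> \<rho> \<in> borel_measurable borel \<and> (\<forall>x. 0 \<le> \<rho> x \<and> \<rho> x \<le> 1 / \<theta>) \<and>
     (\<integral>x. \<rho> x \<partial>lebesgue_Icc (-B) B) = 1"

definition energy :: "real \<Rightarrow> (real \<Rightarrow> real) \<Rightarrow> real \<Rightarrow> real \<Rightarrow> (real \<Rightarrow> real) \<Rightarrow> real" where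
  "energy \<theta> V r B \<rho> =
     \<theta> * (\<integral>x. \<integral>y. trunc_log r (x - y) * \<rho> x * \<rho> y \<partial>lebesgue_Icc (-B) B \<partial>lebesgue_Icc (-B) B)
     - (\<integral>x. V x * \<rho> x \<partial>lebesgue_Icc (-B) B)"

lemma trunc_log_bounded:
  assumes "r > 0" "\<bar>u\<bar> \<le> R"
  shows "\<bar>trunc_log r u\<bar> \<le> \<bar>trunc_log r 0\<bar> + R / r"
proof -
  have "\<bar>trunc_log r u - trunc_log r 0\<bar> \<le> R / r"
    using trunc_log_lipschitz[of r u 0] assms divide_right_mono[of "\<bar>u\<bar>" R r] by simp
  then show ?thesis by linarith
qed

text \<open>
  The energy of the truncated logarithm is a quadratic form \<open>J\<close>, so the midpoint exceeds the average by
  \<open>- \<theta> / 4 * J (\<rho>1 - \<rho>2)\<close>, which is bounded below by negative definiteness.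
\<close>

lemma energy_midpoint:
  assumes th: "\<theta> > 0" and B: "B > 0" and r: "0 < r" "r \<le> 2 * B" and V: "continuous_on UNIV V"
    and adm: "admissible \<theta> B \<rho>1" "admissible \<theta> B \<rho>2"
  shows "neutral_density B (1 / \<theta>) (\<lambda>x. \<rho>1 x - \<rho>2 x)"
    and "admissible \<theta> B (\<lambda>x. (\<rho>1 x + \<rho>2 x) / 2)"
    and "(energy \<theta> V r B \<rho>1 + energy \<theta> V r B \<rho>2) / 2
      + \<theta> / (4 * B) * (\<integral>t. (neutral_density.cumulative B (\<lambda>x. \<rho>1 x - \<rho>2 x) t)\<^sup>2 \<partial>lebesgue_Icc (-B) B)
      \<le> energy \<theta> V r B (\<lambda>x. (\<rho>1 x + \<rho>2 x) / 2)"
proof -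
  let ?M = "lebesgue_Icc (-B) B"
  have [measurable]: "\<rho>1 \<in> borel_measurable borel" "\<rho>2 \<in> borel_measurable borel"
    and b: "0 \<le> \<rho>1 x" "\<rho>1 x \<le> 1 / \<theta>" "0 \<le> \<rho>2 x" "\<rho>2 x \<le> 1 / \<theta>"
    and i1: "(\<integral>x. \<rho>1 x \<partial>?M) = 1" "(\<integral>x. \<rho>2 x \<partial>?M) = 1" for x
    using adm by (auto simp: admissible_def)
  have b': "\<bar>\<rho>1 x\<bar> \<le> 1 / \<theta>" "\<bar>\<rho>2 x\<bar> \<le> 1 / \<theta>" "\<bar>\<rho>1 x - \<rho>2 x\<bar> \<le> 1 / \<theta>" for x
    using b[of x] by auto
  have int: "integrable ?M \<rho>1" "integrable ?M \<rho>2"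
    using b' by (auto intro!: integrable_lebesgue_Icc)
  have Vm [measurable]: "V \<in> borel_measurable borel" by (rule borel_measurable_continuous_onI[OF V])
  obtain CV where CV0: "CV \<ge> 0" and CV: "\<And>x. x \<in> {-B..B} \<Longrightarrow> \<bar>V x\<bar> \<le> CV"
    using continuous_bounded_on_Icc[OF V] by blast
  have intV: "integrable ?M (\<lambda>x. V x * \<rho>1 x)" "integrable ?M (\<lambda>x. V x * \<rho>2 x)"
    using b' CV CV0 by (auto intro!: integrable_lebesgue_Icc[where C="CV * (1 / \<theta>)"] mult_mono simp: abs_mult
      simp del: times_divide_eq_right)
  show nd: "neutral_density B (1 / \<theta>) (\<lambda>x. \<rho>1 x - \<rho>2 x)"
    using int i1 b' B by unfold_locales auto
  show "admissible \<theta> B (\<lambda>x. (\<rho>1 x + \<rho>2 x) / 2)"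
    unfolding admissible_def
  proof (intro conjI allI)
    fix x
    show "0 \<le> (\<rho>1 x + \<rho>2 x) / 2" using b[of x] by simp
    have avg: "(u + v) / 2 \<le> w" if "u \<le> w" "v \<le> w" for u v w :: real using that by simp
    show "(\<rho>1 x + \<rho>2 x) / 2 \<le> 1 / \<theta>" using b[of x] by (intro avg)
  qed (use int i1 in auto)
  define J where "J a = (\<integral>x. \<integral>y. trunc_log r (x - y) * a x * a y \<partial>?M \<partial>?M)" for a
  define K where "K = \<bar>trunc_log r 0\<bar> + 2 * B / r"
  define C where "C = K * (1 / \<theta>) * (1 / \<theta>)"
  have Kb: "\<bar>trunc_log r (x - y)\<bar> \<le> K" if "x \<in> {-B..B}" "y \<in> {-B..B}" for x y
    unfolding K_def using that r by (intro trunc_log_bounded) auto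
  have bd: "\<bar>trunc_log r (x - y) * a x * a y\<bar> \<le> C"
    if "x \<in> {-B..B}" "y \<in> {-B..B}" "\<And>x. \<bar>a x\<bar> \<le> 1 / \<theta>" for x y and a :: "real \<Rightarrow> real"
    unfolding C_def using that Kb by (intro mult3_abs_le) auto
  have "J (\<lambda>x. (\<rho>1 x + \<rho>2 x) / 2)
    = (\<integral>x. \<integral>y. 1 * (1/2 * (trunc_log r (x - y) * \<rho>1 x * \<rho>1 y) + 1/2 * (trunc_log r (x - y) * \<rho>2 x * \<rho>2 y))
        + (- 1/4) * (trunc_log r (x - y) * (\<rho>1 x - \<rho>2 x) * (\<rho>1 y - \<rho>2 y)) \<partial>?M \<partial>?M)"
    unfolding J_def by (intro Bochner_Integration.integral_cong refl) (simp add: field_simps)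
  also have "\<dots> = 1 * (\<integral>x. \<integral>y. 1/2 * (trunc_log r (x - y) * \<rho>1 x * \<rho>1 y) + 1/2 * (trunc_log r (x - y) * \<rho>2 x * \<rho>2 y) \<partial>?M \<partial>?M)
    + (- 1/4) * J (\<lambda>x. \<rho>1 x - \<rho>2 x)"
    unfolding J_def
  proof (rule double_integral_linear)
    fix x y assume xy: "x \<in> {-B..B}" "y \<in> {-B..B}"
    show "\<bar>1/2 * (trunc_log r (x - y) * \<rho>1 x * \<rho>1 y) + 1/2 * (trunc_log r (x - y) * \<rho>2 x * \<rho>2 y)\<bar> \<le> C"
      using bd[OF xy, of \<rho>1] bd[OF xy, of \<rho>2] b' by auto
    show "\<bar>trunc_log r (x - y) * (\<rho>1 x - \<rho>2 x) * (\<rho>1 y - \<rho>2 y)\<bar> \<le> C"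
      using bd[OF xy, of "\<lambda>x. \<rho>1 x - \<rho>2 x"] b' by auto
  next
    show "- B \<le> B" using B by simp
  qed measurable
  also have "(\<integral>x. \<integral>y. 1/2 * (trunc_log r (x - y) * \<rho>1 x * \<rho>1 y) + 1/2 * (trunc_log r (x - y) * \<rho>2 x * \<rho>2 y) \<partial>?M \<partial>?M)
    = 1/2 * J \<rho>1 + 1/2 * J \<rho>2"
    unfolding J_def
  proof (rule double_integral_linear)
    fix x y assume xy: "x \<in> {-B..B}" "y \<in> {-B..B}"
    show "\<bar>trunc_log r (x - y) * \<rho>1 x * \<rho>1 y\<bar> \<le> C" "\<bar>trunc_log r (x - y) * \<rho>2 x * \<rho>2 y\<bar> \<le> C"
      using bd[OF xy, of \<rho>1] bd[OF xy, of \<rho>2] b' by auto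
  next
    show "- B \<le> B" using B by simp
  qed measurable
  finally have J: "J (\<lambda>x. (\<rho>1 x + \<rho>2 x) / 2) = (J \<rho>1 + J \<rho>2) / 2 - J (\<lambda>x. \<rho>1 x - \<rho>2 x) / 4"
    by simp
  have "(\<integral>x. V x * ((\<rho>1 x + \<rho>2 x) / 2) \<partial>?M) = (\<integral>x. (V x * \<rho>1 x + V x * \<rho>2 x) / 2 \<partial>?M)"
    by (intro Bochner_Integration.integral_cong refl) (simp add: field_simps)
  then have VV: "(\<integral>x. V x * ((\<rho>1 x + \<rho>2 x) / 2) \<partial>?M) = ((\<integral>x. V x * \<rho>1 x \<partial>?M) + (\<integral>x. V x * \<rho>2 x \<partial>?M)) / 2"
    using intV by simp
  define Q where "Q = (\<integral>t. (neutral_density.cumulative B (\<lambda>x. \<rho>1 x - \<rho>2 x) t)\<^sup>2 \<partial>?M)"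
  have Q: "J (\<lambda>x. \<rho>1 x - \<rho>2 x) \<le> - Q / B"
    unfolding J_def Q_def by (rule neutral_density.trunc_log_energy_le[OF nd r])
  have "energy \<theta> V r B (\<lambda>x. (\<rho>1 x + \<rho>2 x) / 2)
    = (energy \<theta> V r B \<rho>1 + energy \<theta> V r B \<rho>2) / 2 - \<theta> * (J (\<lambda>x. \<rho>1 x - \<rho>2 x) / 4)"
    unfolding energy_def J_def[symmetric] J VV by (simp add: field_simps)
  moreover have "\<theta> * (J (\<lambda>x. \<rho>1 x - \<rho>2 x) / 4) \<le> \<theta> * ((- Q / B) / 4)"
    using Q th by (intro mult_left_mono divide_right_mono) auto
  moreover have "\<theta> * ((- Q / B) / 4) = - (\<theta> / (4 * B) * Q)" by simp
  ultimately show "(energy \<theta> V r B \<rho>1 + energy \<theta> V r B \<rho>2) / 2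
      + \<theta> / (4 * B) * (\<integral>t. (neutral_density.cumulative B (\<lambda>x. \<rho>1 x - \<rho>2 x) t)\<^sup>2 \<partial>?M)
      \<le> energy \<theta> V r B (\<lambda>x. (\<rho>1 x + \<rho>2 x) / 2)"
    unfolding Q_def[symmetric] by linarith
qed

text \<open>
  The midpoint of two near maximizers cannot exceed the supremum \<open>S\<close>. By strict concavity this forces the
  cumulative functions to be close in \<open>L\<^sup>2\<close>. It matters that \<open>t\<close> is chosen before \<open>r\<close>: later \<open>r\<close> has to be
  taken small in terms of \<open>t\<close>.
\<close>

lemma near_maximizers_close:
  assumes th: "\<theta> > 0" and B: "B > 0" and V: "continuous_on UNIV V"
    and lip: "\<And>x y. \<bar>f x - f y\<bar> \<le> L * \<bar>x - y\<bar>" and eps: "\<epsilon> > 0"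
  obtains t where "t > 0"
    "\<And>r S \<rho>1 \<rho>2. 0 < r \<Longrightarrow> r \<le> 2 * B \<Longrightarrow> (\<And>\<rho>. admissible \<theta> B \<rho> \<Longrightarrow> energy \<theta> V r B \<rho> \<le> S) \<Longrightarrow>
       admissible \<theta> B \<rho>1 \<Longrightarrow> admissible \<theta> B \<rho>2 \<Longrightarrow>
       S - t \<le> energy \<theta> V r B \<rho>1 \<Longrightarrow> S - t \<le> energy \<theta> V r B \<rho>2 \<Longrightarrow>
       \<bar>(\<integral>x. f x * \<rho>1 x \<partial>lebesgue_Icc (-B) B) - (\<integral>x. f x * \<rho>2 x \<partial>lebesgue_Icc (-B) B)\<bar> \<le> \<epsilon>"
proof -
  have L: "L \<ge> 0" using lip[of 0 1] by auto
  define L' where "L' = L + 1"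
  have L': "L' > 0" using L by (simp add: L'_def)
  have lip': "\<bar>f x - f y\<bar> \<le> L' * \<bar>x - y\<bar>" for x y
    using lip[of x y] by (simp add: L'_def algebra_simps)
  \<comment> \<open>with these \<open>a\<close> and \<open>t\<close> the two terms of \<open>test_function_le\<close> are at most \<open>\<epsilon>/2\<close> each\<close>
  define a where "a = \<epsilon> / (2 * L' * B)"
  have a: "a > 0" using eps L' B by (simp add: a_def)
  define t where "t = \<epsilon> * \<theta> * a / (4 * L' * B)"
  have t: "t > 0" using eps th a L' B by (simp add: t_def)
  show thesis
  proof (rule that[OF t])
    fix r S \<rho>1 \<rho>2
    assume r: "0 < r" "r \<le> 2 * B" and S: "\<And>\<rho>. admissible \<theta> B \<rho> \<Longrightarrow> energy \<theta> V r B \<rho> \<le> S"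
      and adm: "admissible \<theta> B \<rho>1" "admissible \<theta> B \<rho>2"
      and near: "S - t \<le> energy \<theta> V r B \<rho>1" "S - t \<le> energy \<theta> V r B \<rho>2"
    let ?M = "lebesgue_Icc (-B) B"
    note mid = energy_midpoint[OF th B r V adm]
    interpret neutral_density B "1 / \<theta>" "\<lambda>x. \<rho>1 x - \<rho>2 x" by (rule mid(1))
    define Q where "Q = (\<integral>t. (cumulative t)\<^sup>2 \<partial>?M)"
    define q where "q = \<theta> / (4 * B) * Q"
    have "q \<le> energy \<theta> V r B (\<lambda>x. (\<rho>1 x + \<rho>2 x) / 2) - (energy \<theta> V r B \<rho>1 + energy \<theta> V r B \<rho>2) / 2"
      using mid(3) unfolding q_def Q_def by (simp only: le_diff_eq add.commute)
    also have "\<dots> \<le> S - (energy \<theta> V r B \<rho>1 + energy \<theta> V r B \<rho>2) / 2"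
      using S[OF mid(2)] by simp
    also have "\<dots> \<le> t" using near by (simp add: field_simps)
    finally have "\<theta> / (4 * B) * Q \<le> t" by (simp add: q_def)
    then have "Q \<le> 4 * B * t / \<theta>" using th B by (simp add: field_simps)
    then have "Q / (2 * a) \<le> 4 * B * t / \<theta> / (2 * a)" using a by (intro divide_right_mono) auto
    also have "\<dots> = \<epsilon> / (2 * L')" using th a B L' by (simp add: t_def)
    finally have "L' * (a * B + Q / (2 * a)) \<le> L' * (a * B + \<epsilon> / (2 * L'))"
      using L' by (intro mult_left_mono) auto
    also have "\<dots> = \<epsilon>" using L' B by (simp add: a_def field_simps)
    finally have "\<bar>\<integral>x. f x * (\<rho>1 x - \<rho>2 x) \<partial>?M\<bar> \<le> \<epsilon>"
      using test_function_le[OF lip' a] unfolding Q_def by linarith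
    moreover have "(\<integral>x. f x * (\<rho>1 x - \<rho>2 x) \<partial>?M) = (\<integral>x. f x * \<rho>1 x \<partial>?M) - (\<integral>x. f x * \<rho>2 x \<partial>?M)"
    proof -
      note fl = lipschitz_measurable_bounded[OF lip']
      have fm [measurable]: "f \<in> borel_measurable borel" by (rule fl)
      have "integrable ?M (\<lambda>x. f x * \<rho> x)" if "admissible \<theta> B \<rho>" for \<rho>
      proof (rule integrable_lebesgue_Icc)
        show "(\<lambda>x. f x * \<rho> x) \<in> borel_measurable borel"
          using that by (auto simp: admissible_def)
        show "\<bar>f x * \<rho> x\<bar> \<le> (\<bar>f 0\<bar> + L' * B) * (1 / \<theta>)" if "x \<in> {-B..B}" for x
          using fl(3)[OF that] \<open>admissible \<theta> B \<rho>\<close> L' B unfolding abs_mult admissible_def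
          by (intro mult_mono) auto
      qed
      then show ?thesis using adm by (simp add: right_diff_distrib)
    qed
    ultimately show "\<bar>(\<integral>x. f x * \<rho>1 x \<partial>?M) - (\<integral>x. f x * \<rho>2 x \<partial>?M)\<bar> \<le> \<epsilon>" by simp
  qed
qed

section \<open>Sums over points versus integrals against densities\<close>

definition separated :: "real \<Rightarrow> nat \<Rightarrow> (nat \<Rightarrow> real) \<Rightarrow> bool" where
  "separated \<theta> N x \<longleftrightarrow> (\<forall>i\<in>{1..N}. \<forall>j\<in>{1..N}. i < j \<longrightarrow> \<theta> / real N * real (j - i) \<le> x j - x i)"

text \<open>
  Both ways of matching a density \<open>a\<close> with points \<open>x i\<close>, \<open>i \<in> I\<close>, of mass \<open>1/N\<close> have an error
  proportional to the Lipschitz constant of the test function. The set \<open>I\<close> may be smaller than \<open>{1..N}\<close>, as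
  only some of the particles are smoothed.
\<close>

definition quadrature :: "real \<Rightarrow> (real \<Rightarrow> real) \<Rightarrow> nat set \<Rightarrow> (nat \<Rightarrow> real) \<Rightarrow> nat \<Rightarrow> real \<Rightarrow> bool" where
  "quadrature B a I x N \<tau> \<longleftrightarrow> (\<forall>g K. (\<forall>x y. \<bar>g x - g y\<bar> \<le> K * \<bar>x - y\<bar>) \<longrightarrow>
     \<bar>(\<integral>t. g t * a t \<partial>lebesgue_Icc (-B) B) - (\<Sum>i\<in>I. g (x i)) / real N\<bar> \<le> K * \<tau>)"

lemma quadratureD:
  assumes "quadrature B a I x N \<tau>" "\<And>x y. \<bar>g x - g y\<bar> \<le> K * \<bar>x - y\<bar>"
  shows "\<bar>(\<integral>t. g t * a t \<partial>lebesgue_Icc (-B) B) - (\<Sum>i\<in>I. g (x i)) / real N\<bar> \<le> K * \<tau>"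
  using assms unfolding quadrature_def by blast

text \<open>
  Apply the quadrature rule in one variable at a time. The kernel is \<open>1/r\<close>-Lipschitz in each variable,
  and so is the potential that it generates.
\<close>

lemma double_quadrature:
  assumes quad: "quadrature B a I x N \<tau>" and r: "r > 0" and N: "N > 0" and I: "finite I" "card I \<le> N"
    and am [measurable]: "a \<in> borel_measurable borel" and a: "\<And>x. 0 \<le> a x" "\<And>x. a x \<le> D"
    and mass: "(\<integral>x. a x \<partial>lebesgue_Icc (-B) B) \<le> 1"
  shows "\<bar>(\<integral>s. \<integral>t. trunc_log r (s - t) * a s * a t \<partial>lebesgue_Icc (-B) B \<partial>lebesgue_Icc (-B) B)
     - (\<Sum>i\<in>I. \<Sum>j\<in>I. trunc_log r (x i - x j)) / (real N)\<^sup>2\<bar> \<le> 2 * \<tau> / r"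
proof -
  let ?M = "lebesgue_Icc (-B) B"
  define U where "U s = (\<integral>t. trunc_log r (s - t) * a t \<partial>?M)" for s
  have lip1: "\<bar>trunc_log r (s - t) - trunc_log r (s - t')\<bar> \<le> 1 / r * \<bar>t - t'\<bar>" for s t t'
    using trunc_log_lipschitz[OF r, of "s - t" "s - t'"] by (simp add: abs_minus_commute)
  have int: "integrable ?M (\<lambda>t. trunc_log r (s - t) * a t)" for s
  proof (rule integrable_lebesgue_Icc)
    fix t assume t: "t \<in> {-B..B}"
    have "\<bar>trunc_log r (s - t)\<bar> \<le> \<bar>trunc_log r 0\<bar> + (\<bar>s\<bar> + B) / r"
      using t by (intro trunc_log_bounded r) auto
    then show "\<bar>trunc_log r (s - t) * a t\<bar> \<le> (\<bar>trunc_log r 0\<bar> + (\<bar>s\<bar> + B) / r) * D"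
      unfolding abs_mult using a[of t] by (intro mult_mono) auto
  qed measurable
  have inta: "integrable ?M a" using a by (intro integrable_lebesgue_Icc[where C=D]) auto
  have lipU: "\<bar>U s - U s'\<bar> \<le> 1 / r * \<bar>s - s'\<bar>" for s s'
  proof -
    have "\<bar>U s - U s'\<bar> = \<bar>\<integral>t. trunc_log r (s - t) * a t - trunc_log r (s' - t) * a t \<partial>?M\<bar>"
      unfolding U_def using int by simp
    also have "\<dots> \<le> (\<integral>t. \<bar>trunc_log r (s - t) * a t - trunc_log r (s' - t) * a t\<bar> \<partial>?M)"
      by (rule integral_abs_bound)
    also have "\<dots> \<le> (\<integral>t. \<bar>s - s'\<bar> / r * a t \<partial>?M)"
    proof (rule integral_mono)
      fix t
      have "\<bar>trunc_log r (s - t) * a t - trunc_log r (s' - t) * a t\<bar> = \<bar>trunc_log r (s - t) - trunc_log r (s' - t)\<bar> * a t"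
        using a(1)[of t] by (simp add: left_diff_distrib[symmetric] abs_mult)
      also have "\<dots> \<le> \<bar>s - s'\<bar> / r * a t"
        using trunc_log_lipschitz[OF r, of "s - t" "s' - t"] a(1) by (intro mult_right_mono) auto
      finally show "\<bar>trunc_log r (s - t) * a t - trunc_log r (s' - t) * a t\<bar> \<le> \<bar>s - s'\<bar> / r * a t" .
    qed (use int inta in auto)
    also have "\<dots> = \<bar>s - s'\<bar> / r * (\<integral>t. a t \<partial>?M)" by simp
    also have "\<dots> \<le> \<bar>s - s'\<bar> / r * 1" using mass r by (intro mult_left_mono) auto
    finally show ?thesis by simp
  qed
  have "(\<integral>s. \<integral>t. trunc_log r (s - t) * a s * a t \<partial>?M \<partial>?M) = (\<integral>s. U s * a s \<partial>?M)"
  proof (intro Bochner_Integration.integral_cong refl)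
    fix s
    have "(\<integral>t. trunc_log r (s - t) * a s * a t \<partial>?M) = (\<integral>t. a s * (trunc_log r (s - t) * a t) \<partial>?M)"
      by (simp add: mult_ac)
    then show "(\<integral>t. trunc_log r (s - t) * a s * a t \<partial>?M) = U s * a s"
      by (simp add: U_def)
  qed
  moreover have "\<bar>(\<integral>s. U s * a s \<partial>?M) - (\<Sum>i\<in>I. U (x i)) / real N\<bar> \<le> 1 / r * \<tau>"
    by (rule quadratureD[OF quad lipU])
  moreover have "\<bar>(\<Sum>i\<in>I. U (x i)) / real N - (\<Sum>i\<in>I. \<Sum>j\<in>I. trunc_log r (x i - x j)) / (real N)\<^sup>2\<bar> \<le> 1 / r * \<tau>"
  proof -
    have each: "\<bar>U (x i) - (\<Sum>j\<in>I. trunc_log r (x i - x j)) / real N\<bar> \<le> 1 / r * \<tau>" for i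
      unfolding U_def by (rule quadratureD[OF quad lip1])
    then have tau: "0 \<le> 1 / r * \<tau>" using abs_ge_zero order_trans by blast
    have "(\<Sum>i\<in>I. U (x i)) / real N - (\<Sum>i\<in>I. \<Sum>j\<in>I. trunc_log r (x i - x j)) / (real N)\<^sup>2
      = (\<Sum>i\<in>I. U (x i) - (\<Sum>j\<in>I. trunc_log r (x i - x j)) / real N) / real N"
      by (simp add: sum_subtractf sum_divide_distrib[symmetric] diff_divide_distrib power2_eq_square)
    also have "\<bar>\<dots>\<bar> \<le> (\<Sum>i\<in>I. 1 / r * \<tau>) / real N"
      unfolding abs_divide abs_of_nat
      by (intro divide_right_mono order_trans[OF sum_abs] sum_mono each) auto
    also have "\<dots> = (real (card I) / real N) * (1 / r * \<tau>)" by simp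
    also have "\<dots> \<le> 1 * (1 / r * \<tau>)"
      using I N tau by (intro mult_right_mono) auto
    finally show ?thesis by simp
  qed
  ultimately show ?thesis by simp
qed

text \<open>
  The cumulative function of \<open>\<rho>\<close> is \<open>1/\<theta>\<close>-Lipschitz. So its quantiles at the levels \<open>i/N\<close> exist and are
  \<open>\<theta>/N\<close> apart; between two consecutive ones there is mass \<open>1/N\<close>, and a Lipschitz function varies there by at
  most \<open>K\<close> times their distance. These distances add up to \<open>2 * B\<close>.
\<close>

lemma quantiles_exist:
  assumes th: "\<theta> > 0" and B: "B > 0" and N: "N > 0" and adm: "admissible \<theta> B \<rho>"
  obtains q where "\<And>i. i \<in> {1..N} \<Longrightarrow> q i \<in> {-B..B}" "separated \<theta> N q"
    "quadrature B \<rho> {1..N} q N (2 * B / real N)"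
proof -
  let ?M = "lebesgue_Icc (-B) B"
  have [measurable]: "\<rho> \<in> borel_measurable borel" and b: "0 \<le> \<rho> x" "\<rho> x \<le> 1 / \<theta>"
    and mass: "(\<integral>x. \<rho> x \<partial>?M) = 1" for x
    using adm by (auto simp: admissible_def)
  define P where "P g t = (\<integral>x. of_bool (x \<le> t) * (g x * \<rho> x) \<partial>?M)" for g :: "real \<Rightarrow> real" and t
  have P_int: "integrable ?M (\<lambda>x. of_bool (Q x) * (g x * \<rho> x))"
    if "g \<in> borel_measurable borel" "\<And>x. x \<in> {-B..B} \<Longrightarrow> \<bar>g x\<bar> \<le> C" "Measurable.pred borel Q" for g C Q
  proof (rule integrable_lebesgue_Icc)
    fix x assume x: "x \<in> {-B..B}"
    have "\<bar>of_bool (Q x) * (g x * \<rho> x)\<bar> \<le> \<bar>g x\<bar> * \<rho> x" using b[of x] by (simp add: abs_mult of_bool_def)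
    also have "\<dots> \<le> C * (1 / \<theta>)" using that(2)[OF x] b[of x] by (intro mult_mono) auto
    finally show "\<bar>of_bool (Q x) * (g x * \<rho> x)\<bar> \<le> C * (1 / \<theta>)" .
  qed (use that in measurable)
  have P_diff: "P g t - P g s = (\<integral>x. of_bool (s < x \<and> x \<le> t) * (g x * \<rho> x) \<partial>?M)"
    if "s \<le> t" "g \<in> borel_measurable borel" "\<And>x. x \<in> {-B..B} \<Longrightarrow> \<bar>g x\<bar> \<le> C" for g C s t
  proof -
    have "P g t - P g s = (\<integral>x. of_bool (x \<le> t) * (g x * \<rho> x) - of_bool (x \<le> s) * (g x * \<rho> x) \<partial>?M)"
      unfolding P_def using that
      by (intro Bochner_Integration.integral_diff[symmetric] P_int[of g C]) auto
    also have "\<dots> = (\<integral>x. of_bool (s < x \<and> x \<le> t) * (g x * \<rho> x) \<partial>?M)"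
      using that(1) by (intro Bochner_Integration.integral_cong refl) auto
    finally show ?thesis .
  qed
  have P_left: "P g (-B) = 0" for g
  proof -
    have "P g (-B) = (\<integral>x. indicator {-B..B} x * (of_bool (x \<le> -B) * (g x * \<rho> x)) \<partial>lborel)"
      unfolding P_def integral_lebesgue_Icc_lborel ..
    also have "\<dots> = 0"
    proof (rule integral_eq_zero_AE)
      show "AE x in lborel. indicator {-B..B} x * (of_bool (x \<le> -B) * (g x * \<rho> x)) = 0"
        using AE_lborel_singleton[of "-B"] by eventually_elim (auto simp: indicator_def)
    qed
    finally show ?thesis .
  qed
  have P_right: "P g B = (\<integral>x. g x * \<rho> x \<partial>?M)" for g
    unfolding P_def by (intro Bochner_Integration.integral_cong refl) auto
  define F where "F = P (\<lambda>_. 1)"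
  have F_diff: "F t - F s = (\<integral>x. of_bool (s < x \<and> x \<le> t) * \<rho> x \<partial>?M)" if "s \<le> t" for s t
    unfolding F_def using P_diff[OF that, of "\<lambda>_. 1" 1] by simp
  have int_ob: "integrable ?M (\<lambda>x. of_bool (s < x \<and> x \<le> t) * \<rho> x)" for s t
    using P_int[of "\<lambda>_. 1" 1 "\<lambda>x. s < x \<and> x \<le> t"] by simp
  have F_mono: "F s \<le> F t" if "s \<le> t" for s t
  proof -
    have "0 \<le> F t - F s" unfolding F_diff[OF that] using b by (intro Bochner_Integration.integral_nonneg) auto
    then show ?thesis by simp
  qed
  have F_lip: "F t - F s \<le> (t - s) / \<theta>" if "s \<le> t" for s t
  proof -
    have "F t - F s \<le> (\<integral>x. indicator {-B..B} x * (of_bool (s < x \<and> x \<le> t) * (1 / \<theta>)) \<partial>lborel)"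
      unfolding F_diff[OF that] integral_lebesgue_Icc_lborel[symmetric]
      using b by (intro integral_mono int_ob integrable_lebesgue_Icc[where C="1 / \<theta>"]) (use th in auto)
    also have "\<dots> \<le> (\<integral>x. indicator {s<..t} x * (1 / \<theta>) \<partial>lborel)"
    proof (rule integral_mono)
      show "integrable lborel (\<lambda>x. indicator {s<..t} x * (1 / \<theta>))" using that by simp
      then show "integrable lborel (\<lambda>x. indicator {-B..B} x * (of_bool (s < x \<and> x \<le> t) * (1 / \<theta>)))"
        by (rule Bochner_Integration.integrable_bound) (auto simp: indicator_def)
    qed (use th in \<open>auto simp: indicator_def\<close>)
    also have "\<dots> = (t - s) / \<theta>" using that by simp
    finally show ?thesis .
  qed
  have "(1 / \<theta>)-lipschitz_on UNIV F"
  proof (rule lipschitz_onI)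
    fix s t
    show "dist (F s) (F t) \<le> 1 / \<theta> * dist s t"
      using F_mono[of s t] F_mono[of t s] F_lip[of s t] F_lip[of t s]
      by (cases "s \<le> t") (auto simp: dist_real_def)
  qed (use th in auto)
  then have Fc: "continuous_on {-B..B} F"
    using lipschitz_on_continuous_on continuous_on_subset by blast
  have FB: "F (-B) = 0" "F B = 1"
    unfolding F_def using P_left P_right[of "\<lambda>_. 1"] mass by auto
  \<comment> \<open>the extreme quantiles are taken to be the endpoints, so that the cells between consecutive quantiles
    exhaust \<open>[-B, B]\<close>\<close>
  have "\<exists>t. t \<in> {-B..B} \<and> F t = real i / real N \<and> (i = 0 \<longrightarrow> t = -B) \<and> (i = N \<longrightarrow> t = B)" if iN: "i \<le> N" for i
  proof -
    consider "i = 0" | "i = N" | "0 < i" "i < N" using iN by linarith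
    then show ?thesis
    proof cases
      case 1 then show ?thesis using FB B N by (intro exI[of _ "-B"]) auto
    next
      case 2 then show ?thesis using FB B N by (intro exI[of _ B]) auto
    next
      case 3
      have "\<exists>t. -B \<le> t \<and> t \<le> B \<and> F t = real i / real N"
        using FB Fc 3 B by (intro IVT') auto
      then show ?thesis using 3 by auto
    qed
  qed
  then obtain q where q: "\<And>i. i \<le> N \<Longrightarrow> q i \<in> {-B..B} \<and> F (q i) = real i / real N \<and> (i = 0 \<longrightarrow> q i = -B) \<and> (i = N \<longrightarrow> q i = B)"
    by metis
  have q_mono: "q i \<le> q j" if "i < j" "j \<le> N" for i j
  proof (rule ccontr)
    assume "\<not> ?thesis"
    then have "F (q j) \<le> F (q i)" by (intro F_mono) auto
    then show False using q[of i] q[of j] that N by (auto simp: field_simps)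
  qed
  show thesis
  proof (rule that[of q])
    show "q i \<in> {-B..B}" if "i \<in> {1..N}" for i using q[of i] that by auto
    show "separated \<theta> N q"
      unfolding separated_def
    proof (intro ballI impI)
      fix i j assume ij: "i \<in> {1..N}" "j \<in> {1..N}" "i < j"
      have "F (q j) - F (q i) \<le> (q j - q i) / \<theta>" using q_mono[of i j] ij by (intro F_lip) auto
      moreover have "F (q j) - F (q i) = real (j - i) / real N"
        using q[of i] q[of j] ij by (simp add: diff_divide_distrib of_nat_diff)
      ultimately show "\<theta> / real N * real (j - i) \<le> q j - q i"
        using th N by (simp add: field_simps)
    qed
    show "quadrature B \<rho> {1..N} q N (2 * B / real N)"
      unfolding quadrature_def
    proof (intro allI impI)
      fix g :: "real \<Rightarrow> real" and K :: real assume "\<forall>x y. \<bar>g x - g y\<bar> \<le> K * \<bar>x - y\<bar>"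
      then have lip: "\<And>x y. \<bar>g x - g y\<bar> \<le> K * \<bar>x - y\<bar>" by blast
      note gl = lipschitz_measurable_bounded[OF lip]
      have [measurable]: "g \<in> borel_measurable borel" by (rule gl)
      have cell: "\<bar>(P g (q (Suc i)) - P g (q i)) - g (q (Suc i)) / real N\<bar> \<le> K / real N * (q (Suc i) - q i)"
        if i: "i < N" for i
      proof -
        have qq: "q i \<le> q (Suc i)" using q_mono[of i "Suc i"] i by auto
        let ?o = "\<lambda>x. of_bool (q i < x \<and> x \<le> q (Suc i)) :: real"
        have F1: "(\<integral>x. ?o x * \<rho> x \<partial>?M) = 1 / real N"
          using F_diff[OF qq] q[of i] q[of "Suc i"] i by (simp add: diff_divide_distrib[symmetric])
        have i1: "integrable ?M (\<lambda>x. ?o x * (g x * \<rho> x))"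
          using gl(3)[of _ B] by (intro P_int) auto
        have "(P g (q (Suc i)) - P g (q i)) - g (q (Suc i)) / real N
          = (\<integral>x. ?o x * (g x * \<rho> x) \<partial>?M) - g (q (Suc i)) * (\<integral>x. ?o x * \<rho> x \<partial>?M)"
          using P_diff[OF qq, of g "\<bar>g 0\<bar> + K * B"] gl F1 by simp
        also have "\<dots> = (\<integral>x. ?o x * (g x * \<rho> x) - g (q (Suc i)) * (?o x * \<rho> x) \<partial>?M)"
          using i1 int_ob by simp
        finally have E: "(P g (q (Suc i)) - P g (q i)) - g (q (Suc i)) / real N
          = (\<integral>x. ?o x * (g x * \<rho> x) - g (q (Suc i)) * (?o x * \<rho> x) \<partial>?M)" .
        have "\<bar>(P g (q (Suc i)) - P g (q i)) - g (q (Suc i)) / real N\<bar> \<le> (\<integral>x. \<bar>?o x * (g x * \<rho> x) - g (q (Suc i)) * (?o x * \<rho> x)\<bar> \<partial>?M)"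
          unfolding E by (rule integral_abs_bound)
        also have "\<dots> \<le> (\<integral>x. K * (q (Suc i) - q i) * (?o x * \<rho> x) \<partial>?M)"
        proof (rule integral_mono)
          show "integrable ?M (\<lambda>x. \<bar>?o x * (g x * \<rho> x) - g (q (Suc i)) * (?o x * \<rho> x)\<bar>)"
            by (rule Bochner_Integration.integrable_abs[OF Bochner_Integration.integrable_diff
                [OF i1 integrable_mult_right[OF int_ob]]])
          show "integrable ?M (\<lambda>x. K * (q (Suc i) - q i) * (?o x * \<rho> x))" using int_ob by simp
          fix x
          show "\<bar>?o x * (g x * \<rho> x) - g (q (Suc i)) * (?o x * \<rho> x)\<bar> \<le> K * (q (Suc i) - q i) * (?o x * \<rho> x)"
          proof (cases "q i < x \<and> x \<le> q (Suc i)")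
            case True
            have "\<bar>g x * \<rho> x - g (q (Suc i)) * \<rho> x\<bar> = \<bar>g x - g (q (Suc i))\<bar> * \<rho> x"
              using b[of x] by (simp add: left_diff_distrib[symmetric] abs_mult)
            also have "\<dots> \<le> (K * \<bar>x - q (Suc i)\<bar>) * \<rho> x" by (intro mult_right_mono lip b)
            also have "\<dots> \<le> (K * (q (Suc i) - q i)) * \<rho> x"
              using True gl(1) b by (intro mult_right_mono mult_left_mono) auto
            finally show ?thesis using True by simp
          qed auto
        qed
        also have "\<dots> = K / real N * (q (Suc i) - q i)" using F1 by simp
        finally show ?thesis .
      qed
      have "(\<integral>t. g t * \<rho> t \<partial>?M) - (\<Sum>i\<in>{1..N}. g (q i)) / real N
        = (P g (q N) - P g (q 0)) - (\<Sum>i<N. g (q (Suc i))) / real N"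
        using q[of 0] q[of N] by (simp add: P_left P_right sum.atLeast1_atMost_eq)
      also have "\<dots> = (\<Sum>i<N. (P g (q (Suc i)) - P g (q i)) - g (q (Suc i)) / real N)"
        by (simp add: sum_subtractf sum_divide_distrib[symmetric] sum_lessThan_telescope[symmetric, of "\<lambda>i. P g (q i)"])
      also have "\<bar>\<dots>\<bar> \<le> (\<Sum>i<N. K / real N * (q (Suc i) - q i))"
        using cell by (intro order_trans[OF sum_abs] sum_mono) auto
      also have "\<dots> = K / real N * (q N - q 0)"
        by (simp only: sum_distrib_left[symmetric] sum_lessThan_telescope)
      also have "\<dots> = K * (2 * B / real N)" using q[of 0] q[of N] by simp
      finally show "\<bar>(\<integral>t. g t * \<rho> t \<partial>?M) - (\<Sum>i\<in>{1..N}. g (q i)) / real N\<bar> \<le> K * (2 * B / real N)" .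
    qed
  qed
qed

text \<open>
  As the points are \<open>\<theta>/N\<close> apart, the intervals of that length to the right of them are disjoint, and
  filling each with density \<open>1/\<theta>\<close> gives mass \<open>1/N\<close> per point.
\<close>

lemma smoothed_configuration:
  assumes th: "\<theta> > 0" and K: "K > 0" and N: "N > 0" and sep: "separated \<theta> N x"
    and I: "I \<subseteq> {1..N}" "\<And>i. i \<in> I \<Longrightarrow> \<bar>x i\<bar> \<le> K"
    and B: "B = K + \<theta>"
    and a_def: "a = (\<lambda>t. (\<Sum>i\<in>I. indicator {x i..<x i + \<theta> / real N} t) / \<theta>)"
  shows "a \<in> borel_measurable borel" "\<And>t. 0 \<le> a t" "\<And>t. a t \<le> 1 / \<theta>"
    "(\<integral>t. a t \<partial>lebesgue_Icc (-B) B) = real (card I) / real N"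
    "quadrature B a I x N (\<theta> / real N)"
proof -
  let ?M = "lebesgue_Icc (-B) B"
  let ?A = "\<lambda>i. {x i..<x i + \<theta> / real N}"
  have fI: "finite I" using I(1) finite_subset by blast
  show [measurable]: "a \<in> borel_measurable borel" unfolding a_def by measurable
  show "0 \<le> a t" for t unfolding a_def using th by (intro divide_nonneg_nonneg sum_nonneg) auto
  have disj: "disjoint_family_on ?A I"
    unfolding disjoint_family_on_def
  proof (intro ballI impI)
    have *: "?A i \<inter> ?A j = {}" if "i \<in> I" "j \<in> I" "i < j" for i j
    proof -
      have "\<theta> / real N * real (j - i) \<le> x j - x i" using sep that I(1) unfolding separated_def by blast
      moreover have "\<theta> / real N * 1 \<le> \<theta> / real N * real (j - i)" using that th by (intro mult_left_mono) auto
      ultimately show ?thesis by auto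
    qed
    fix i j assume "i \<in> I" "j \<in> I" "i \<noteq> j"
    then show "?A i \<inter> ?A j = {}" using *[of i j] *[of j i] by (cases "i < j") auto
  qed
  show "a t \<le> 1 / \<theta>" for t
    unfolding a_def indicator_UN_disjoint[OF fI disj, symmetric]
    using th by (intro divide_right_mono) (auto simp: indicator_def)
  have sub: "?A i \<subseteq> {-B..B}" if "i \<in> I" for i
  proof -
    have "\<theta> / real N \<le> \<theta> / 1" using N th by (intro divide_left_mono) auto
    then show ?thesis using I(2)[OF that] th unfolding B by (auto simp: abs_le_iff)
  qed
  have meas: "(\<integral>t. indicator (?A i) t \<partial>?M) = \<theta> / real N" if "i \<in> I" for i
  proof -
    have "(\<integral>t. (indicator (?A i) t :: real) \<partial>?M) = (\<integral>t. indicator (?A i) t \<partial>lborel)"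
      unfolding integral_lebesgue_Icc_lborel using sub[OF that]
      by (intro Bochner_Integration.integral_cong) (auto simp: indicator_def)
    then show ?thesis using th by simp
  qed
  have i1: "integrable ?M (\<lambda>t. g t * indicator (?A i) t)"
    if g: "g \<in> borel_measurable borel" "\<And>x. x \<in> {-B..B} \<Longrightarrow> \<bar>g x\<bar> \<le> C"
    for g :: "real \<Rightarrow> real" and C :: real and i
  proof (rule integrable_lebesgue_Icc)
    show "\<bar>g t * indicator (?A i) t\<bar> \<le> \<bar>C\<bar>" if "t \<in> {-B..B}" for t
      using g(2)[OF that] by (auto simp: indicator_def)
    show "(\<lambda>t. g t * indicator (?A i) t) \<in> borel_measurable borel"
      using g(1) by measurable
  qed
  have expand: "(\<integral>t. g t * a t \<partial>?M) = (\<Sum>i\<in>I. \<integral>t. g t * indicator (?A i) t \<partial>?M) / \<theta>"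
    if "g \<in> borel_measurable borel" "\<And>x. x \<in> {-B..B} \<Longrightarrow> \<bar>g x\<bar> \<le> C"
    for g :: "real \<Rightarrow> real" and C :: real
  proof -
    have "(\<integral>t. g t * a t \<partial>?M) = (\<integral>t. (\<Sum>i\<in>I. g t * indicator (?A i) t) / \<theta> \<partial>?M)"
      unfolding a_def by (simp add: sum_distrib_left)
    also have "\<dots> = (\<Sum>i\<in>I. \<integral>t. g t * indicator (?A i) t \<partial>?M) / \<theta>"
      using i1[OF that] by (simp add: Bochner_Integration.integral_sum)
    finally show ?thesis .
  qed
  show "(\<integral>t. a t \<partial>?M) = real (card I) / real N"
    using expand[of "\<lambda>_. 1" 1] meas th by simp
  show "quadrature B a I x N (\<theta> / real N)"
    unfolding quadrature_def
  proof (intro allI impI)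
    fix g :: "real \<Rightarrow> real" and K :: real assume "\<forall>x y. \<bar>g x - g y\<bar> \<le> K * \<bar>x - y\<bar>"
    then have lip: "\<And>x y. \<bar>g x - g y\<bar> \<le> K * \<bar>x - y\<bar>" by blast
    note gl = lipschitz_measurable_bounded[OF lip]
    have [measurable]: "g \<in> borel_measurable borel" by (rule gl)
    let ?h = "\<theta> / real N"
    have h: "?h > 0" using th N by simp
    have cell: "\<bar>(\<integral>t. g t * indicator (?A i) t \<partial>?M) - ?h * g (x i)\<bar> \<le> K * ?h * ?h" if i: "i \<in> I" for i
    proof -
      have i2: "integrable ?M (\<lambda>t. c * indicator (?A i) t)" for c :: real
        by (rule i1[of "\<lambda>_. c" "\<bar>c\<bar>"]) auto
      have i3: "integrable ?M (\<lambda>t. g t * indicator (?A i) t)"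
        by (rule i1[OF _ gl(3)[of _ B]]) auto
      have E: "(\<integral>t. g t * indicator (?A i) t \<partial>?M) - ?h * g (x i)
        = (\<integral>t. g t * indicator (?A i) t - g (x i) * indicator (?A i) t \<partial>?M)"
        using i2 i3 meas[OF i] by simp
      have "\<bar>(\<integral>t. g t * indicator (?A i) t \<partial>?M) - ?h * g (x i)\<bar> \<le> (\<integral>t. \<bar>g t * indicator (?A i) t - g (x i) * indicator (?A i) t\<bar> \<partial>?M)"
        unfolding E by (rule integral_abs_bound)
      also have "\<dots> \<le> (\<integral>t. (K * ?h) * indicator (?A i) t \<partial>?M)"
      proof (rule integral_mono)
        fix t
        have "\<bar>g t - g (x i)\<bar> \<le> K * ?h" if "t \<in> ?A i"
        proof -
          have "K * \<bar>t - x i\<bar> \<le> K * ?h" using that gl(1) by (intro mult_left_mono) auto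
          then show ?thesis using lip[of t "x i"] by linarith
        qed
        then show "\<bar>g t * indicator (?A i) t - g (x i) * indicator (?A i) t\<bar> \<le> (K * ?h) * indicator (?A i) t"
          by (auto simp: indicator_def)
      qed (use i2 i3 in \<open>auto intro!: Bochner_Integration.integrable_abs Bochner_Integration.integrable_diff\<close>)
      also have "\<dots> = K * ?h * ?h" using meas[OF i] by simp
      finally show ?thesis .
    qed
    have "(\<Sum>i\<in>I. (\<integral>t. g t * indicator (?A i) t \<partial>?M) - ?h * g (x i)) / \<theta>
      = (\<integral>t. g t * a t \<partial>?M) - (?h * (\<Sum>i\<in>I. g (x i))) / \<theta>"
      using expand[OF \<open>g \<in> _\<close> gl(3)[of _ B]]
      by (simp only: sum_subtractf sum_distrib_left diff_divide_distrib)
    also have "(?h * (\<Sum>i\<in>I. g (x i))) / \<theta> = (\<Sum>i\<in>I. g (x i)) / real N"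
      using th by simp
    finally have E: "(\<integral>t. g t * a t \<partial>?M) - (\<Sum>i\<in>I. g (x i)) / real N
      = (\<Sum>i\<in>I. (\<integral>t. g t * indicator (?A i) t \<partial>?M) - ?h * g (x i)) / \<theta>"
      by simp
    have "\<bar>(\<integral>t. g t * a t \<partial>?M) - (\<Sum>i\<in>I. g (x i)) / real N\<bar> \<le> (\<Sum>i\<in>I. K * ?h * ?h) / \<theta>"
      unfolding E abs_divide using th cell
      by (simp only: abs_of_pos) (intro divide_right_mono order_trans[OF sum_abs] sum_mono, auto)
    also have "\<dots> = (real (card I) / real N) * (K * ?h)" using th by (simp add: field_simps)
    also have "\<dots> \<le> 1 * (K * ?h)"
    proof (rule mult_right_mono)
      have "card I \<le> N" using card_mono[OF _ I(1)] by simp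
      then show "real (card I) / real N \<le> 1" using N by simp
      show "0 \<le> K * ?h" by (rule mult_nonneg_nonneg[OF gl(1) less_imp_le[OF h]])
    qed
    finally show "\<bar>(\<integral>t. g t * a t \<partial>?M) - (\<Sum>i\<in>I. g (x i)) / real N\<bar> \<le> K * (\<theta> / real N)" by simp
  qed
qed

section \<open>From densities to configurations\<close>

text \<open>
  The exponent of the weight of a configuration, in units of \<open>N\<^sup>2\<close> and as a function of the rescaled
  positions \<open>x i = l i / N\<close>.
\<close>

definition disc_energy :: "real \<Rightarrow> (real \<Rightarrow> real) \<Rightarrow> nat \<Rightarrow> (nat \<Rightarrow> real) \<Rightarrow> real" where
  "disc_energy \<theta> V N x =
     \<theta> * (\<Sum>i\<in>{1..N}. \<Sum>j\<in>{1..N} - {i}. ln \<bar>x i - x j\<bar>) / (real N)\<^sup>2 - (\<Sum>i\<in>{1..N}. V (x i)) / real N"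

lemma particle_configs_gap:
  assumes "l \<in> particle_configs \<theta> N" "i \<in> {1..N}" "j \<in> {1..N}" "i < j"
  shows "\<theta> * real (j - i) \<le> l j - l i"
proof -
  obtain lam where lam: "mono_on {1..N} lam" "\<forall>i\<in>{1..N}. l i = of_int (lam i) + \<theta> * real i"
    using assms by (auto simp: particle_configs_def)
  have "lam i \<le> lam j" using lam(1) assms by (auto intro: mono_onD)
  then show ?thesis using lam(2) assms by (simp add: of_nat_diff algebra_simps)
qed

lemma particle_configs_separated:
  assumes "l \<in> particle_configs \<theta> N"
  shows "separated \<theta> N (\<lambda>i. l i / real N)"
  unfolding separated_def
proof (intro ballI impI)
  fix i j assume ij: "i \<in> {1..N}" "j \<in> {1..N}" "i < j"
  then have "\<theta> * real (j - i) / real N \<le> (l j - l i) / real N"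
    by (intro divide_right_mono particle_configs_gap[OF assms]) auto
  then show "\<theta> / real N * real (j - i) \<le> l j / real N - l i / real N"
    by (simp add: diff_divide_distrib)
qed

lemma separated_gap:
  assumes "separated \<theta> N x" "\<theta> > 0" "N > 0" "i \<in> {1..N}" "j \<in> {1..N}" "i \<noteq> j"
  shows "\<bar>x i - x j\<bar> \<ge> \<theta> / real N"
proof -
  have *: "x b - x a \<ge> \<theta> / real N" if "a \<in> {1..N}" "b \<in> {1..N}" "a < b" for a b
  proof -
    have "\<theta> / real N * 1 \<le> \<theta> / real N * real (b - a)" using that assms by (intro mult_left_mono) auto
    also have "\<dots> \<le> x b - x a" using assms(1) that unfolding separated_def by blast
    finally show ?thesis by simp
  qed
  show ?thesis using *[of i j] *[of j i] assms by (cases "i < j") auto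
qed

text \<open>
  The diagonal terms of the truncated sum are negative, and off the diagonal the truncation costs at most
  \<open>2 * sqrt (r / \<bar>u\<bar>)\<close>, which sums to order \<open>sqrt r * N\<^sup>2\<close> over separated points.
\<close>

lemma disc_energy_ge_truncated:
  assumes sep: "separated \<theta> N x" and th: "\<theta> > 0" and N: "N > 0" and r: "0 < r" "r \<le> 1"
  shows "\<theta> * (\<Sum>i\<in>{1..N}. \<Sum>j\<in>{1..N}. trunc_log r (x i - x j)) / (real N)\<^sup>2
      - (\<Sum>i\<in>{1..N}. V (x i)) / real N - 8 * sqrt (r * \<theta>) \<le> disc_energy \<theta> V N x"
proof -
  have "(\<Sum>i\<in>{1..N}. \<Sum>j\<in>{1..N}. trunc_log r (x i - x j))
    \<le> (\<Sum>i\<in>{1..N}. \<Sum>j\<in>{1..N} - {i}. trunc_log r (x i - x j))"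
  proof (rule sum_mono)
    fix i assume i: "i \<in> {1..N}"
    have "ln r \<le> 0" using r by simp
    moreover have "trunc_log r (x i - x i) = ln r - 1" using r by (simp add: trunc_log_def)
    ultimately have "trunc_log r (x i - x i) \<le> 0" by linarith
    moreover have "(\<Sum>j\<in>{1..N}. trunc_log r (x i - x j))
      = trunc_log r (x i - x i) + (\<Sum>j\<in>{1..N} - {i}. trunc_log r (x i - x j))"
      by (rule sum.remove) (use i in auto)
    ultimately show "(\<Sum>j\<in>{1..N}. trunc_log r (x i - x j)) \<le> (\<Sum>j\<in>{1..N} - {i}. trunc_log r (x i - x j))"
      by linarith
  qed
  also have "\<dots> \<le> (\<Sum>i\<in>{1..N}. \<Sum>j\<in>{1..N} - {i}. ln \<bar>x i - x j\<bar> + 2 * sqrt r * (1 / sqrt \<bar>x i - x j\<bar>))"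
  proof (intro sum_mono)
    fix i j assume "i \<in> {1..N}" "j \<in> {1..N} - {i}"
    then have "\<theta> / real N \<le> \<bar>x i - x j\<bar>" using separated_gap[OF sep th N, of i j] by auto
    then have "x i - x j \<noteq> 0" using th N by (smt (verit) divide_pos_pos of_nat_0_less_iff)
    from trunc_log_le_ln_add_sqrt[OF r(1) this]
    show "trunc_log r (x i - x j) \<le> ln \<bar>x i - x j\<bar> + 2 * sqrt r * (1 / sqrt \<bar>x i - x j\<bar>)"
      by (simp add: real_sqrt_divide)
  qed
  also have "\<dots> = (\<Sum>i\<in>{1..N}. \<Sum>j\<in>{1..N} - {i}. ln \<bar>x i - x j\<bar>)
      + 2 * sqrt r * (\<Sum>i\<in>{1..N}. \<Sum>j\<in>{1..N} - {i}. 1 / sqrt \<bar>x i - x j\<bar>)"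
    by (simp only: sum.distrib sum_distrib_left)
  also have "\<dots> \<le> (\<Sum>i\<in>{1..N}. \<Sum>j\<in>{1..N} - {i}. ln \<bar>x i - x j\<bar>)
      + 2 * sqrt r * (4 * real N * sqrt (real N) / sqrt (\<theta> / real N))"
    using sep th N r unfolding separated_def
    by (intro add_left_mono mult_left_mono sum_inverse_sqrt_gaps_le) auto
  also have "4 * real N * sqrt (real N) / sqrt (\<theta> / real N) = 4 * (real N)\<^sup>2 / sqrt \<theta>"
    using th N by (simp add: real_sqrt_divide power2_eq_square)
  finally have "(\<Sum>i\<in>{1..N}. \<Sum>j\<in>{1..N}. trunc_log r (x i - x j))
    \<le> (\<Sum>i\<in>{1..N}. \<Sum>j\<in>{1..N} - {i}. ln \<bar>x i - x j\<bar>) + 2 * sqrt r * (4 * (real N)\<^sup>2 / sqrt \<theta>)" .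
  then have "\<theta> * (\<Sum>i\<in>{1..N}. \<Sum>j\<in>{1..N}. trunc_log r (x i - x j)) / (real N)\<^sup>2
    \<le> \<theta> * ((\<Sum>i\<in>{1..N}. \<Sum>j\<in>{1..N} - {i}. ln \<bar>x i - x j\<bar>) + 2 * sqrt r * (4 * (real N)\<^sup>2 / sqrt \<theta>)) / (real N)\<^sup>2"
    using th by (intro divide_right_mono mult_left_mono) auto
  also have "\<dots> = \<theta> * (\<Sum>i\<in>{1..N}. \<Sum>j\<in>{1..N} - {i}. ln \<bar>x i - x j\<bar>) / (real N)\<^sup>2 + 8 * sqrt r * (\<theta> / sqrt \<theta>)"
    using N by (simp add: field_simps)
  also have "\<theta> / sqrt \<theta> = sqrt \<theta>" using th by (simp add: real_div_sqrt)
  finally show ?thesis unfolding disc_energy_def by (simp add: real_sqrt_mult)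
qed

text \<open>
  Extends a function that is Lipschitz on \<open>[-B, B]\<close> to a Lipschitz function on the line.
\<close>

definition clip :: "real \<Rightarrow> real \<Rightarrow> real" where
  "clip B x = max (-B) (min B x)"

lemma clipped_lipschitz:
  assumes "\<And>x y. x \<in> {-B..B} \<Longrightarrow> y \<in> {-B..B} \<Longrightarrow> \<bar>V x - V y\<bar> \<le> L * \<bar>x - y\<bar>" "B > 0"
  shows "\<bar>V (clip B x) - V (clip B y)\<bar> \<le> L * \<bar>x - y\<bar>"
proof -
  have "L \<ge> 0" using assms(1)[of 0 B] assms(2) by (auto simp: zero_le_mult_iff dest!: order_trans[OF abs_ge_zero])
  have "\<bar>V (clip B x) - V (clip B y)\<bar> \<le> L * \<bar>clip B x - clip B y\<bar>"
    using assms by (intro assms(1)) (auto simp: clip_def)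
  also have "\<dots> \<le> L * \<bar>x - y\<bar>"
    using \<open>L \<ge> 0\<close> by (intro mult_left_mono) (auto simp: clip_def)
  finally show ?thesis .
qed

lemma clip_id: "x \<in> {-B..B} \<Longrightarrow> clip B x = x"
  by (auto simp: clip_def)

text \<open>
  Each scaled quantile \<open>N * q i\<close> is rounded up to the next point of \<open>\<int> + \<theta> * i\<close>, which moves it by less
  than \<open>1\<close>. The quantiles are \<open>\<theta>/N\<close> apart, so the integer parts stay monotone.
\<close>

lemma config_of_density:
  assumes th: "\<theta> > 0" and B: "B > 0" and N: "N > 0" and r: "0 < r" "r \<le> 1"
    and lipV: "\<And>x y. x \<in> {-(B+1)..B+1} \<Longrightarrow> y \<in> {-(B+1)..B+1} \<Longrightarrow> \<bar>V x - V y\<bar> \<le> L * \<bar>x - y\<bar>"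
    and adm: "admissible \<theta> B \<rho>"
  obtains l where "l \<in> particle_configs \<theta> N"
    "energy \<theta> V r B \<rho> - 8 * sqrt (r * \<theta>) - (2 * B + 1) * (2 * \<theta> / r + L) / real N
      \<le> disc_energy \<theta> V N (\<lambda>i. l i / real N)"
proof -
  let ?M = "lebesgue_Icc (-B) B"
  obtain q where q: "\<And>i. i \<in> {1..N} \<Longrightarrow> q i \<in> {-B..B}" "separated \<theta> N q"
    "quadrature B \<rho> {1..N} q N (2 * B / real N)"
    using quantiles_exist[OF th B N adm] by blast
  define lam where "lam i = \<lceil>real N * q i - \<theta> * real i\<rceil>" for i :: nat
  define l where "l = restrict (\<lambda>i. of_int (lam i) + \<theta> * real i) {1..N}"
  define x where "x i = l i / real N" for i
  have "mono_on {1..N} lam"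
  proof (rule mono_onI)
    fix i j assume ij: "i \<in> {1..N}" "j \<in> {1..N}" "i \<le> j"
    have "real N * q i - \<theta> * real i \<le> real N * q j - \<theta> * real j"
    proof (cases "i = j")
      case False
      then have "\<theta> / real N * real (j - i) \<le> q j - q i" using q(2) ij unfolding separated_def by auto
      then have "real N * (\<theta> / real N * real (j - i)) \<le> real N * (q j - q i)" by (intro mult_left_mono) auto
      then show ?thesis using N ij by (simp add: of_nat_diff algebra_simps)
    qed auto
    then show "lam i \<le> lam j" unfolding lam_def by (rule ceiling_mono)
  qed
  then have l: "l \<in> particle_configs \<theta> N"
    unfolding particle_configs_def l_def by auto
  have sep: "separated \<theta> N x"
    unfolding x_def by (rule particle_configs_separated[OF l])
  have xq: "q i \<le> x i \<and> x i \<le> q i + 1 / real N" if "i \<in> {1..N}" for i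
  proof -
    have "real N * q i \<le> l i" "l i \<le> real N * q i + 1"
      using that unfolding l_def lam_def by (auto, linarith+)
    then show ?thesis using N unfolding x_def by (auto simp: field_simps)
  qed
  define \<tau> where "\<tau> = (2 * B + 1) / real N"
  have quad: "quadrature B \<rho> {1..N} x N \<tau>"
    unfolding quadrature_def
  proof (intro allI impI)
    fix g :: "real \<Rightarrow> real" and K :: real assume "\<forall>x y. \<bar>g x - g y\<bar> \<le> K * \<bar>x - y\<bar>"
    then have lip: "\<And>x y. \<bar>g x - g y\<bar> \<le> K * \<bar>x - y\<bar>" by blast
    have K: "K \<ge> 0" by (rule lipschitz_measurable_bounded(1)[OF lip])
    have "\<bar>(\<integral>t. g t * \<rho> t \<partial>?M) - (\<Sum>i\<in>{1..N}. g (q i)) / real N\<bar> \<le> K * (2 * B / real N)"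
      by (rule quadratureD[OF q(3) lip])
    moreover have "\<bar>(\<Sum>i\<in>{1..N}. g (q i)) / real N - (\<Sum>i\<in>{1..N}. g (x i)) / real N\<bar> \<le> K * (1 / real N)"
    proof -
      have "\<bar>(\<Sum>i\<in>{1..N}. g (q i)) / real N - (\<Sum>i\<in>{1..N}. g (x i)) / real N\<bar>
        = \<bar>\<Sum>i\<in>{1..N}. g (q i) - g (x i)\<bar> / real N"
        by (simp add: sum_subtractf diff_divide_distrib[symmetric])
      also have "\<dots> \<le> (\<Sum>i\<in>{1..N}. K * (1 / real N)) / real N"
      proof (intro divide_right_mono order_trans[OF sum_abs] sum_mono)
        fix i assume "i \<in> {1..N}"
        then have "K * \<bar>q i - x i\<bar> \<le> K * (1 / real N)" using xq[of i] K by (intro mult_left_mono) auto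
        then show "\<bar>g (q i) - g (x i)\<bar> \<le> K * (1 / real N)" using lip[of "q i" "x i"] by linarith
      qed auto
      also have "\<dots> = K * (1 / real N)" using N by simp
      finally show ?thesis .
    qed
    moreover have "K * (2 * B / real N) + K * (1 / real N) = K * \<tau>"
      by (simp add: \<tau>_def add_divide_distrib distrib_left)
    ultimately show "\<bar>(\<integral>t. g t * \<rho> t \<partial>?M) - (\<Sum>i\<in>{1..N}. g (x i)) / real N\<bar> \<le> K * \<tau>" by linarith
  qed
  define J where "J = (\<integral>s. \<integral>t. trunc_log r (s - t) * \<rho> s * \<rho> t \<partial>?M \<partial>?M)"
  define T where "T = (\<Sum>i\<in>{1..N}. \<Sum>j\<in>{1..N}. trunc_log r (x i - x j)) / (real N)\<^sup>2"
  have JT: "\<bar>J - T\<bar> \<le> 2 * \<tau> / r"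
    unfolding J_def T_def using adm
    by (intro double_quadrature[OF quad r(1) N, where D="1 / \<theta>"]) (auto simp: admissible_def)
  define W where "W y = V (clip (B + 1) y)" for y
  have lipW: "\<bar>W y - W z\<bar> \<le> L * \<bar>y - z\<bar>" for y z
    unfolding W_def by (rule clipped_lipschitz[OF lipV]) (use B in auto)
  have "\<bar>(\<integral>t. W t * \<rho> t \<partial>?M) - (\<Sum>i\<in>{1..N}. W (x i)) / real N\<bar> \<le> L * \<tau>"
    by (rule quadratureD[OF quad lipW])
  moreover have "(\<integral>t. W t * \<rho> t \<partial>?M) = (\<integral>t. V t * \<rho> t \<partial>?M)"
    by (intro Bochner_Integration.integral_cong refl) (auto simp: W_def clip_id)
  moreover have "(\<Sum>i\<in>{1..N}. W (x i)) = (\<Sum>i\<in>{1..N}. V (x i))"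
  proof (rule sum.cong)
    fix i assume i: "i \<in> {1..N}"
    have "1 / real N \<le> 1" using N by simp
    then have "x i \<in> {-(B+1)..B+1}" using xq[OF i] q(1)[OF i] by auto
    then show "W (x i) = V (x i)" by (simp add: W_def clip_id)
  qed simp
  ultimately have VV: "\<bar>(\<integral>t. V t * \<rho> t \<partial>?M) - (\<Sum>i\<in>{1..N}. V (x i)) / real N\<bar> \<le> L * \<tau>" by simp
  have "\<theta> * (J - T) \<le> \<theta> * (2 * \<tau> / r)" using JT th by (intro mult_left_mono) auto
  moreover have "energy \<theta> V r B \<rho> = \<theta> * J - (\<integral>t. V t * \<rho> t \<partial>?M)" by (simp add: energy_def J_def)
  moreover have "\<theta> * T - (\<Sum>i\<in>{1..N}. V (x i)) / real N - 8 * sqrt (r * \<theta>) \<le> disc_energy \<theta> V N x"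
    using disc_energy_ge_truncated[OF sep th N r, of V] by (simp add: T_def)
  moreover have "(2 * B + 1) * (2 * \<theta> / r + L) / real N = \<theta> * (2 * \<tau> / r) + L * \<tau>"
    using r N by (simp add: \<tau>_def field_simps)
  ultimately have "energy \<theta> V r B \<rho> - 8 * sqrt (r * \<theta>) - (2 * B + 1) * (2 * \<theta> / r + L) / real N
      \<le> disc_energy \<theta> V N x"
    using VV by (simp add: right_diff_distrib abs_le_iff)
  then show thesis using that[OF l] by (simp add: x_def[abs_def])
qed

section \<open>From configurations to densities\<close>

definition log_potential :: "real \<Rightarrow> real \<Rightarrow> (real \<Rightarrow> real) \<Rightarrow> real \<Rightarrow> real" where
  "log_potential r B b s = (\<integral>t. trunc_log r (s - t) * b t \<partial>lebesgue_Icc (-B) B)"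

lemma integral_ln_add_ge:
  fixes r :: real
  assumes "0 < r" "r \<le> 1"
  shows "- 4 \<le> (\<integral>u. indicator {-1..1} u * (ln (\<bar>u\<bar> + r) - 1) \<partial>lborel)"
    "integrable lborel (\<lambda>u. indicator {-1..1} u * (ln (\<bar>u\<bar> + r) - 1))"
proof -
  have 1: "(\<integral>u. (ln (u + r) - 1) * indicator {0..1} u \<partial>lborel) = ((1 + r) * ln (1 + r) - 2 * 1) - ((0 + r) * ln (0 + r) - 2 * 0)"
    using assms
    by (intro integral_FTC_Icc_real) (auto intro!: derivative_eq_intros continuous_intros)
  have 2: "(\<integral>u. (ln (r - u) - 1) * indicator {-1..0} u \<partial>lborel)
    = (- ((r - 0) * ln (r - 0)) - 2 * 0) - (- ((r - (-1)) * ln (r - (-1))) - 2 * (-1))"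
    using assms
    by (intro integral_FTC_Icc_real) (auto intro!: derivative_eq_intros continuous_intros)
  have 3: "(1 + r) * ln (1 + r) \<ge> 0" "r * ln r \<le> 0"
    using assms by (auto intro!: mult_nonneg_nonpos)
  have i: "integrable lborel (\<lambda>u. indicator {-1..1} u *\<^sub>R (ln (\<bar>u\<bar> + r) - 1))"
    by (rule borel_integrable_compact) (use assms in \<open>auto intro!: continuous_intros\<close>)
  then show i': "integrable lborel (\<lambda>u. indicator {-1..1} u * (ln (\<bar>u\<bar> + r) - 1))" by simp
  have i1: "integrable lborel (\<lambda>u. (ln (u + r) - 1) * indicator {0..1} u)"
    by (rule Bochner_Integration.integrable_bound[OF i']) (auto simp: indicator_def)
  have i2: "integrable lborel (\<lambda>u. (ln (r - u) - 1) * indicator {-1..0} u)"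
    by (rule Bochner_Integration.integrable_bound[OF i']) (auto simp: indicator_def add.commute)
  have "(\<integral>u. (ln (u + r) - 1) * indicator {0..1} u + (ln (r - u) - 1) * indicator {-1..0} u \<partial>lborel)
    \<le> (\<integral>u. indicator {-1..1} u * (ln (\<bar>u\<bar> + r) - 1) \<partial>lborel)"
  proof (rule integral_mono)
    fix u :: real
    have "ln r \<le> 0" using assms by simp
    then show "(ln (u + r) - 1) * indicator {0..1} u + (ln (r - u) - 1) * indicator {-1..0} u
      \<le> indicator {-1..1} u * (ln (\<bar>u\<bar> + r) - 1)"
      by (auto simp: indicator_def add.commute)
  qed (use i' i1 i2 in auto)
  then show "- 4 \<le> (\<integral>u. indicator {-1..1} u * (ln (\<bar>u\<bar> + r) - 1) \<partial>lborel)"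
    using i1 i2 1 2 3 by (simp add: add.commute)
qed

text \<open>
  For a density of height at most \<open>1/\<theta>\<close> only the part within distance \<open>1\<close> of \<open>s\<close> contributes negatively,
  and \<open>ln\<close> is integrable at \<open>0\<close>; hence a bound independent of \<open>r\<close>.
\<close>

lemma log_potential_ge:
  assumes th: "\<theta> > 0" and r: "0 < r" "r \<le> 1"
    and bm [measurable]: "b \<in> borel_measurable borel" and b: "\<And>x. 0 \<le> b x" "\<And>x. b x \<le> 1 / \<theta>"
  shows "- 4 / \<theta> \<le> log_potential r B b s"
    and "integrable (lebesgue_Icc (-B) B) (\<lambda>t. trunc_log r (s - t) * b t)"
proof -
  let ?M = "lebesgue_Icc (-B) B"
  let ?h = "\<lambda>u. indicator {-1..1} u * (ln (\<bar>u\<bar> + r) - 1) :: real"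
  show int: "integrable ?M (\<lambda>t. trunc_log r (s - t) * b t)"
  proof (rule integrable_lebesgue_Icc)
    fix t assume t: "t \<in> {-B..B}"
    have "\<bar>trunc_log r (s - t)\<bar> \<le> \<bar>trunc_log r 0\<bar> + (\<bar>s\<bar> + B) / r"
      using t by (intro trunc_log_bounded r) auto
    then show "\<bar>trunc_log r (s - t) * b t\<bar> \<le> (\<bar>trunc_log r 0\<bar> + (\<bar>s\<bar> + B) / r) * (1 / \<theta>)"
      unfolding abs_mult using b[of t] by (intro mult_mono) auto
  qed measurable
  have h0: "?h u \<le> 0" for u
  proof -
    have "ln (\<bar>u\<bar> + r) \<le> 1" if "\<bar>u\<bar> \<le> 1"
    proof -
      have "ln (\<bar>u\<bar> + r) \<le> \<bar>u\<bar> + r - 1" using r by (intro ln_le_minus_one) auto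
      then show ?thesis using that r by linarith
    qed
    then show ?thesis by (auto simp: indicator_def abs_le_iff)
  qed
  have hint: "integrable lborel (\<lambda>t. ?h (s - t))"
    using lborel_integrable_real_affine[OF integral_ln_add_ge(2)[OF r], of "-1" s] by simp
  have hval: "(\<integral>t. ?h (s - t) \<partial>lborel) = (\<integral>u. ?h u \<partial>lborel)"
    by (subst lborel_integral_real_affine[where c="-1" and t=s and f="?h"]) simp_all
  have hintM: "integrable lborel (\<lambda>t. indicator {-B..B} t * (?h (s - t) * (1 / \<theta>)))"
  proof (rule Bochner_Integration.integrable_bound)
    show "integrable lborel (\<lambda>t. ?h (s - t) * (1 / \<theta>))" using hint by simp
    show "AE t in lborel. norm (indicator {-B..B} t * (?h (s - t) * (1 / \<theta>))) \<le> norm (?h (s - t) * (1 / \<theta>))"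
      by (intro AE_I2) (auto simp: indicator_def)
  qed measurable
  have "- 4 / \<theta> \<le> (\<integral>t. ?h (s - t) * (1 / \<theta>) \<partial>lborel)"
    using divide_right_mono[OF integral_ln_add_ge(1)[OF r], of \<theta>] th hval by simp
  also have "\<dots> \<le> (\<integral>t. indicator {-B..B} t * (?h (s - t) * (1 / \<theta>)) \<partial>lborel)"
  proof (rule integral_mono[OF _ hintM])
    fix t show "?h (s - t) * (1 / \<theta>) \<le> indicator {-B..B} t * (?h (s - t) * (1 / \<theta>))"
      using mult_nonpos_nonneg[OF h0[of "s - t"], of "1 / \<theta>"] th by (simp add: indicator_def)
  qed (use hint in simp)
  also have "\<dots> \<le> (\<integral>t. indicator {-B..B} t * (trunc_log r (s - t) * b t) \<partial>lborel)"
  proof (rule integral_mono[OF hintM])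
    show "integrable lborel (\<lambda>t. indicator {-B..B} t * (trunc_log r (s - t) * b t))"
      using int by (simp add: integrable_restrict_space set_integrable_def)
    fix t
    have "?h (s - t) * (1 / \<theta>) \<le> trunc_log r (s - t) * b t"
    proof (cases "\<bar>s - t\<bar> \<le> 1")
      case True
      then have hh: "?h (s - t) \<le> trunc_log r (s - t)"
        using trunc_log_ge_ln_add[OF r(1), of "s - t"] by (auto simp: indicator_def)
      have "?h (s - t) * (1 / \<theta>) \<le> ?h (s - t) * b t"
        using h0[of "s - t"] b[of t] by (intro mult_left_mono_neg) auto
      also have "\<dots> \<le> trunc_log r (s - t) * b t" by (intro mult_right_mono hh b)
      finally show ?thesis .
    next
      case False
      then have "trunc_log r (s - t) \<ge> 0" using r by (simp add: trunc_log_def)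
      moreover have "?h (s - t) = 0" using False by (auto simp: indicator_def)
      ultimately show ?thesis using b(1)[of t] by (simp only: mult_zero_left mult_nonneg_nonneg)
    qed
    then show "indicator {-B..B} t * (?h (s - t) * (1 / \<theta>)) \<le> indicator {-B..B} t * (trunc_log r (s - t) * b t)"
      by (intro mult_left_mono) auto
  qed
  also have "\<dots> = log_potential r B b s"
    by (simp add: log_potential_def integral_lebesgue_Icc_lborel)
  finally show "- 4 / \<theta> \<le> log_potential r B b s" .
qed

lemma integrable_log_potential_mult:
  assumes th: "\<theta> > 0" and r: "0 < r" "r \<le> 1" and B: "B > 0"
    and bm [measurable]: "b \<in> borel_measurable borel" and b: "\<And>x. 0 \<le> b x" "\<And>x. b x \<le> 1 / \<theta>"
    and cm [measurable]: "c \<in> borel_measurable borel" and c: "\<And>x. 0 \<le> c x" "\<And>x. c x \<le> C"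
  shows "integrable (lebesgue_Icc (-B) B) (\<lambda>s. log_potential r B b s * c s)"
proof (rule integrable_lebesgue_Icc)
  have "(\<lambda>s. log_potential r B b s) \<in> borel_measurable borel"
    unfolding log_potential_def by (rule measurable_integral_lebesgue_Icc) measurable
  then show "(\<lambda>s. log_potential r B b s * c s) \<in> borel_measurable borel" by measurable
  define T where "T = \<bar>trunc_log r 0\<bar> + 2 * B / r"
  fix s assume s: "s \<in> {-B..B}"
  have "\<bar>log_potential r B b s\<bar> \<le> (B - (-B)) * (T * (1 / \<theta>))"
    unfolding log_potential_def
  proof (rule integral_lebesgue_Icc_abs_le)
    fix t assume t: "t \<in> {-B..B}"
    have "\<bar>trunc_log r (s - t)\<bar> \<le> T"
      unfolding T_def using s t by (intro trunc_log_bounded r) auto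
    then show "\<bar>trunc_log r (s - t) * b t\<bar> \<le> T * (1 / \<theta>)"
      unfolding abs_mult using b[of t] by (intro mult_mono) auto
  qed (use B in auto)
  then show "\<bar>log_potential r B b s * c s\<bar> \<le> (B - (-B)) * (T * (1 / \<theta>)) * C"
    unfolding abs_mult using c[of s] by (intro mult_mono) auto
qed

lemma double_integral_eq_log_potential:
  "(\<integral>s. \<integral>t. trunc_log r (s - t) * b s * b t \<partial>lebesgue_Icc (-B) B \<partial>lebesgue_Icc (-B) B)
    = (\<integral>s. log_potential r B b s * b s \<partial>lebesgue_Icc (-B) B)"
proof (intro Bochner_Integration.integral_cong refl)
  fix s
  have "(\<integral>t. trunc_log r (s - t) * b s * b t \<partial>lebesgue_Icc (-B) B)
    = (\<integral>t. b s * (trunc_log r (s - t) * b t) \<partial>lebesgue_Icc (-B) B)"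
    by (simp add: mult_ac)
  then show "(\<integral>t. trunc_log r (s - t) * b s * b t \<partial>lebesgue_Icc (-B) B) = log_potential r B b s * b s"
    by (simp add: log_potential_def)
qed

text \<open>
  Mass \<open>p\<close> that is missing from a density is put into the unused capacity of \<open>[-\<theta>, \<theta>]\<close>. That interval can
  hold mass \<open>2\<close> at density \<open>1/\<theta>\<close>, so there is always room for mass \<open>1\<close>. The energy decreases by at most a
  constant times \<open>p\<close>, since logarithmic potentials are bounded below.
\<close>

lemma refill_density:
  assumes th: "\<theta> > 0" and B: "B \<ge> \<theta>" and r: "0 < r" "r \<le> 1"
    and am [measurable]: "a \<in> borel_measurable borel" and a: "\<And>x. 0 \<le> a x" "\<And>x. a x \<le> 1 / \<theta>"
    and mass: "(\<integral>x. a x \<partial>lebesgue_Icc (-B) B) = 1 - p" and p: "0 \<le> p" "p \<le> 1"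
    and V: "continuous_on UNIV V" and Vm: "\<And>x. \<bar>x\<bar> \<le> \<theta> \<Longrightarrow> \<bar>V x\<bar> \<le> Vm"
  obtains \<rho> where "admissible \<theta> B \<rho>"
    "energy \<theta> V r B a - (8 + Vm) * p \<le> energy \<theta> V r B \<rho>"
    "\<And>f Mf. f \<in> borel_measurable borel \<Longrightarrow> (\<And>x. \<bar>f x\<bar> \<le> Mf) \<Longrightarrow>
      \<bar>(\<integral>x. f x * \<rho> x \<partial>lebesgue_Icc (-B) B) - (\<integral>x. f x * a x \<partial>lebesgue_Icc (-B) B)\<bar> \<le> Mf * p"
proof -
  let ?M = "lebesgue_Icc (-B) B"
  have B0: "B > 0" using th B by linarith
  have inta: "integrable ?M a" using a by (intro integrable_lebesgue_Icc[where C="1 / \<theta>"]) auto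
  \<comment> \<open>the unused capacity near the origin\<close>
  define v where "v x = indicator {-\<theta>..\<theta>} x * (1 / \<theta> - a x)" for x
  have v: "0 \<le> v x" "v x \<le> 1 / \<theta>" for x
    using a[of x] th by (auto simp: v_def indicator_def)
  have vm [measurable]: "v \<in> borel_measurable borel" unfolding v_def by measurable
  have intv: "integrable ?M v" using v by (intro integrable_lebesgue_Icc[where C="1 / \<theta>"]) auto
  define Z where "Z = (\<integral>x. v x \<partial>?M)"
  have Z: "Z \<ge> 1"
  proof -
    have i: "integrable ?M (\<lambda>x. indicator {-\<theta>..\<theta>} x * (1 / \<theta>))"
      using th by (intro integrable_lebesgue_Icc[where C="1 / \<theta>"]) (auto simp: indicator_def)
    have "(\<integral>x. indicator {-\<theta>..\<theta>} x * (1 / \<theta>) \<partial>?M) = (\<integral>x. indicator {-\<theta>..\<theta>} x * (1 / \<theta>) \<partial>lborel)"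
      unfolding integral_lebesgue_Icc_lborel using B
      by (intro Bochner_Integration.integral_cong) (auto simp: indicator_def)
    also have "\<dots> = 2" using th by simp
    finally have "2 - (1 - p) = (\<integral>x. indicator {-\<theta>..\<theta>} x * (1 / \<theta>) - a x \<partial>?M)"
      using i inta mass by simp
    also have "\<dots> \<le> Z"
      unfolding Z_def using i inta intv a(1)
      by (intro integral_mono Bochner_Integration.integrable_diff) (auto simp: v_def indicator_def)
    finally show ?thesis using p by simp
  qed
  define w where "w x = v x / Z" for x
  have w0: "0 \<le> w x" for x using v Z by (simp add: w_def)
  have wv: "w x \<le> v x" for x
    unfolding w_def using v[of x] Z by (simp add: pos_divide_le_eq mult_le_cancel_left1)
  have w1: "w x \<le> 1 / \<theta>" for x using wv[of x] v[of x] by linarith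
  have wm [measurable]: "w \<in> borel_measurable borel" unfolding w_def by measurable
  have intw: "integrable ?M w" using intv unfolding w_def by simp
  have massw: "(\<integral>x. w x \<partial>?M) = 1" unfolding w_def using Z by (simp add: Z_def[symmetric])
  define \<rho> where "\<rho> x = a x + p * w x" for x
  have r0: "0 \<le> \<rho> x" for x unfolding \<rho>_def using a w0 p by (intro add_nonneg_nonneg mult_nonneg_nonneg) auto
  have r1: "\<rho> x \<le> 1 / \<theta>" for x
  proof -
    have "p * w x \<le> 1 * v x" using wv[of x] w0[of x] p by (intro mult_mono) auto
    then have "\<rho> x \<le> a x + v x" by (simp add: \<rho>_def)
    also have "\<dots> \<le> 1 / \<theta>" using a[of x] by (auto simp: v_def indicator_def)
    finally show ?thesis .
  qed
  have rm [measurable]: "\<rho> \<in> borel_measurable borel" unfolding \<rho>_def by measurable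
  have "(\<integral>x. \<rho> x \<partial>?M) = 1" unfolding \<rho>_def using inta intw mass massw by simp
  then have adm: "admissible \<theta> B \<rho>" unfolding admissible_def using r0 r1 rm by auto
  have fint: "integrable ?M (\<lambda>x. f x * c x)"
    if "f \<in> borel_measurable borel" "\<And>x. x \<in> {-B..B} \<Longrightarrow> \<bar>f x\<bar> \<le> C" "c \<in> borel_measurable borel"
      "\<And>x. 0 \<le> c x" "\<And>x. c x \<le> 1 / \<theta>" for f c :: "real \<Rightarrow> real" and C
  proof (rule integrable_lebesgue_Icc)
    fix x assume x: "x \<in> {-B..B}"
    show "\<bar>f x * c x\<bar> \<le> C * (1 / \<theta>)"
      unfolding abs_mult using that(2)[OF x] that(4)[of x] that(5)[of x] by (intro mult_mono) auto
  qed (use that in measurable)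
  have split: "(\<integral>x. f x * \<rho> x \<partial>?M) = (\<integral>x. f x * a x \<partial>?M) + p * (\<integral>x. f x * w x \<partial>?M)"
    if "f \<in> borel_measurable borel" "\<And>x. x \<in> {-B..B} \<Longrightarrow> \<bar>f x\<bar> \<le> C" for f C
  proof -
    have "(\<integral>x. f x * \<rho> x \<partial>?M) = (\<integral>x. f x * a x + p * (f x * w x) \<partial>?M)"
      by (intro Bochner_Integration.integral_cong refl) (simp add: \<rho>_def algebra_simps)
    also have "\<dots> = (\<integral>x. f x * a x \<partial>?M) + p * (\<integral>x. f x * w x \<partial>?M)"
      using fint[OF that am a] fint[OF that wm w0 w1] by simp
    finally show ?thesis .
  qed
  have wbound: "\<bar>\<integral>x. f x * w x \<partial>?M\<bar> \<le> C"
    if "f \<in> borel_measurable borel" "\<And>x. x \<in> {-B..B} \<Longrightarrow> \<bar>f x\<bar> \<le> D" "\<And>x. w x \<noteq> 0 \<Longrightarrow> \<bar>f x\<bar> \<le> C" for f C D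
  proof -
    have "\<bar>\<integral>x. f x * w x \<partial>?M\<bar> \<le> (\<integral>x. \<bar>f x * w x\<bar> \<partial>?M)" by (rule integral_abs_bound)
    also have "\<dots> \<le> (\<integral>x. C * w x \<partial>?M)"
    proof (rule integral_mono)
      show "integrable ?M (\<lambda>x. \<bar>f x * w x\<bar>)"
        by (rule Bochner_Integration.integrable_abs[OF fint[OF that(1,2) wm w0 w1]])
      show "\<bar>f x * w x\<bar> \<le> C * w x" for x
        using that(3)[of x] w0[of x] by (cases "w x = 0") (auto simp: abs_mult intro: mult_right_mono)
    qed (use intw in auto)
    also have "\<dots> = C" using massw by simp
    finally show ?thesis .
  qed
  define J where "J c = (\<integral>s. log_potential r B c s * c s \<partial>?M)" for c
  have Jge: "J a - 8 * p / \<theta> \<le> J \<rho>"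
  proof -
    have U: "log_potential r B \<rho> s = log_potential r B a s + p * log_potential r B w s" for s
    proof -
      have "log_potential r B \<rho> s = (\<integral>t. trunc_log r (s - t) * a t + p * (trunc_log r (s - t) * w t) \<partial>?M)"
        unfolding log_potential_def \<rho>_def
        by (intro Bochner_Integration.integral_cong refl) (simp add: algebra_simps)
      also have "\<dots> = log_potential r B a s + p * log_potential r B w s"
        using log_potential_ge(2)[OF th r am a] log_potential_ge(2)[OF th r wm w0 w1]
        by (simp add: log_potential_def)
      finally show ?thesis .
    qed
    note ip = integrable_log_potential_mult[OF th r B0]
    have "J \<rho> = (\<integral>s. log_potential r B a s * a s + p * (log_potential r B w s * a s)
        + p * (log_potential r B \<rho> s * w s) \<partial>?M)"
      unfolding J_def
    proof (intro Bochner_Integration.integral_cong refl)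
      fix s
      have "log_potential r B \<rho> s * \<rho> s = log_potential r B \<rho> s * a s + p * (log_potential r B \<rho> s * w s)"
        by (simp add: \<rho>_def algebra_simps)
      also have "log_potential r B \<rho> s * a s = log_potential r B a s * a s + p * (log_potential r B w s * a s)"
        by (simp add: U algebra_simps)
      finally show "log_potential r B \<rho> s * \<rho> s = log_potential r B a s * a s + p * (log_potential r B w s * a s)
        + p * (log_potential r B \<rho> s * w s)" .
    qed
    also have "\<dots> = J a + p * (\<integral>s. log_potential r B w s * a s \<partial>?M) + p * (\<integral>s. log_potential r B \<rho> s * w s \<partial>?M)"
      using ip[OF am a am a] ip[OF wm w0 w1 am a] ip[OF rm r0 r1 wm w0 w1] by (simp add: J_def)
    finally have E: "J \<rho> = J a + p * (\<integral>s. log_potential r B w s * a s \<partial>?M) + p * (\<integral>s. log_potential r B \<rho> s * w s \<partial>?M)" .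
    have lower: "- 4 / \<theta> * (\<integral>s. d s \<partial>?M) \<le> (\<integral>s. log_potential r B c s * d s \<partial>?M)"
      if c: "c \<in> borel_measurable borel" "\<And>x. 0 \<le> c x" "\<And>x. c x \<le> 1 / \<theta>"
        and d: "d \<in> borel_measurable borel" "\<And>x. 0 \<le> d x" "\<And>x. d x \<le> 1 / \<theta>" for c d
    proof -
      have id: "integrable ?M d" using d by (intro integrable_lebesgue_Icc[where C="1 / \<theta>"]) auto
      have "- 4 / \<theta> * (\<integral>s. d s \<partial>?M) = (\<integral>s. - 4 / \<theta> * d s \<partial>?M)" by simp
      also have "\<dots> \<le> (\<integral>s. log_potential r B c s * d s \<partial>?M)"
      proof (rule integral_mono)
        show "integrable ?M (\<lambda>s. log_potential r B c s * d s)" by (rule ip[OF c d])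
        show "- 4 / \<theta> * d s \<le> log_potential r B c s * d s" for s
          by (intro mult_right_mono log_potential_ge(1)[OF th r c] d)
      qed (use id in simp)
      finally show ?thesis .
    qed
    have l1: "- 4 / \<theta> \<le> (\<integral>s. log_potential r B w s * a s \<partial>?M)"
    proof -
      have "- 4 / \<theta> * 1 \<le> - 4 / \<theta> * (1 - p)" using th p by (intro mult_left_mono_neg) auto
      then show ?thesis using lower[OF wm w0 w1 am a] mass by simp
    qed
    have l2: "- 4 / \<theta> \<le> (\<integral>s. log_potential r B \<rho> s * w s \<partial>?M)"
      using lower[OF rm r0 r1 wm w0 w1] massw by simp
    have "p * (- 4 / \<theta>) \<le> p * (\<integral>s. log_potential r B w s * a s \<partial>?M)"
      "p * (- 4 / \<theta>) \<le> p * (\<integral>s. log_potential r B \<rho> s * w s \<partial>?M)"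
      by (rule mult_left_mono[OF l1 p(1)], rule mult_left_mono[OF l2 p(1)])
    moreover have "8 * p / \<theta> = - (p * (- 4 / \<theta>)) - (p * (- 4 / \<theta>))" by simp
    ultimately show ?thesis unfolding E by linarith
  qed
  have Vmeas: "V \<in> borel_measurable borel" by (rule borel_measurable_continuous_onI[OF V])
  obtain CV where CV: "\<And>x. x \<in> {-B..B} \<Longrightarrow> \<bar>V x\<bar> \<le> CV"
    using continuous_bounded_on_Icc[OF V] by blast
  have wsupp: "\<bar>x\<bar> \<le> \<theta>" if "w x \<noteq> 0" for x
    using that by (auto simp: w_def v_def indicator_def abs_le_iff split: if_splits)
  have "\<bar>\<integral>x. V x * w x \<partial>?M\<bar> \<le> Vm"
    using Vmeas CV Vm wsupp by (intro wbound[where D=CV]) auto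
  then have "p * (\<integral>x. V x * w x \<partial>?M) \<le> p * Vm" using p by (intro mult_left_mono) auto
  then have VV: "(\<integral>x. V x * \<rho> x \<partial>?M) \<le> (\<integral>x. V x * a x \<partial>?M) + p * Vm"
    using split[OF Vmeas CV] by simp
  have "\<theta> * (J a - 8 * p / \<theta>) \<le> \<theta> * J \<rho>" using Jge th by (intro mult_left_mono) auto
  then have JJ: "\<theta> * J a - 8 * p \<le> \<theta> * J \<rho>" using th by (simp add: right_diff_distrib)
  show thesis
  proof (rule that[OF adm])
    show "energy \<theta> V r B a - (8 + Vm) * p \<le> energy \<theta> V r B \<rho>"
      using JJ VV unfolding energy_def double_integral_eq_log_potential J_def[symmetric]
      by (simp add: algebra_simps)
    fix f :: "real \<Rightarrow> real" and Mf assume f: "f \<in> borel_measurable borel" "\<And>x. \<bar>f x\<bar> \<le> Mf"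
    have "(\<integral>x. f x * \<rho> x \<partial>?M) - (\<integral>x. f x * a x \<partial>?M) = p * (\<integral>x. f x * w x \<partial>?M)"
      using split[OF f] by simp
    moreover have "\<bar>\<integral>x. f x * w x \<partial>?M\<bar> \<le> Mf" using f by (intro wbound) auto
    then have "p * \<bar>\<integral>x. f x * w x \<partial>?M\<bar> \<le> p * Mf" using p by (intro mult_left_mono) auto
    ultimately show "\<bar>(\<integral>x. f x * \<rho> x \<partial>?M) - (\<integral>x. f x * a x \<partial>?M)\<bar> \<le> Mf * p"
      using p by (simp add: abs_mult mult.commute)
  qed
qed

text \<open>
  For \<open>\<bar>x\<bar> \<le> K < \<bar>y\<bar>\<close> the distance is at most \<open>2 * \<bar>y\<bar>\<close>, and for two far points it is at most the product
  of \<open>2 * \<bar>x\<bar>\<close> and \<open>2 * \<bar>y\<bar>\<close>. So an interaction that involves a far point can be charged to the far points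
  alone.
\<close>

lemma trunc_log_far_le:
  assumes r: "0 < r" "r \<le> 1" and K: "K \<ge> 1"
    and m: "\<And>y. m y = (if \<bar>y\<bar> \<le> K then 0 else ln (2 * \<bar>y\<bar>))"
    and far: "\<not> (\<bar>x\<bar> \<le> K \<and> \<bar>y\<bar> \<le> K)"
  shows "trunc_log r (x - y) \<le> m x + m y"
proof -
  have le: "trunc_log r u \<le> ln z" if "\<bar>u\<bar> \<le> z" "z \<ge> 1" for u z
    using trunc_log_mono[OF r(1), of u z] that r by (simp add: trunc_log_def)
  have mpos: "m y \<ge> 0" for y using K by (auto simp: m)
  consider "\<bar>x\<bar> \<le> K" "\<bar>y\<bar> > K" | "\<bar>x\<bar> > K" "\<bar>y\<bar> \<le> K" | "\<bar>x\<bar> > K" "\<bar>y\<bar> > K" using far by linarith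
  then show ?thesis
  proof cases
    case 1
    have "trunc_log r (x - y) \<le> ln (2 * \<bar>y\<bar>)" using 1 K by (intro le) auto
    then show ?thesis using 1 by (simp add: m)
  next
    case 2
    have "trunc_log r (x - y) \<le> ln (2 * \<bar>x\<bar>)" using 2 K by (intro le) auto
    then show ?thesis using 2 by (simp add: m)
  next
    case 3
    have "trunc_log r (x - y) \<le> ln (2 * \<bar>x\<bar> * (2 * \<bar>y\<bar>))"
    proof (rule le)
      have "(\<bar>x\<bar> - 1) * (\<bar>y\<bar> - 1) \<ge> 0" using 3 K by simp
      then have "\<bar>x\<bar> + \<bar>y\<bar> \<le> \<bar>x\<bar> * \<bar>y\<bar> + 1" by (simp add: algebra_simps)
      moreover have xy: "1 \<le> \<bar>x\<bar> * \<bar>y\<bar>" using 3 K mult_mono[of 1 "\<bar>x\<bar>" 1 "\<bar>y\<bar>"] by simp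
      ultimately have "\<bar>x\<bar> + \<bar>y\<bar> \<le> 4 * (\<bar>x\<bar> * \<bar>y\<bar>)" by linarith
      then show "\<bar>x - y\<bar> \<le> 2 * \<bar>x\<bar> * (2 * \<bar>y\<bar>)" using abs_triangle_ineq4[of x y] by simp
      show "1 \<le> 2 * \<bar>x\<bar> * (2 * \<bar>y\<bar>)" using xy by simp
    qed
    also have "\<dots> = m x + m y" using 3 K by (subst ln_mult_pos) (auto simp: m)
    finally show ?thesis .
  qed
qed

text \<open>
  Smooth the particles in \<open>[-K, K]\<close> and replace those outside by mass \<open>p\<close> near the origin. A particle at
  \<open>y\<close> outside interacts with all others by at most \<open>2\<theta> ln (2 * \<bar>y\<bar>)\<close>, while it costs \<open>V y\<close>. By the choice
  of \<open>K\<close> the difference exceeds the price of refilling by \<open>1\<close>, which is where the term \<open>p\<close> on the left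
  comes from. The interval does not depend on \<open>r\<close>.
\<close>

lemma density_of_config:
  assumes th: "\<theta> > 0" and K: "K \<ge> 1" and B: "B = K + \<theta>" and r: "0 < r" "r \<le> 1"
    and V: "continuous_on UNIV V"
    and lipV: "\<And>x y. x \<in> {-B..B} \<Longrightarrow> y \<in> {-B..B} \<Longrightarrow> \<bar>V x - V y\<bar> \<le> L * \<bar>x - y\<bar>"
    and Vm: "\<And>x. \<bar>x\<bar> \<le> \<theta> \<Longrightarrow> \<bar>V x\<bar> \<le> Vm"
    and tail: "\<And>y. \<bar>y\<bar> > K \<Longrightarrow> 2 * \<theta> * ln (2 * \<bar>y\<bar>) + 9 + Vm \<le> V y"
    and N: "N > 0" and sep: "separated \<theta> N x"
  obtains \<rho> p where "admissible \<theta> B \<rho>" "0 \<le> p" "p \<le> 1"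
    "disc_energy \<theta> V N x + p \<le> energy \<theta> V r B \<rho> + (2 * \<theta>\<^sup>2 / r + L * \<theta> + \<theta> * (1 - ln r)) / real N"
    "\<And>f Lf Mf. (\<And>x y. \<bar>f x - f y\<bar> \<le> Lf * \<bar>x - y\<bar>) \<Longrightarrow> (\<And>x. \<bar>f x\<bar> \<le> Mf) \<Longrightarrow>
      \<bar>(\<integral>x. f x * \<rho> x \<partial>lebesgue_Icc (-B) B) - (\<Sum>i\<in>{1..N}. f (x i)) / real N\<bar> \<le> Lf * (\<theta> / real N) + 2 * Mf * p"
proof -
  let ?M = "lebesgue_Icc (-B) B"
  define I where "I = {i \<in> {1..N}. \<bar>x i\<bar> \<le> K}"
  define O' where "O' = {1..N} - I"
  have I: "I \<subseteq> {1..N}" "finite I" and fin: "finite O'" by (auto simp: I_def O'_def)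
  have IO: "{1..N} = I \<union> O'" "I \<inter> O' = {}" using I by (auto simp: O'_def)
  have IK: "\<And>i. i \<in> I \<Longrightarrow> \<bar>x i\<bar> \<le> K" by (simp add: I_def)
  have sumIO: "(\<Sum>i\<in>{1..N}. g i) = (\<Sum>i\<in>I. g i) + (\<Sum>i\<in>O'. g i)" for g :: "nat \<Rightarrow> real"
    unfolding IO(1) using I fin IO(2) by (intro sum.union_disjoint) auto
  define p where "p = real (card O') / real N"
  have cardIO: "real (card I) + real (card O') = real N"
    using sumIO[of "\<lambda>_. 1"] by simp
  have p: "0 \<le> p" "p \<le> 1" unfolding p_def using cardIO N by auto
  have K0: "K > 0" using K by simp
  define a where "a = (\<lambda>t. (\<Sum>i\<in>I. indicator {x i..<x i + \<theta> / real N} t) / \<theta>)"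
  note sm = smoothed_configuration[OF th K0 N sep I(1) IK B a_def]
  have mass: "(\<integral>t. a t \<partial>?M) = 1 - p"
    using sm(4) cardIO N by (simp add: p_def field_simps)
  have B\<theta>: "B \<ge> \<theta>" using B K by simp
  obtain \<rho> where rho: "admissible \<theta> B \<rho>"
    "energy \<theta> V r B a - (8 + Vm) * p \<le> energy \<theta> V r B \<rho>"
    "\<And>f Mf. f \<in> borel_measurable borel \<Longrightarrow> (\<And>x. \<bar>f x\<bar> \<le> Mf) \<Longrightarrow>
      \<bar>(\<integral>x. f x * \<rho> x \<partial>?M) - (\<integral>x. f x * a x \<partial>?M)\<bar> \<le> Mf * p"
    using refill_density[OF th B\<theta> r sm(1,2,3) mass p V Vm] by blast
  define m where "m y = (if \<bar>y\<bar> \<le> K then 0 else ln (2 * \<bar>y\<bar>))" for y :: real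
  define T where "T = (\<Sum>i\<in>I. \<Sum>j\<in>I. trunc_log r (x i - x j))"
  \<comment> \<open>the interaction among the inner particles is kept, every other pair is charged to its outer members\<close>
  have far: "trunc_log r (x i - x j) \<le> (if i \<in> I \<and> j \<in> I then trunc_log r (x i - x j) else 0) + (m (x i) + m (x j))"
    if "i \<in> {1..N}" "j \<in> {1..N}" for i j
  proof (cases "i \<in> I \<and> j \<in> I")
    case True
    then show ?thesis using IK by (simp add: m_def)
  next
    case False
    then have "\<not> (\<bar>x i\<bar> \<le> K \<and> \<bar>x j\<bar> \<le> K)" using that by (auto simp: I_def)
    from trunc_log_far_le[OF r K m_def this] False show ?thesis by auto
  qed
  have "(\<Sum>i\<in>{1..N}. \<Sum>j\<in>{1..N} - {i}. ln \<bar>x i - x j\<bar>) \<le> (\<Sum>i\<in>{1..N}. \<Sum>j\<in>{1..N} - {i}. trunc_log r (x i - x j))"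
  proof (intro sum_mono)
    fix i j assume "i \<in> {1..N}" "j \<in> {1..N} - {i}"
    then have "\<theta> / real N \<le> \<bar>x i - x j\<bar>" using separated_gap[OF sep th N, of i j] by auto
    then have "x i - x j \<noteq> 0" using th N by (smt (verit) divide_pos_pos of_nat_0_less_iff)
    then show "ln \<bar>x i - x j\<bar> \<le> trunc_log r (x i - x j)" by (intro trunc_log_ge_ln r)
  qed
  also have "\<dots> = (\<Sum>i\<in>{1..N}. (\<Sum>j\<in>{1..N}. trunc_log r (x i - x j)) - trunc_log r 0)"
  proof (rule sum.cong[OF refl])
    fix i assume i: "i \<in> {1..N}"
    have "(\<Sum>j\<in>{1..N}. trunc_log r (x i - x j))
      = trunc_log r (x i - x i) + (\<Sum>j\<in>{1..N} - {i}. trunc_log r (x i - x j))"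
      by (rule sum.remove) (use i in auto)
    then show "(\<Sum>j\<in>{1..N} - {i}. trunc_log r (x i - x j)) = (\<Sum>j\<in>{1..N}. trunc_log r (x i - x j)) - trunc_log r 0"
      by simp
  qed
  also have "\<dots> = (\<Sum>i\<in>{1..N}. \<Sum>j\<in>{1..N}. trunc_log r (x i - x j)) - real N * trunc_log r 0"
    by (simp add: sum_subtractf)
  also have "(\<Sum>i\<in>{1..N}. \<Sum>j\<in>{1..N}. trunc_log r (x i - x j))
    \<le> (\<Sum>i\<in>{1..N}. \<Sum>j\<in>{1..N}. (if i \<in> I \<and> j \<in> I then trunc_log r (x i - x j) else 0) + (m (x i) + m (x j)))"
    using far by (intro sum_mono) auto
  also have "\<dots> = T + 2 * real N * (\<Sum>i\<in>O'. ln (2 * \<bar>x i\<bar>))"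
  proof -
    have 1: "(\<Sum>i\<in>{1..N}. \<Sum>j\<in>{1..N}. (if i \<in> I \<and> j \<in> I then trunc_log r (x i - x j) else 0)) = T"
    proof -
      have "(\<Sum>i\<in>{1..N}. \<Sum>j\<in>{1..N}. (if i \<in> I \<and> j \<in> I then trunc_log r (x i - x j) else 0))
        = (\<Sum>i\<in>{1..N}. if i \<in> I then (\<Sum>j\<in>I. trunc_log r (x i - x j)) else 0)"
        using I by (intro sum.cong refl) (auto simp: sum.If_cases Int_absorb1)
      also have "\<dots> = T" unfolding T_def using I by (simp add: sum.If_cases Int_absorb1)
      finally show ?thesis .
    qed
    have 2: "(\<Sum>i\<in>{1..N}. m (x i)) = (\<Sum>i\<in>O'. ln (2 * \<bar>x i\<bar>))"
      unfolding sumIO using IK by (simp add: m_def) (auto intro!: sum.cong simp: O'_def I_def)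
    show ?thesis
      by (simp only: sum.distrib 1) (simp add: 2[unfolded One_nat_def] sum_distrib_left[symmetric])
  qed
  finally have S: "(\<Sum>i\<in>{1..N}. \<Sum>j\<in>{1..N} - {i}. ln \<bar>x i - x j\<bar>)
    \<le> T + 2 * real N * (\<Sum>i\<in>O'. ln (2 * \<bar>x i\<bar>)) - real N * trunc_log r 0" by simp
  have "\<theta> * (\<Sum>i\<in>{1..N}. \<Sum>j\<in>{1..N} - {i}. ln \<bar>x i - x j\<bar>) / (real N)\<^sup>2
    \<le> \<theta> * (T + 2 * real N * (\<Sum>i\<in>O'. ln (2 * \<bar>x i\<bar>)) - real N * trunc_log r 0) / (real N)\<^sup>2"
    using S th by (intro divide_right_mono mult_left_mono) auto
  also have "\<dots> = \<theta> * (T / (real N)\<^sup>2) + (\<Sum>i\<in>O'. 2 * \<theta> * ln (2 * \<bar>x i\<bar>)) / real N - \<theta> * trunc_log r 0 / real N"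
    using N by (simp add: sum_distrib_left[symmetric] field_simps power2_eq_square)
  finally have D1: "disc_energy \<theta> V N x \<le> \<theta> * (T / (real N)\<^sup>2)
      + ((\<Sum>i\<in>O'. 2 * \<theta> * ln (2 * \<bar>x i\<bar>)) / real N - (\<Sum>i\<in>O'. V (x i)) / real N)
      - \<theta> * trunc_log r 0 / real N - (\<Sum>i\<in>I. V (x i)) / real N"
    unfolding disc_energy_def sumIO by (simp add: add_divide_distrib)
  have "(\<Sum>i\<in>O'. 2 * \<theta> * ln (2 * \<bar>x i\<bar>)) - (\<Sum>i\<in>O'. V (x i)) \<le> (\<Sum>i\<in>O'. - (9 + Vm))"
    unfolding sum_subtractf[symmetric]
  proof (rule sum_mono)
    fix i assume "i \<in> O'"
    then have "\<bar>x i\<bar> > K" by (auto simp: O'_def I_def)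
    from tail[OF this] show "2 * \<theta> * ln (2 * \<bar>x i\<bar>) - V (x i) \<le> - (9 + Vm)" by simp
  qed
  then have "((\<Sum>i\<in>O'. 2 * \<theta> * ln (2 * \<bar>x i\<bar>)) - (\<Sum>i\<in>O'. V (x i))) / real N \<le> (\<Sum>i\<in>O'. - (9 + Vm)) / real N"
    by (intro divide_right_mono) auto
  also have "\<dots> = - (9 + Vm) * p" by (simp add: p_def)
  finally have D2: "(\<Sum>i\<in>O'. 2 * \<theta> * ln (2 * \<bar>x i\<bar>)) / real N - (\<Sum>i\<in>O'. V (x i)) / real N \<le> - (9 + Vm) * p"
    by (simp only: diff_divide_distrib)
  define J where "J = (\<integral>s. \<integral>t. trunc_log r (s - t) * a s * a t \<partial>?M \<partial>?M)"
  have "card I \<le> N" using card_mono[OF _ I(1)] by simp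
  then have JT: "\<bar>J - T / (real N)\<^sup>2\<bar> \<le> 2 * (\<theta> / real N) / r"
    unfolding J_def T_def using mass p I(2)
    by (intro double_quadrature[OF sm(5) r(1) N _ _ sm(1,2,3)]) auto
  then have JT': "\<theta> * (T / (real N)\<^sup>2 - J) \<le> \<theta> * (2 * (\<theta> / real N) / r)"
    using th by (intro mult_left_mono) auto
  define W where "W y = V (clip B y)" for y
  have lipW: "\<bar>W y - W z\<bar> \<le> L * \<bar>y - z\<bar>" for y z
    unfolding W_def by (rule clipped_lipschitz[OF lipV]) (use B K th in auto)
  have "\<bar>(\<integral>t. W t * a t \<partial>?M) - (\<Sum>i\<in>I. W (x i)) / real N\<bar> \<le> L * (\<theta> / real N)"
    by (rule quadratureD[OF sm(5) lipW])
  moreover have "(\<integral>t. W t * a t \<partial>?M) = (\<integral>t. V t * a t \<partial>?M)"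
    by (intro Bochner_Integration.integral_cong refl) (auto simp: W_def clip_id)
  moreover have "(\<Sum>i\<in>I. W (x i)) = (\<Sum>i\<in>I. V (x i))"
  proof (rule sum.cong)
    fix i assume "i \<in> I"
    from IK[OF this] have "x i \<in> {-B..B}" using B th by (auto simp: abs_le_iff)
    then show "W (x i) = V (x i)" by (simp add: W_def clip_id)
  qed simp
  ultimately have VV: "\<bar>(\<integral>t. V t * a t \<partial>?M) - (\<Sum>i\<in>I. V (x i)) / real N\<bar> \<le> L * (\<theta> / real N)" by simp
  have t0: "trunc_log r 0 = ln r - 1" using r by (simp add: trunc_log_def)
  have err: "(2 * \<theta>\<^sup>2 / r + L * \<theta> + \<theta> * (1 - ln r)) / real N
    = \<theta> * (2 * (\<theta> / real N) / r) + L * (\<theta> / real N) - \<theta> * trunc_log r 0 / real N"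
    unfolding t0 using N r by (simp add: field_simps power2_eq_square)
  have en: "energy \<theta> V r B a = \<theta> * J - (\<integral>t. V t * a t \<partial>?M)" by (simp add: energy_def J_def)
  show thesis
  proof (rule that[OF rho(1) p])
    have "\<theta> * (T / (real N)\<^sup>2) \<le> \<theta> * J + \<theta> * (2 * (\<theta> / real N) / r)" using JT' by (simp add: right_diff_distrib)
    moreover have "- (9 + Vm) * p + p = - ((8 + Vm) * p)" by (simp add: algebra_simps)
    moreover have "(\<integral>t. V t * a t \<partial>?M) - L * (\<theta> / real N) \<le> (\<Sum>i\<in>I. V (x i)) / real N" using VV by linarith
    ultimately show "disc_energy \<theta> V N x + p \<le> energy \<theta> V r B \<rho> + (2 * \<theta>\<^sup>2 / r + L * \<theta> + \<theta> * (1 - ln r)) / real N"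
      using D1 D2 rho(2) unfolding err en by linarith
    fix f :: "real \<Rightarrow> real" and Lf Mf :: real
    assume lip: "\<And>x y. \<bar>f x - f y\<bar> \<le> Lf * \<bar>x - y\<bar>" and Mf: "\<And>x. \<bar>f x\<bar> \<le> Mf"
    have "\<bar>(\<integral>x. f x * \<rho> x \<partial>?M) - (\<integral>x. f x * a x \<partial>?M)\<bar> \<le> Mf * p"
      by (rule rho(3)[OF lipschitz_measurable_bounded(2)[OF lip] Mf])
    moreover have "\<bar>(\<integral>x. f x * a x \<partial>?M) - (\<Sum>i\<in>I. f (x i)) / real N\<bar> \<le> Lf * (\<theta> / real N)"
      by (rule quadratureD[OF sm(5) lip])
    moreover have "\<bar>(\<Sum>i\<in>O'. f (x i)) / real N\<bar> \<le> Mf * p"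
    proof -
      have "\<bar>\<Sum>i\<in>O'. f (x i)\<bar> \<le> (\<Sum>i\<in>O'. Mf)"
        by (intro order_trans[OF sum_abs] sum_mono Mf)
      then have "\<bar>\<Sum>i\<in>O'. f (x i)\<bar> / real N \<le> (\<Sum>i\<in>O'. Mf) / real N" by (intro divide_right_mono) auto
      then show ?thesis by (simp add: p_def mult.commute)
    qed
    moreover have "(\<Sum>i\<in>{1..N}. f (x i)) / real N = (\<Sum>i\<in>I. f (x i)) / real N + (\<Sum>i\<in>O'. f (x i)) / real N"
      unfolding sumIO by (rule add_divide_distrib)
    ultimately show "\<bar>(\<integral>x. f x * \<rho> x \<partial>?M) - (\<Sum>i\<in>{1..N}. f (x i)) / real N\<bar> \<le> Lf * (\<theta> / real N) + 2 * Mf * p"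
      by linarith
  qed
qed

section \<open>Weights and sums over all configurations\<close>

lemma sum_ordered_pairs:
  fixes h :: "nat \<Rightarrow> nat \<Rightarrow> real"
  assumes "\<And>i j. h i j = h j i"
  shows "2 * (\<Sum>(i, j)\<in>{(i, j). 1 \<le> i \<and> i < j \<and> j \<le> N}. h i j) = (\<Sum>i\<in>{1..N}. \<Sum>j\<in>{1..N} - {i}. h i j)"
proof -
  let ?P = "{(i, j). 1 \<le> i \<and> i < j \<and> j \<le> N}" and ?Q = "{(i, j). 1 \<le> j \<and> j < i \<and> i \<le> N}"
  have "?P \<subseteq> {1..N} \<times> {1..N}" "?Q \<subseteq> {1..N} \<times> {1..N}" by auto
  then have fin: "finite ?P" "finite ?Q" by (auto intro: finite_subset)
  have "(\<Sum>i\<in>{1..N}. \<Sum>j\<in>{1..N} - {i}. h i j) = (\<Sum>(i, j)\<in>Sigma {1..N} (\<lambda>i. {1..N} - {i}). h i j)"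
    by (rule sum.Sigma) auto
  also have "Sigma {1..N} (\<lambda>i. {1..N} - {i}) = ?P \<union> ?Q" by auto
  also have "(\<Sum>(i, j)\<in>?P \<union> ?Q. h i j) = (\<Sum>(i, j)\<in>?P. h i j) + (\<Sum>(i, j)\<in>?Q. h i j)"
    using fin by (intro sum.union_disjoint) auto
  also have "(\<Sum>(i, j)\<in>?Q. h i j) = (\<Sum>(i, j)\<in>?P. h i j)"
    by (rule sum.reindex_bij_witness[of _ prod.swap prod.swap]) (auto simp: assms)
  finally show ?thesis by simp
qed

lemma config_weight_eq:
  "config_weight \<theta> V N l = (\<Prod>(i, j)\<in>{(i, j). 1 \<le> i \<and> i < j \<and> j \<le> N}. pair_interaction \<theta> (l j - l i)) *
     (\<Prod>i = 1..N. exp (- real N * V (l i / real N)))"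
  unfolding config_weight_def pair_interaction_def by (simp add: case_prod_beta)

lemma config_weight_pos:
  assumes th: "\<theta> > 0" and l: "l \<in> particle_configs \<theta> N"
  shows "config_weight \<theta> V N l > 0"
proof -
  have "pair_interaction \<theta> (l j - l i) > 0" if "1 \<le> i" "i < j" "j \<le> N" for i j
  proof (rule pair_interaction_pos[OF th])
    have "\<theta> * 1 \<le> \<theta> * real (j - i)" using that th by (intro mult_left_mono) auto
    then show "\<theta> \<le> l j - l i" using particle_configs_gap[OF l, of i j] that by auto
  qed
  then show ?thesis unfolding config_weight_eq by (intro mult_pos_pos prod_pos) auto
qed

text \<open>
  Replacing each pair interaction by its leading term \<open>u powr (2 * \<theta>)\<close> costs \<open>O(1 / sqrt u)\<close> in the
  logarithm, hence \<open>O(N * sqrt N)\<close> altogether. Rescaling \<open>l i = N * x i\<close> splits off \<open>ln N\<close> from each of the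
  \<open>N * (N - 1)\<close> ordered pairs.
\<close>

lemma ln_config_weight:
  assumes th: "\<theta> > 0"
  obtains C where "C \<ge> 0"
    "\<And>V N l. N > 0 \<Longrightarrow> l \<in> particle_configs \<theta> N \<Longrightarrow>
      \<bar>ln (config_weight \<theta> V N l) - (\<theta> * (real N * (real N - 1)) * ln (real N)
        + (real N)\<^sup>2 * disc_energy \<theta> V N (\<lambda>i. l i / real N))\<bar> \<le> C * real N * sqrt (real N)"
proof -
  obtain C where C: "C \<ge> 0"
    "\<And>u. u \<ge> \<theta> \<Longrightarrow> \<bar>ln (pair_interaction \<theta> u) - 2 * \<theta> * ln u\<bar> \<le> C / sqrt u"
    using ln_pair_interaction_asymp[OF th] by blast
  show thesis
  proof (rule that[of "C * 4 / sqrt \<theta>"])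
    show "0 \<le> C * 4 / sqrt \<theta>" using C th by simp
    fix V :: "real \<Rightarrow> real" and N and l :: "nat \<Rightarrow> real"
    assume N: "N > 0" and l: "l \<in> particle_configs \<theta> N"
    let ?P = "{(i, j). 1 \<le> i \<and> i < j \<and> j \<le> N}"
    have "?P \<subseteq> {1..N} \<times> {1..N}" by auto
    then have fin: "finite ?P" by (auto intro: finite_subset)
    have gap: "\<theta> \<le> l j - l i" if "i \<in> {1..N}" "j \<in> {1..N}" "i < j" for i j
    proof -
      have "\<theta> * 1 \<le> \<theta> * real (j - i)" using that th by (intro mult_left_mono) auto
      then show "\<theta> \<le> l j - l i" using particle_configs_gap[OF l that] by auto
    qed
    have agap: "\<theta> \<le> \<bar>l i - l j\<bar>" if "i \<in> {1..N}" "j \<in> {1..N} - {i}" for i j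
      using gap[of i j] gap[of j i] that by (cases "i < j") auto
    have pi_pos: "0 < pair_interaction \<theta> (l j - l i)" if "1 \<le> i" "i < j" "j \<le> N" for i j
      using that by (intro pair_interaction_pos[OF th] gap) auto
    define g where "g u = ln (pair_interaction \<theta> u)" for u
    have "ln (config_weight \<theta> V N l) = ln (\<Prod>(i, j)\<in>?P. pair_interaction \<theta> (l j - l i))
        + ln (\<Prod>i = 1..N. exp (- real N * V (l i / real N)))"
      unfolding config_weight_eq
    proof (rule ln_mult_pos)
      show "0 < (\<Prod>(i, j)\<in>?P. pair_interaction \<theta> (l j - l i))"
        using pi_pos by (intro prod_pos) auto
    qed (auto intro!: prod_pos)
    also have "ln (\<Prod>(i, j)\<in>?P. pair_interaction \<theta> (l j - l i))
      = (\<Sum>p\<in>?P. ln (case p of (i, j) \<Rightarrow> pair_interaction \<theta> (l j - l i)))"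
      by (rule ln_prod[OF fin]) (use pi_pos in force)
    also have "\<dots> = (\<Sum>(i, j)\<in>?P. g (l j - l i))"
      by (intro sum.cong refl) (auto simp: g_def)
    also have "(\<Sum>(i, j)\<in>?P. g (l j - l i)) = (\<Sum>(i, j)\<in>?P. g \<bar>l i - l j\<bar>)"
    proof (rule sum.cong[OF refl])
      fix p assume "p \<in> ?P"
      moreover obtain i j where p: "p = (i, j)" by (cases p)
      ultimately show "(case p of (i, j) \<Rightarrow> g (l j - l i)) = (case p of (i, j) \<Rightarrow> g \<bar>l i - l j\<bar>)"
        using gap[of i j] th by auto
    qed
    also have "\<dots> = (\<Sum>i\<in>{1..N}. \<Sum>j\<in>{1..N} - {i}. g \<bar>l i - l j\<bar>) / 2"
      by (subst sum_ordered_pairs[symmetric]) (auto simp: abs_minus_commute)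
    also have "ln (\<Prod>i = 1..N. exp (- real N * V (l i / real N))) = - real N * (\<Sum>i\<in>{1..N}. V (l i / real N))"
      by (simp add: exp_sum[symmetric] sum_distrib_left sum_negf)
    finally have lnw: "ln (config_weight \<theta> V N l) = (\<Sum>i\<in>{1..N}. \<Sum>j\<in>{1..N} - {i}. g \<bar>l i - l j\<bar>) / 2
        - real N * (\<Sum>i\<in>{1..N}. V (l i / real N))" by simp
    have split: "2 * \<theta> * ln \<bar>l i - l j\<bar> = 2 * \<theta> * ln (real N) + 2 * \<theta> * ln \<bar>l i / real N - l j / real N\<bar>"
      if "i \<in> {1..N}" "j \<in> {1..N} - {i}" for i j
    proof -
      have pos: "\<bar>l i - l j\<bar> > 0" using agap[OF that] th by linarith
      have "\<bar>l i / real N - l j / real N\<bar> = \<bar>l i - l j\<bar> / real N"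
        by (simp add: diff_divide_distrib[symmetric])
      then have E: "ln \<bar>l i / real N - l j / real N\<bar> = ln \<bar>l i - l j\<bar> - ln (real N)"
        using pos N by (simp add: ln_div)
      show ?thesis unfolding E right_diff_distrib by simp
    qed
    have "(\<Sum>i\<in>{1..N}. \<Sum>j\<in>{1..N} - {i}. 2 * \<theta> * ln \<bar>l i - l j\<bar>)
      = (\<Sum>i\<in>{1..N}. \<Sum>j\<in>{1..N} - {i}. 2 * \<theta> * ln (real N) + 2 * \<theta> * ln \<bar>l i / real N - l j / real N\<bar>)"
      using split by (intro sum.cong refl) auto
    also have "\<dots> = (\<Sum>i\<in>{1..N}. \<Sum>j\<in>{1..N} - {i}. 2 * \<theta> * ln (real N))
        + 2 * \<theta> * (\<Sum>i\<in>{1..N}. \<Sum>j\<in>{1..N} - {i}. ln \<bar>l i / real N - l j / real N\<bar>)"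
      by (simp only: sum.distrib sum_distrib_left)
    also have "(\<Sum>i\<in>{1..N}. \<Sum>j\<in>{1..N} - {i}. 2 * \<theta> * ln (real N)) = 2 * (\<theta> * (real N * (real N - 1)) * ln (real N))"
      using N by (simp add: of_nat_diff)
    finally have main: "(\<Sum>i\<in>{1..N}. \<Sum>j\<in>{1..N} - {i}. 2 * \<theta> * ln \<bar>l i - l j\<bar>) / 2
        - real N * (\<Sum>i\<in>{1..N}. V (l i / real N))
      = \<theta> * (real N * (real N - 1)) * ln (real N) + (real N)\<^sup>2 * disc_energy \<theta> V N (\<lambda>i. l i / real N)"
      unfolding disc_energy_def using N by (simp add: right_diff_distrib power2_eq_square)
    have "\<bar>(\<Sum>i\<in>{1..N}. \<Sum>j\<in>{1..N} - {i}. g \<bar>l i - l j\<bar>) - (\<Sum>i\<in>{1..N}. \<Sum>j\<in>{1..N} - {i}. 2 * \<theta> * ln \<bar>l i - l j\<bar>)\<bar>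
      \<le> (\<Sum>i\<in>{1..N}. \<Sum>j\<in>{1..N} - {i}. C * (1 / sqrt \<bar>l i - l j\<bar>))"
      unfolding sum_subtractf[symmetric]
    proof (intro order_trans[OF sum_abs] sum_mono)
      fix i j assume "i \<in> {1..N}" "j \<in> {1..N} - {i}"
      from C(2)[OF agap[OF this]]
      show "\<bar>g \<bar>l i - l j\<bar> - 2 * \<theta> * ln \<bar>l i - l j\<bar>\<bar> \<le> C * (1 / sqrt \<bar>l i - l j\<bar>)" by (simp add: g_def)
    qed
    also have "\<dots> = C * (\<Sum>i\<in>{1..N}. \<Sum>j\<in>{1..N} - {i}. 1 / sqrt \<bar>l i - l j\<bar>)"
      by (simp only: sum_distrib_left)
    also have "\<dots> \<le> C * (4 * real N * sqrt (real N) / sqrt \<theta>)"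
      using particle_configs_gap[OF l] th C(1) by (intro mult_left_mono sum_inverse_sqrt_gaps_le) auto
    finally have "\<bar>(\<Sum>i\<in>{1..N}. \<Sum>j\<in>{1..N} - {i}. g \<bar>l i - l j\<bar>) / 2 - (\<Sum>i\<in>{1..N}. \<Sum>j\<in>{1..N} - {i}. 2 * \<theta> * ln \<bar>l i - l j\<bar>) / 2\<bar>
      \<le> C * (4 * real N * sqrt (real N) / sqrt \<theta>)" by linarith
    then show "\<bar>ln (config_weight \<theta> V N l) - (\<theta> * (real N * (real N - 1)) * ln (real N)
        + (real N)\<^sup>2 * disc_energy \<theta> V N (\<lambda>i. l i / real N))\<bar> \<le> C * 4 / sqrt \<theta> * real N * sqrt (real N)"
      unfolding lnw main[symmetric] by (simp add: algebra_simps)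
  qed
qed

text \<open>
  From \<open>\<bar>x - y\<bar> \<le> (1 + \<bar>x\<bar>) * (1 + \<bar>y\<bar>)\<close>: the interaction is dominated by a sum of one-particle terms,
  and \<open>V\<close> beats these with a margin \<open>\<kappa>\<close>.
\<close>

lemma disc_energy_le:
  assumes th: "\<theta> > 0" and N: "N > 0" and sep: "separated \<theta> N x"
    and V: "\<And>z. (2 * \<theta> + \<kappa>) * ln (1 + \<bar>z\<bar>) - C \<le> V z"
  shows "disc_energy \<theta> V N x \<le> C - \<kappa> / real N * (\<Sum>i\<in>{1..N}. ln (1 + \<bar>x i\<bar>))"
proof -
  define m where "m i = ln (1 + \<bar>x i\<bar>)" for i
  have m0: "m i \<ge> 0" for i by (simp add: m_def)
  have "(\<Sum>i\<in>{1..N}. \<Sum>j\<in>{1..N} - {i}. ln \<bar>x i - x j\<bar>) \<le> (\<Sum>i\<in>{1..N}. \<Sum>j\<in>{1..N} - {i}. m i + m j)"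
  proof (intro sum_mono)
    fix i j assume "i \<in> {1..N}" "j \<in> {1..N} - {i}"
    then have "\<theta> / real N \<le> \<bar>x i - x j\<bar>" using separated_gap[OF sep th N, of i j] by auto
    then have pos: "0 < \<bar>x i - x j\<bar>" using th N by (smt (verit) divide_pos_pos of_nat_0_less_iff)
    have "\<bar>x i - x j\<bar> \<le> (1 + \<bar>x i\<bar>) * (1 + \<bar>x j\<bar>)"
    proof -
      have "0 \<le> \<bar>x i\<bar> * \<bar>x j\<bar>" by simp
      moreover have "(1 + \<bar>x i\<bar>) * (1 + \<bar>x j\<bar>) = 1 + \<bar>x i\<bar> + \<bar>x j\<bar> + \<bar>x i\<bar> * \<bar>x j\<bar>"
        by (simp add: algebra_simps)
      ultimately show ?thesis using abs_triangle_ineq4[of "x i" "x j"] by linarith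
    qed
    then have "ln \<bar>x i - x j\<bar> \<le> ln ((1 + \<bar>x i\<bar>) * (1 + \<bar>x j\<bar>))" using pos by simp
    also have "\<dots> = m i + m j" unfolding m_def by (intro ln_mult_pos) auto
    finally show "ln \<bar>x i - x j\<bar> \<le> m i + m j" .
  qed
  also have "\<dots> \<le> (\<Sum>i\<in>{1..N}. \<Sum>j\<in>{1..N}. m i + m j)"
    using m0 by (intro sum_mono sum_mono2) auto
  also have "\<dots> = 2 * real N * (\<Sum>i\<in>{1..N}. m i)"
    by (simp add: sum.distrib sum_distrib_left[symmetric])
  finally have "\<theta> * (\<Sum>i\<in>{1..N}. \<Sum>j\<in>{1..N} - {i}. ln \<bar>x i - x j\<bar>) / (real N)\<^sup>2
    \<le> \<theta> * (2 * real N * (\<Sum>i\<in>{1..N}. m i)) / (real N)\<^sup>2"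
    using th by (intro divide_right_mono mult_left_mono) auto
  also have "\<dots> = 2 * \<theta> / real N * (\<Sum>i\<in>{1..N}. m i)" using N by (simp add: power2_eq_square)
  finally have 1: "\<theta> * (\<Sum>i\<in>{1..N}. \<Sum>j\<in>{1..N} - {i}. ln \<bar>x i - x j\<bar>) / (real N)\<^sup>2 \<le> 2 * \<theta> / real N * (\<Sum>i\<in>{1..N}. m i)" .
  have "(\<Sum>i\<in>{1..N}. (2 * \<theta> + \<kappa>) * m i - C) \<le> (\<Sum>i\<in>{1..N}. V (x i))"
    unfolding m_def by (intro sum_mono V)
  then have "((2 * \<theta> + \<kappa>) * (\<Sum>i\<in>{1..N}. m i) - real N * C) / real N \<le> (\<Sum>i\<in>{1..N}. V (x i)) / real N"
    by (intro divide_right_mono) (auto simp: sum_subtractf sum_distrib_left)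
  moreover have "((2 * \<theta> + \<kappa>) * (\<Sum>i\<in>{1..N}. m i) - real N * C) / real N
      = 2 * \<theta> / real N * (\<Sum>i\<in>{1..N}. m i) + \<kappa> / real N * (\<Sum>i\<in>{1..N}. m i) - C"
    using N by (simp add: field_simps)
  ultimately show ?thesis using 1 unfolding disc_energy_def m_def by linarith
qed

text \<open>
  Shifting the summation index by the floor of \<open>t\<close> compares all shifts with the sum over the
  integers themselves, up to the factor \<open>4\<close>.
\<close>

lemma shifted_inverse_squares:
  obtains C :: real where "C \<ge> 1"
    "\<And>t::real. (\<lambda>m::int. (1 / (1 + \<bar>of_int m + t\<bar>))\<^sup>2) summable_on UNIV"
    "\<And>t::real. infsum (\<lambda>m::int. (1 / (1 + \<bar>of_int m + t\<bar>))\<^sup>2) UNIV \<le> C"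
proof -
  define h where "h k = 4 * (1 / (1 + \<bar>of_int k\<bar> :: real))\<^sup>2" for k :: int
  have "summable (\<lambda>n. inverse (real (Suc n) ^ 2))"
    using inverse_power_summable[of 2, where 'a=real] by (subst summable_Suc_iff) simp
  then have sn: "(\<lambda>n::nat. 4 * (1 / (1 + real n))\<^sup>2) summable_on UNIV"
    by (intro summable_on_cmult_right summable_nonneg_imp_summable_on)
       (auto simp: inverse_eq_divide power_divide)
  have "h summable_on (range int)"
    by (subst summable_on_reindex) (use sn in \<open>auto simp: h_def o_def inj_on_def\<close>)
  moreover have "h summable_on (range (\<lambda>n. - int n))"
    by (subst summable_on_reindex) (use sn in \<open>auto simp: h_def o_def inj_on_def\<close>)
  ultimately have "h summable_on (range int \<union> range (\<lambda>n. - int n))"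
    by (rule summable_on_union)
  moreover have "range int \<union> range (\<lambda>n. - int n) = UNIV"
  proof -
    have "k \<in> range int \<union> range (\<lambda>n. - int n)" for k
      by (cases "k \<ge> 0") (auto intro: image_eqI[of _ _ "nat k"] image_eqI[of _ _ "nat (- k)"])
    then show ?thesis by blast
  qed
  ultimately have h: "h summable_on UNIV" by simp
  have bij: "bij_betw (\<lambda>m::int. m + k) UNIV UNIV" for k
    by (rule bij_betw_byWitness[where f'="\<lambda>m. m - k"]) auto
  have hs: "(\<lambda>m. h (m + k)) summable_on UNIV" "infsum (\<lambda>m. h (m + k)) UNIV = infsum h UNIV" for k
    using h summable_on_reindex_bij_betw[OF bij, of h k] infsum_reindex_bij_betw[OF bij, of h k] by auto
  have le: "(1 / (1 + \<bar>of_int m + t\<bar>))\<^sup>2 \<le> h (m + \<lfloor>t\<rfloor>)" for m :: int and t :: real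
  proof -
    have "1 + \<bar>real_of_int (m + \<lfloor>t\<rfloor>)\<bar> \<le> 2 * (1 + \<bar>of_int m + t\<bar>)"
    proof -
      define k s where "k = real_of_int (m + \<lfloor>t\<rfloor>)" and "s = of_int m + t"
      have "k \<le> s" "s < k + 1"
        using of_int_floor_le[of t] real_of_int_floor_add_one_gt[of t] by (auto simp: k_def s_def)
      then have "1 + \<bar>k\<bar> \<le> 2 * (1 + \<bar>s\<bar>)" by (auto simp: abs_if)
      then show ?thesis by (simp only: k_def s_def)
    qed
    then have "1 / (1 + \<bar>of_int m + t\<bar>) \<le> 2 / (1 + \<bar>real_of_int (m + \<lfloor>t\<rfloor>)\<bar>)"
      by (simp add: field_simps)
    then have "(1 / (1 + \<bar>of_int m + t\<bar>))\<^sup>2 \<le> (2 / (1 + \<bar>real_of_int (m + \<lfloor>t\<rfloor>)\<bar>))\<^sup>2"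
      by (intro power_mono) auto
    then show ?thesis by (simp add: h_def power_divide)
  qed
  have s: "(\<lambda>m::int. (1 / (1 + \<bar>of_int m + t\<bar>))\<^sup>2) summable_on UNIV" for t :: real
    by (rule summable_on_comparison_test[OF hs(1) le]) auto
  have "infsum (\<lambda>m::int. (1 / (1 + \<bar>of_int m + t\<bar>))\<^sup>2) UNIV \<le> infsum h UNIV" for t :: real
    using infsum_mono[OF s hs(1) le, of t] hs(2) by simp
  then have "infsum (\<lambda>m::int. (1 / (1 + \<bar>of_int m + t\<bar>))\<^sup>2) UNIV \<le> max 1 (infsum h UNIV)" for t :: real
    by (meson max.coboundedI2)
  with s show thesis by (intro that[of "max 1 (infsum h UNIV)"]) auto
qed

text \<open>
  Dropping the monotonicity of the integer parts only adds nonnegative terms and turns the sum over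
  configurations into a product of sums over the integers.
\<close>

lemma sum_over_configs:
  obtains C :: real where "C \<ge> 1"
    "\<And>N. N > 0 \<Longrightarrow> (\<lambda>l. \<Prod>i\<in>{1..N}. (1 / (1 + \<bar>l i / real N\<bar>))\<^sup>2) summable_on particle_configs \<theta> N"
    "\<And>N. N > 0 \<Longrightarrow> infsum (\<lambda>l. \<Prod>i\<in>{1..N}. (1 / (1 + \<bar>l i / real N\<bar>))\<^sup>2) (particle_configs \<theta> N)
       \<le> (C * (real N)\<^sup>2) ^ N"
proof -
  obtain C :: real where C: "C \<ge> 1"
    "\<And>t::real. (\<lambda>m::int. (1 / (1 + \<bar>of_int m + t\<bar>))\<^sup>2) summable_on UNIV"
    "\<And>t::real. infsum (\<lambda>m::int. (1 / (1 + \<bar>of_int m + t\<bar>))\<^sup>2) UNIV \<le> C"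
    using shifted_inverse_squares by blast
  have main: "(\<lambda>l. \<Prod>i\<in>{1..N}. (1 / (1 + \<bar>l i / real N\<bar>))\<^sup>2) summable_on particle_configs \<theta> N
    \<and> infsum (\<lambda>l. \<Prod>i\<in>{1..N}. (1 / (1 + \<bar>l i / real N\<bar>))\<^sup>2) (particle_configs \<theta> N) \<le> (C * (real N)\<^sup>2) ^ N"
    if N: "N > 0" for N
  proof -
    define G where "G l = (\<Prod>i\<in>{1..N}. (1 / (1 + \<bar>l i / real N\<bar>))\<^sup>2)" for l :: "nat \<Rightarrow> real"
    define f where "f i m = (1 / (1 + \<bar>(of_int m + \<theta> * real i) / real N\<bar>))\<^sup>2" for i :: nat and m :: int
    have fle: "f i m \<le> (real N)\<^sup>2 * (1 / (1 + \<bar>of_int m + \<theta> * real i\<bar>))\<^sup>2" for i m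
    proof -
      let ?u = "\<bar>of_int m + \<theta> * real i\<bar>"
      have "1 / (1 + ?u / real N) = real N / (real N + ?u)" using N by (simp add: field_simps)
      also have "\<dots> \<le> real N / (1 + ?u)" using N by (intro divide_left_mono mult_pos_pos add_pos_nonneg) auto
      finally have "(1 / (1 + ?u / real N))\<^sup>2 \<le> (real N / (1 + ?u))\<^sup>2" by (intro power_mono) auto
      then show ?thesis by (simp add: f_def abs_divide power_divide)
    qed
    have fs: "f i summable_on UNIV" for i
      by (rule summable_on_comparison_test[OF summable_on_cmult_right[OF C(2)] fle]) (simp add: f_def)
    have fsum: "infsum (f i) UNIV \<le> C * (real N)\<^sup>2" for i
    proof -
      have "infsum (f i) UNIV \<le> infsum (\<lambda>m::int. (real N)\<^sup>2 * (1 / (1 + \<bar>of_int m + \<theta> * real i\<bar>))\<^sup>2) UNIV"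
        by (rule infsum_mono[OF fs summable_on_cmult_right[OF C(2)] fle])
      also have "\<dots> = (real N)\<^sup>2 * infsum (\<lambda>m::int. (1 / (1 + \<bar>of_int m + \<theta> * real i\<bar>))\<^sup>2) UNIV"
        by (rule infsum_cmult_right')
      also have "\<dots> \<le> (real N)\<^sup>2 * C" by (intro mult_left_mono C) auto
      finally show ?thesis by (simp add: mult.commute)
    qed
    have fpos: "f i m > 0" for i m unfolding f_def by (intro zero_less_power divide_pos_pos add_pos_nonneg) auto
    have fsum0: "infsum (f i) UNIV > 0" for i
    proof -
      have "f i 0 = infsum (f i) {0}" by simp
      also have "\<dots> \<le> infsum (f i) UNIV"
        using fs fpos by (intro infsum_mono2) (auto intro: less_imp_le)
      finally show ?thesis using fpos[of i 0] by linarith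
    qed
    let ?S = "PiE {1..N} (\<lambda>_. UNIV :: int set)"
    define \<psi> where "\<psi> lam = restrict (\<lambda>i. of_int (lam i) + \<theta> * real i) {1..N}" for lam :: "nat \<Rightarrow> int"
    have prodS: "infsum (\<lambda>lam. \<Prod>i\<in>{1..N}. f i (lam i)) ?S = (\<Prod>i\<in>{1..N}. infsum (f i) UNIV)"
    proof (rule infsum_prod_PiE_abs)
      show "(\<lambda>m. norm (f i m)) summable_on UNIV" for i
        using fs[of i] summable_on_iff_abs_summable_on_real by blast
    qed simp
    also have "\<dots> > 0" using fsum0 by (intro prod_pos) auto
    finally have prod0: "infsum (\<lambda>lam. \<Prod>i\<in>{1..N}. f i (lam i)) ?S > 0" .
    then have sS: "(\<lambda>lam. \<Prod>i\<in>{1..N}. f i (lam i)) summable_on ?S"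
      using infsum_not_exists by fastforce
    have inj: "inj_on \<psi> ?S"
    proof (rule inj_onI)
      fix u v assume uv: "u \<in> ?S" "v \<in> ?S" "\<psi> u = \<psi> v"
      show "u = v"
      proof (rule PiE_ext[OF uv(1,2)])
        fix i assume i: "i \<in> {1..N}"
        then show "u i = v i" using fun_cong[OF uv(3), of i] by (simp add: \<psi>_def)
      qed
    qed
    have G\<psi>: "(G \<circ> \<psi>) lam = (\<Prod>i\<in>{1..N}. f i (lam i))" for lam
      unfolding G_def f_def \<psi>_def o_def by (intro prod.cong) auto
    have sub: "particle_configs \<theta> N \<subseteq> \<psi> ` ?S"
    proof
      fix l assume l: "l \<in> particle_configs \<theta> N"
      then obtain lam :: "nat \<Rightarrow> int" where lam: "\<forall>i\<in>{1..N}. l i = of_int (lam i) + \<theta> * real i"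
        by (auto simp: particle_configs_def)
      have "l = \<psi> (restrict lam {1..N})"
        using l lam by (intro extensionalityI[of _ "{1..N}"]) (auto simp: particle_configs_def \<psi>_def)
      then show "l \<in> \<psi> ` ?S" by auto
    qed
    have sImg: "G summable_on (\<psi> ` ?S)"
      using summable_on_reindex[OF inj, of G] sS unfolding G\<psi>[abs_def, symmetric] by (simp add: G\<psi> o_def)
    have "infsum G (particle_configs \<theta> N) \<le> infsum G (\<psi> ` ?S)"
      by (intro infsum_mono2 sub sImg summable_on_subset[OF sImg sub]) (auto simp: G_def intro!: prod_nonneg)
    also have "\<dots> = infsum (\<lambda>lam. \<Prod>i\<in>{1..N}. f i (lam i)) ?S"
      unfolding infsum_reindex[OF inj, of G] by (rule infsum_cong) (rule G\<psi>)
    also have "\<dots> = (\<Prod>i\<in>{1..N}. infsum (f i) UNIV)" by (rule prodS)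
    also have "\<dots> \<le> (\<Prod>i\<in>{1..N}. C * (real N)\<^sup>2)"
      using fsum fsum0 by (intro prod_mono) (auto intro: less_imp_le)
    also have "\<dots> = (C * (real N)\<^sup>2) ^ N" by simp
    finally show ?thesis
      using summable_on_subset[OF sImg sub] unfolding G_def by blast
  qed
  show thesis using main by (intro that[OF C(1)]) auto
qed

lemma emeasure_point_measure_infsum:
  fixes f :: "'a \<Rightarrow> real"
  assumes "f summable_on A" "\<And>x. x \<in> A \<Longrightarrow> f x \<ge> 0" "X \<subseteq> A"
  shows "emeasure (point_measure A (\<lambda>x. ennreal (f x))) X = ennreal (infsum f X)"
proof -
  define g where "g x = f x * indicator X x" for x
  have "(\<lambda>x. f x) summable_on X" by (rule summable_on_subset[OF assms(1,3)])
  moreover have "g summable_on A \<longleftrightarrow> f summable_on X"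
    using assms(3) by (intro summable_on_cong_neutral) (auto simp: g_def)
  ultimately have "g summable_on A" by simp
  then have gs: "Infinite_Set_Sum.abs_summable_on g A"
    using summable_on_iff_abs_summable_on_real abs_summable_equivalent by blast
  have "emeasure (point_measure A (\<lambda>x. ennreal (f x))) X = (\<integral>\<^sup>+x. ennreal (f x) * indicator X x \<partial>count_space A)"
    unfolding point_measure_def using assms(3) by (subst emeasure_density) auto
  also have "\<dots> = (\<integral>\<^sup>+x. ennreal (g x) \<partial>count_space A)"
    by (intro nn_integral_cong) (auto simp: g_def indicator_def)
  also have "\<dots> = ennreal (infsetsum g A)"
    using gs assms(2) by (intro nn_integral_conv_infsetsum) (auto simp: g_def)
  also have "infsetsum g A = infsum g A" by (rule infsetsum_infsum[OF gs])
  also have "infsum g A = infsum f X"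
    using assms(3) by (intro infsum_cong_neutral) (auto simp: g_def)
  finally show ?thesis .
qed

lemma particle_configs_nonempty: "particle_configs \<theta> N \<noteq> {}"
proof -
  have "restrict (\<lambda>i. of_int 0 + \<theta> * real i) {1..N} \<in> particle_configs \<theta> N"
    unfolding particle_configs_def by (auto intro!: exI[of _ "\<lambda>_. 0"] mono_onI)
  then show ?thesis by blast
qed

lemma beta_ensemble_summable:
  assumes th: "\<theta> > 0" and s: "config_weight \<theta> V N summable_on particle_configs \<theta> N"
  shows "prob_space (beta_ensemble \<theta> V N)"
    and "\<And>l. l \<in> particle_configs \<theta> N \<Longrightarrow> config_weight \<theta> V N l \<le> partition_function \<theta> V N"
    and "partition_function \<theta> V N > 0"
    and "\<And>X. X \<subseteq> particle_configs \<theta> N \<Longrightarrow> measure (beta_ensemble \<theta> V N) X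
      = infsum (config_weight \<theta> V N) X / partition_function \<theta> V N"
proof -
  let ?w = "config_weight \<theta> V N" and ?Z = "partition_function \<theta> V N" and ?A = "particle_configs \<theta> N"
  have w: "l \<in> ?A \<Longrightarrow> ?w l > 0" for l by (rule config_weight_pos[OF th])
  show le: "?w l \<le> ?Z" if "l \<in> ?A" for l
  proof -
    have "?w l = infsum ?w {l}" by simp
    also have "\<dots> \<le> infsum ?w ?A"
      using that w s by (intro infsum_mono2) (auto intro: less_imp_le)
    finally show ?thesis by (simp add: partition_function_def)
  qed
  obtain l0 where "l0 \<in> ?A" using particle_configs_nonempty by blast
  with le[OF this] w[OF this] show Z: "?Z > 0" by linarith
  have s': "(\<lambda>l. ?w l / ?Z) summable_on ?A" using summable_on_cmult_left[OF s, of "1 / ?Z"] by simp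
  have em: "emeasure (beta_ensemble \<theta> V N) X = ennreal (infsum ?w X / ?Z)" if "X \<subseteq> ?A" for X
  proof -
    have "emeasure (beta_ensemble \<theta> V N) X = ennreal (infsum (\<lambda>l. ?w l / ?Z) X)"
      unfolding beta_ensemble_def
      using s' w Z that by (intro emeasure_point_measure_infsum) (auto intro!: divide_nonneg_nonneg less_imp_le)
    also have "infsum (\<lambda>l. ?w l / ?Z) X = infsum ?w X / ?Z"
      using infsum_cmult_left'[of ?w "1 / ?Z" X] by simp
    finally show ?thesis .
  qed
  show "prob_space (beta_ensemble \<theta> V N)"
  proof (rule prob_spaceI)
    have "space (beta_ensemble \<theta> V N) = ?A" by (simp add: beta_ensemble_def space_point_measure)
    then show "emeasure (beta_ensemble \<theta> V N) (space (beta_ensemble \<theta> V N)) = 1"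
      using em[of ?A] Z by (simp add: partition_function_def[symmetric])
  qed
  show "measure (beta_ensemble \<theta> V N) X = infsum ?w X / ?Z" if "X \<subseteq> ?A" for X
  proof -
    have "infsum ?w X \<ge> 0" using that w by (intro infsum_nonneg) (auto intro: less_imp_le)
    then show ?thesis unfolding measure_def em[OF that] using Z by simp
  qed
qed

section \<open>Concentration near maximizers of the energy\<close>

text \<open>
  The properties of the potential on which concentration rests. \<open>V_growth\<close> controls the sum over configurations and \<open>V_far\<close> the
  particles outside \<open>[-K, K]\<close>; the number \<open>9 + Vm\<close> in it is \<open>8 + Vm\<close>, the price of refilling mass near the
  origin, plus \<open>1\<close>.
\<close>

locale confining_potential =
  fixes \<theta> \<kappa> Cl K B L Vm :: real and V :: "real \<Rightarrow> real"
  assumes th: "\<theta> > 0" and kappa: "\<kappa> > 0" and K: "K \<ge> 1" and B_def: "B = K + \<theta>"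
    and V_cont: "continuous_on UNIV V"
    and V_lip: "\<And>x y. x \<in> {-(B+1)..B+1} \<Longrightarrow> y \<in> {-(B+1)..B+1} \<Longrightarrow> \<bar>V x - V y\<bar> \<le> L * \<bar>x - y\<bar>"
    and V_near: "\<And>x. \<bar>x\<bar> \<le> \<theta> \<Longrightarrow> \<bar>V x\<bar> \<le> Vm"
    and V_far: "\<And>y. \<bar>y\<bar> > K \<Longrightarrow> 2 * \<theta> * ln (2 * \<bar>y\<bar>) + 9 + Vm \<le> V y"
    and V_growth: "\<And>z. (2 * \<theta> + \<kappa>) * ln (1 + \<bar>z\<bar>) - Cl \<le> V z"
begin

lemma B_pos: "B > 0" and B_ge: "B \<ge> 1" "\<theta> \<le> B"
  using th K B_def by auto

definition max_energy :: "real \<Rightarrow> real" where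
  "max_energy r = Sup (energy \<theta> V r B ` {\<rho>. admissible \<theta> B \<rho>})"

lemma energy_bounded:
  assumes r: "0 < r" "r \<le> 1" and adm: "admissible \<theta> B \<rho>"
  shows "energy \<theta> V r B \<rho> \<le> \<theta> * (\<bar>trunc_log r 0\<bar> + 2 * B / r) + Cl"
proof -
  let ?M = "lebesgue_Icc (-B) B"
  have rm [measurable]: "\<rho> \<in> borel_measurable borel" and b: "\<And>x. 0 \<le> \<rho> x" "\<And>x. \<rho> x \<le> 1 / \<theta>"
    and mass: "(\<integral>x. \<rho> x \<partial>?M) = 1"
    using adm by (auto simp: admissible_def)
  have intr: "integrable ?M \<rho>" using b by (intro integrable_lebesgue_Icc[where C="1 / \<theta>"]) auto
  define T where "T = \<bar>trunc_log r 0\<bar> + 2 * B / r"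
  have pot: "log_potential r B \<rho> s \<le> T" if s: "s \<in> {-B..B}" for s
  proof -
    have "log_potential r B \<rho> s \<le> (\<integral>t. T * \<rho> t \<partial>?M)"
      unfolding log_potential_def
    proof (rule integral_mono)
      show "integrable ?M (\<lambda>t. trunc_log r (s - t) * \<rho> t)" by (rule log_potential_ge(2)[OF th r rm b])
      fix t assume "t \<in> space ?M"
      then have "\<bar>trunc_log r (s - t)\<bar> \<le> T" unfolding T_def using s by (intro trunc_log_bounded r) auto
      then show "trunc_log r (s - t) * \<rho> t \<le> T * \<rho> t" using b by (intro mult_right_mono) auto
    qed (use intr in simp)
    then show ?thesis using mass by simp
  qed
  have "(\<integral>s. log_potential r B \<rho> s * \<rho> s \<partial>?M) \<le> (\<integral>s. T * \<rho> s \<partial>?M)"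
    using pot b intr
    by (intro integral_mono integrable_log_potential_mult[OF th r B_pos rm b rm b]) (auto intro: mult_right_mono)
  then have J: "(\<integral>s. log_potential r B \<rho> s * \<rho> s \<partial>?M) \<le> T" using mass by simp
  have Vm: "V \<in> borel_measurable borel" by (rule borel_measurable_continuous_onI[OF V_cont])
  obtain CV where CV: "\<And>x. x \<in> {-B..B} \<Longrightarrow> \<bar>V x\<bar> \<le> CV"
    using continuous_bounded_on_Icc[OF V_cont] by blast
  have intV: "integrable ?M (\<lambda>x. V x * \<rho> x)"
  proof (rule integrable_lebesgue_Icc)
    show "\<bar>V x * \<rho> x\<bar> \<le> CV * (1 / \<theta>)" if "x \<in> {-B..B}" for x
      unfolding abs_mult using CV[OF that] b[of x] by (intro mult_mono) auto
  qed (use Vm in measurable)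
  have "(\<integral>x. - Cl * \<rho> x \<partial>?M) \<le> (\<integral>x. V x * \<rho> x \<partial>?M)"
  proof (rule integral_mono)
    fix x
    have "0 \<le> (2 * \<theta> + \<kappa>) * ln (1 + \<bar>x\<bar>)" using th kappa by (intro mult_nonneg_nonneg) auto
    then have "- Cl \<le> V x" using V_growth[of x] by linarith
    then show "- Cl * \<rho> x \<le> V x * \<rho> x" using b by (intro mult_right_mono) auto
  qed (use intV intr in auto)
  then have "- Cl \<le> (\<integral>x. V x * \<rho> x \<partial>?M)" using mass by simp
  moreover have "\<theta> * (\<integral>s. log_potential r B \<rho> s * \<rho> s \<partial>?M) \<le> \<theta> * T" using J th by (intro mult_left_mono) auto
  ultimately show ?thesis unfolding energy_def double_integral_eq_log_potential T_def by linarith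
qed

lemma admissible_uniform: "admissible \<theta> B (\<lambda>_. 1 / (2 * B))"
  using B_pos B_ge th unfolding admissible_def
  by (auto simp: measure_restrict_space intro!: divide_left_mono)

lemma energy_le_max:
  assumes "0 < r" "r \<le> 1" "admissible \<theta> B \<rho>"
  shows "energy \<theta> V r B \<rho> \<le> max_energy r"
  unfolding max_energy_def using energy_bounded[OF assms(1,2)] assms(3)
  by (intro cSup_upper bdd_aboveI2) auto

lemma near_maximizer_exists:
  assumes "0 < r" "r \<le> 1" "e > 0"
  obtains \<rho> where "admissible \<theta> B \<rho>" "max_energy r - e \<le> energy \<theta> V r B \<rho>"
proof -
  have "max_energy r - e < Sup (energy \<theta> V r B ` {\<rho>. admissible \<theta> B \<rho>})"
    using assms by (simp add: max_energy_def)
  then obtain y where "y \<in> energy \<theta> V r B ` {\<rho>. admissible \<theta> B \<rho>}" "max_energy r - e < y"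
    using less_cSupD[of "energy \<theta> V r B ` {\<rho>. admissible \<theta> B \<rho>}"] admissible_uniform by blast
  then show thesis using that by (auto intro: less_imp_le)
qed

text \<open>
  The constant of \<open>ln_config_weight\<close>, which depends on \<open>\<theta>\<close> only.
\<close>

definition weight_error :: real where
  "weight_error = (SOME C. C \<ge> 0 \<and> (\<forall>V N l. N > 0 \<longrightarrow> l \<in> particle_configs \<theta> N \<longrightarrow>
      \<bar>ln (config_weight \<theta> V N l) - (\<theta> * (real N * (real N - 1)) * ln (real N)
        + (real N)\<^sup>2 * disc_energy \<theta> V N (\<lambda>i. l i / real N))\<bar> \<le> C * real N * sqrt (real N)))"

lemma weight_error:
  "weight_error \<ge> 0"
  "N > 0 \<Longrightarrow> l \<in> particle_configs \<theta> N \<Longrightarrow>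
      \<bar>ln (config_weight \<theta> U N l) - (\<theta> * (real N * (real N - 1)) * ln (real N)
        + (real N)\<^sup>2 * disc_energy \<theta> U N (\<lambda>i. l i / real N))\<bar> \<le> weight_error * real N * sqrt (real N)"
proof -
  obtain C where "C \<ge> 0"
    "\<And>V N l. N > 0 \<Longrightarrow> l \<in> particle_configs \<theta> N \<Longrightarrow>
      \<bar>ln (config_weight \<theta> V N l) - (\<theta> * (real N * (real N - 1)) * ln (real N)
        + (real N)\<^sup>2 * disc_energy \<theta> V N (\<lambda>i. l i / real N))\<bar> \<le> C * real N * sqrt (real N)"
    using ln_config_weight[OF th] by blast
  then have "\<exists>C. C \<ge> 0 \<and> (\<forall>V N l. N > 0 \<longrightarrow> l \<in> particle_configs \<theta> N \<longrightarrow>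
      \<bar>ln (config_weight \<theta> V N l) - (\<theta> * (real N * (real N - 1)) * ln (real N)
        + (real N)\<^sup>2 * disc_energy \<theta> V N (\<lambda>i. l i / real N))\<bar> \<le> C * real N * sqrt (real N))" by blast
  from someI_ex[OF this] show "weight_error \<ge> 0"
    "N > 0 \<Longrightarrow> l \<in> particle_configs \<theta> N \<Longrightarrow>
      \<bar>ln (config_weight \<theta> U N l) - (\<theta> * (real N * (real N - 1)) * ln (real N)
        + (real N)\<^sup>2 * disc_energy \<theta> U N (\<lambda>i. l i / real N))\<bar> \<le> weight_error * real N * sqrt (real N)"
    unfolding weight_error_def by blast+
qed

text \<open>
  The part of the logarithm of a weight that is common to all configurations.
\<close>

definition log_scale :: "nat \<Rightarrow> real" where
  "log_scale N = \<theta> * (real N * (real N - 1)) * ln (real N)"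

text \<open>
  A summable weight on configurations with which all others are compared.
\<close>

definition profile :: "nat \<Rightarrow> (nat \<Rightarrow> real) \<Rightarrow> real" where
  "profile N l = (\<Prod>i\<in>{1..N}. (1 / (1 + \<bar>l i / real N\<bar>))\<^sup>2)"

text \<open>
  The exponent is a convex combination of the bound \<open>D\<close>, which is good but has no decay in \<open>l\<close>, and the
  crude bound of \<open>disc_energy_le\<close>, of which a small multiple \<open>\<eta>\<close> already makes the sum over configurations
  converge. For \<open>\<eta> = 1\<close> only the latter is used.
\<close>

lemma config_weight_le:
  assumes N: "N > 0" and l: "l \<in> particle_configs \<theta> N" and eta: "0 \<le> \<eta>" "\<eta> \<le> 1" "2 \<le> \<eta> * \<kappa> * real N"
    and D: "\<eta> < 1 \<Longrightarrow> disc_energy \<theta> V N (\<lambda>i. l i / real N) \<le> D"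
  shows "config_weight \<theta> V N l
    \<le> exp (log_scale N + (real N)\<^sup>2 * ((1 - \<eta>) * D + \<eta> * Cl) + weight_error * real N * sqrt (real N)) * profile N l"
proof -
  define d where "d = disc_energy \<theta> V N (\<lambda>i. l i / real N)"
  define S where "S = (\<Sum>i\<in>{1..N}. ln (1 + \<bar>l i / real N\<bar>))"
  have S0: "S \<ge> 0" unfolding S_def by (intro sum_nonneg) auto
  have d: "d \<le> Cl - \<kappa> / real N * S"
    unfolding d_def S_def
    by (rule disc_energy_le[OF th N particle_configs_separated[OF l] V_growth])
  have "(1 - \<eta>) * d \<le> (1 - \<eta>) * D"
    using D eta by (cases "\<eta> = 1") (auto simp: d_def intro: mult_left_mono)
  moreover have "\<eta> * d \<le> \<eta> * (Cl - \<kappa> / real N * S)" using d eta by (intro mult_left_mono) auto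
  ultimately have "d \<le> (1 - \<eta>) * D + \<eta> * (Cl - \<kappa> / real N * S)" by (simp add: algebra_simps)
  then have "(real N)\<^sup>2 * d \<le> (real N)\<^sup>2 * ((1 - \<eta>) * D + \<eta> * (Cl - \<kappa> / real N * S))" by (intro mult_left_mono) auto
  also have "\<dots> = (real N)\<^sup>2 * ((1 - \<eta>) * D + \<eta> * Cl) - \<eta> * \<kappa> * real N * S"
    using N by (simp add: algebra_simps power2_eq_square)
  also have "\<dots> \<le> (real N)\<^sup>2 * ((1 - \<eta>) * D + \<eta> * Cl) - 2 * S"
    using mult_right_mono[OF eta(3) S0] by simp
  finally have 1: "ln (config_weight \<theta> V N l)
    \<le> (log_scale N + (real N)\<^sup>2 * ((1 - \<eta>) * D + \<eta> * Cl) + weight_error * real N * sqrt (real N)) - 2 * S"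
    using weight_error(2)[OF N l, of V] unfolding d_def log_scale_def by linarith
  have "exp (- 2 * S) = profile N l"
  proof -
    have "exp (- 2 * S) = (\<Prod>i\<in>{1..N}. exp (- 2 * ln (1 + \<bar>l i / real N\<bar>)))"
      unfolding S_def by (simp add: exp_sum[symmetric] sum_distrib_left)
    also have "\<dots> = profile N l"
      unfolding profile_def
    proof (rule prod.cong[OF refl])
      fix i
      have "1 + \<bar>l i / real N\<bar> > 0" by (intro add_pos_nonneg) auto
      then show "exp (- 2 * ln (1 + \<bar>l i / real N\<bar>)) = (1 / (1 + \<bar>l i / real N\<bar>))\<^sup>2"
        by (simp add: exp_minus exp_of_nat_mult[of 2, simplified] power_divide inverse_eq_divide)
    qed
    finally show ?thesis .
  qed
  define A where "A = log_scale N + (real N)\<^sup>2 * ((1 - \<eta>) * D + \<eta> * Cl) + weight_error * real N * sqrt (real N)"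
  have "config_weight \<theta> V N l = exp (ln (config_weight \<theta> V N l))"
    using config_weight_pos[OF th l] by simp
  also have "\<dots> \<le> exp (A + - 2 * S)" using 1 by (simp add: A_def)
  also have "\<dots> = exp A * profile N l" unfolding exp_add \<open>exp (- 2 * S) = profile N l\<close> ..
  finally show ?thesis by (simp only: A_def)
qed

lemma config_weight_summable:
  assumes N: "N > 0" "2 \<le> \<kappa> * real N"
  shows "config_weight \<theta> V N summable_on particle_configs \<theta> N"
proof -
  obtain C :: real where "\<And>N. N > 0 \<Longrightarrow> profile N summable_on particle_configs \<theta> N"
    unfolding profile_def[abs_def] using sum_over_configs[of \<theta>] by blast
  then have "(\<lambda>l. exp (log_scale N + (real N)\<^sup>2 * ((1 - 1) * 0 + 1 * Cl) + weight_error * real N * sqrt (real N)) * profile N l)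
    summable_on particle_configs \<theta> N"
    using N by (intro summable_on_cmult_right) auto
  then show ?thesis
  proof (rule summable_on_comparison_test)
    fix l assume l: "l \<in> particle_configs \<theta> N"
    show "config_weight \<theta> V N l \<le> exp (log_scale N + (real N)\<^sup>2 * ((1 - 1) * 0 + 1 * Cl) + weight_error * real N * sqrt (real N)) * profile N l"
      using N by (intro config_weight_le l) auto
    show "0 \<le> config_weight \<theta> V N l" using config_weight_pos[OF th l] by (rule less_imp_le)
  qed
qed

text \<open>
  The ratio of the total weight of the set \<open>Bad N\<close> to the weight of a single good configuration is at most
  \<open>exp (- \<delta> / 4 * N\<^sup>2 + o(N\<^sup>2))\<close>.
\<close>

lemma far_from_maximum_negligible:
  assumes delta: "\<delta> > 0"
    and bad: "\<forall>\<^sub>F N in sequentially. Bad N \<subseteq> {l \<in> particle_configs \<theta> N. disc_energy \<theta> V N (\<lambda>i. l i / real N) \<le> S - \<delta>}"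
    and good: "\<forall>\<^sub>F N in sequentially. \<exists>l\<in>particle_configs \<theta> N. S - \<delta> / 2 \<le> disc_energy \<theta> V N (\<lambda>i. l i / real N)"
  shows "(\<lambda>N. measure (beta_ensemble \<theta> V N) (Bad N)) \<longlonglongrightarrow> 0"
proof -
  obtain C :: real where C: "C \<ge> 1"
    "\<And>N. N > 0 \<Longrightarrow> profile N summable_on particle_configs \<theta> N"
    "\<And>N. N > 0 \<Longrightarrow> infsum (profile N) (particle_configs \<theta> N) \<le> (C * (real N)\<^sup>2) ^ N"
    unfolding profile_def[abs_def] using sum_over_configs[of \<theta>] by blast
  define q where "q = \<bar>Cl - S + \<delta>\<bar> + 1"
  have q: "q > 0" "Cl - S + \<delta> \<le> q" unfolding q_def by (auto intro: add_nonneg_pos)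
  \<comment> \<open>small enough that mixing in the crude bound \<open>Cl\<close> costs at most \<open>\<delta>/4\<close>\<close>
  define \<eta> where "\<eta> = min 1 (\<delta> / (4 * q))"
  have eta: "0 < \<eta>" "\<eta> \<le> 1" unfolding \<eta>_def using delta q by auto
  have "\<eta> * (Cl - S + \<delta>) \<le> \<eta> * q" using eta q by (intro mult_left_mono) auto
  also have "\<dots> \<le> \<delta> / (4 * q) * q"
    unfolding \<eta>_def using q by (intro mult_right_mono) auto
  also have "\<dots> = \<delta> / 4" using q by simp
  finally have mix: "(1 - \<eta>) * (S - \<delta>) + \<eta> * Cl \<le> S - 3 * \<delta> / 4" by (simp add: algebra_simps)
  define W where "W = weight_error"
  \<comment> \<open>\<open>W\<close> enters twice, once for the weights of the bad configurations and once for the good one;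
    the last term bounds the logarithm of the sum of \<open>profile N\<close>\<close>
  define bound where "bound N = exp (- (\<delta> / 4) * (real N)\<^sup>2 + 2 * W * real N * sqrt (real N) + real N * ln (C * (real N)\<^sup>2))" for N
  have "\<forall>\<^sub>F N in sequentially. 2 \<le> \<eta> * \<kappa> * real N"
    using eta kappa by real_asymp
  then have ev: "\<forall>\<^sub>F N in sequentially. measure (beta_ensemble \<theta> V N) (Bad N) \<le> bound N"
    using bad good eventually_gt_at_top[of 0]
  proof eventually_elim
    case (elim N)
    let ?w = "config_weight \<theta> V N" and ?A = "particle_configs \<theta> N" and ?Z = "partition_function \<theta> V N"
    have N: "N > 0" "2 \<le> \<kappa> * real N"
    proof -
      have "\<eta> * (\<kappa> * real N) \<le> 1 * (\<kappa> * real N)" using eta kappa by (intro mult_right_mono) auto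
      then show "2 \<le> \<kappa> * real N" using elim(1) by (simp add: mult.assoc)
    qed (use elim in auto)
    note sw = config_weight_summable[OF N]
    note be = beta_ensemble_summable[OF th sw]
    define E where "E = log_scale N + (real N)\<^sup>2 * (S - 3 * \<delta> / 4) + W * real N * sqrt (real N)"
    have sub: "Bad N \<subseteq> ?A" using elim(2) by auto
    have ps: "profile N summable_on ?A" by (rule C(2)[OF N(1)])
    have p0: "profile N l \<ge> 0" for l unfolding profile_def by (intro prod_nonneg) auto
    have wle: "?w l \<le> exp E * profile N l" if l: "l \<in> Bad N" for l
    proof -
      have lA: "l \<in> ?A" and dl: "disc_energy \<theta> V N (\<lambda>i. l i / real N) \<le> S - \<delta>" using elim(2) l by auto
      have "?w l \<le> exp (log_scale N + (real N)\<^sup>2 * ((1 - \<eta>) * (S - \<delta>) + \<eta> * Cl) + weight_error * real N * sqrt (real N)) * profile N l"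
        using eta elim(1) dl by (intro config_weight_le[OF N(1) lA]) auto
      also have "\<dots> \<le> exp E * profile N l"
        unfolding E_def W_def using mix p0 by (intro mult_right_mono) (auto intro!: mult_left_mono)
      finally show ?thesis .
    qed
    have "infsum ?w (Bad N) \<le> infsum (\<lambda>l. exp E * profile N l) (Bad N)"
      by (intro infsum_mono wle summable_on_subset[OF sw sub] summable_on_cmult_right summable_on_subset[OF ps sub])
    also have "\<dots> \<le> infsum (\<lambda>l. exp E * profile N l) ?A"
      using p0 by (intro infsum_mono2 sub summable_on_cmult_right summable_on_subset[OF ps sub] ps) auto
    also have "\<dots> = exp E * infsum (profile N) ?A" by (rule infsum_cmult_right')
    also have "\<dots> \<le> exp E * (C * (real N)\<^sup>2) ^ N" using C(3)[OF N(1)] by (intro mult_left_mono) auto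
    also have "(C * (real N)\<^sup>2) ^ N = exp (real N * ln (C * (real N)\<^sup>2))"
      using C(1) N(1) by (simp add: exp_of_nat_mult)
    finally have num: "infsum ?w (Bad N) \<le> exp (E + real N * ln (C * (real N)\<^sup>2))" by (simp add: exp_add)
    obtain l0 where l0: "l0 \<in> ?A" "S - \<delta> / 2 \<le> disc_energy \<theta> V N (\<lambda>i. l0 i / real N)" using elim(3) by blast
    define F where "F = log_scale N + (real N)\<^sup>2 * (S - \<delta> / 2) - W * real N * sqrt (real N)"
    have "(real N)\<^sup>2 * (S - \<delta> / 2) \<le> (real N)\<^sup>2 * disc_energy \<theta> V N (\<lambda>i. l0 i / real N)"
      using l0 by (intro mult_left_mono) auto
    then have "F \<le> ln (?w l0)"
      using weight_error(2)[OF N(1) l0(1), of V] unfolding F_def W_def log_scale_def by linarith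
    then have "exp F \<le> ?w l0" using config_weight_pos[OF th l0(1)] by (simp add: ln_ge_iff)
    also have "\<dots> \<le> ?Z" by (rule be(2)[OF l0(1)])
    finally have den: "exp F \<le> ?Z" .
    have "measure (beta_ensemble \<theta> V N) (Bad N) = infsum ?w (Bad N) / ?Z" by (rule be(4)[OF sub])
    also have "\<dots> \<le> exp (E + real N * ln (C * (real N)\<^sup>2)) / exp F"
      using num den by (intro frac_le) auto
    also have "\<dots> = exp (E + real N * ln (C * (real N)\<^sup>2) - F)" by (simp add: exp_diff)
    also have "E + real N * ln (C * (real N)\<^sup>2) - F
      = - (\<delta> / 4) * (real N)\<^sup>2 + 2 * W * real N * sqrt (real N) + real N * ln (C * (real N)\<^sup>2)"
      by (simp add: E_def F_def algebra_simps)
    finally show ?case by (simp add: bound_def)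
  qed
  have "bound \<longlonglongrightarrow> 0"
    unfolding bound_def using delta C(1) by real_asymp
  then show ?thesis
    by (rule tendsto_sandwich[OF _ ev tendsto_const, rotated]) auto
qed

text \<open>
  A configuration with energy above \<open>max_energy r - \<delta>\<close> has a density as in \<open>density_of_config\<close> that
  is a near maximizer, so it is close to \<open>\<rho>\<close>; its moved mass \<open>p\<close> is small as well. Configurations
  with smaller energy are negligible against one built from the quantiles of \<open>\<rho>\<close>.
\<close>

lemma empirical_concentration:
  assumes lip: "\<And>x y. \<bar>f x - f y\<bar> \<le> Lf * \<bar>x - y\<bar>" and Mf: "\<And>x. \<bar>f x\<bar> \<le> Mf" and eps: "\<epsilon> > 0"
  obtains r0 where "r0 > 0" "r0 \<le> 1"
    "\<And>r \<rho>. 0 < r \<Longrightarrow> r \<le> r0 \<Longrightarrow> admissible \<theta> B \<rho> \<Longrightarrow> max_energy r - r \<le> energy \<theta> V r B \<rho> \<Longrightarrow>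
      (\<lambda>N. measure (beta_ensemble \<theta> V N) {l \<in> particle_configs \<theta> N.
         \<bar>(\<Sum>i\<in>{1..N}. f (l i / real N)) / real N - (\<integral>x. f x * \<rho> x \<partial>lebesgue_Icc (-B) B)\<bar> > \<epsilon>}) \<longlonglongrightarrow> 0"
proof -
  have eps2: "\<epsilon> / 2 > 0" and eps4: "\<epsilon> / 4 > 0" using eps by simp_all
  obtain t where t: "t > 0"
    "\<And>r S \<rho>1 \<rho>2. 0 < r \<Longrightarrow> r \<le> 2 * B \<Longrightarrow> (\<And>\<rho>. admissible \<theta> B \<rho> \<Longrightarrow> energy \<theta> V r B \<rho> \<le> S) \<Longrightarrow>
       admissible \<theta> B \<rho>1 \<Longrightarrow> admissible \<theta> B \<rho>2 \<Longrightarrow>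
       S - t \<le> energy \<theta> V r B \<rho>1 \<Longrightarrow> S - t \<le> energy \<theta> V r B \<rho>2 \<Longrightarrow>
       \<bar>(\<integral>x. f x * \<rho>1 x \<partial>lebesgue_Icc (-B) B) - (\<integral>x. f x * \<rho>2 x \<partial>lebesgue_Icc (-B) B)\<bar> \<le> \<epsilon> / 2"
    using near_maximizers_close[OF th B_pos V_cont lip eps2] by blast
  have Mf0: "Mf \<ge> 0" using Mf[of 0] by linarith
  \<comment> \<open>\<open>2 * \<delta> \<le> t\<close> makes the density of a good configuration a near maximizer; the other bound keeps the
    contribution \<open>2 * Mf * p\<close> of the moved mass \<open>p \<le> 2 * \<delta>\<close> below \<open>\<epsilon>/4\<close>\<close>
  define \<delta> where "\<delta> = min (t / 2) (\<epsilon> / (16 * (Mf + 1)))"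
  have delta: "\<delta> > 0" using t(1) eps Mf0 by (simp add: \<delta>_def)
  then have delta4: "\<delta> / 4 > 0" by simp
  have d1: "2 * \<delta> \<le> t" by (simp add: \<delta>_def)
  have "\<delta> * (16 * (Mf + 1)) \<le> \<epsilon> / (16 * (Mf + 1)) * (16 * (Mf + 1))"
    unfolding \<delta>_def using Mf0 by (intro mult_right_mono) auto
  also have "\<dots> = \<epsilon>" using Mf0 by simp
  finally have d2: "4 * Mf * \<delta> \<le> \<epsilon> / 4" using delta by (simp add: algebra_simps)
  \<comment> \<open>ensures that truncation and suboptimality, \<open>8 * sqrt (r * \<theta>) + r\<close>, cost at most \<open>\<delta>/4\<close>\<close>
  define r0 where "r0 = min 1 (min t (min (\<delta> / 8) ((\<delta> / 64)\<^sup>2 / \<theta>)))"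
  have r0: "r0 > 0" "r0 \<le> 1" using t(1) delta th by (auto simp: r0_def)
  show thesis
  proof (rule that[OF r0])
    fix r \<rho> assume r: "0 < r" "r \<le> r0" and rho: "admissible \<theta> B \<rho>" "max_energy r - r \<le> energy \<theta> V r B \<rho>"
    let ?M = "lebesgue_Icc (-B) B"
    have r1: "r \<le> 1" "r \<le> t" "r \<le> \<delta> / 8" "r \<le> (\<delta> / 64)\<^sup>2 / \<theta>" using r(2) unfolding r0_def by auto
    have "r * \<theta> \<le> (\<delta> / 64)\<^sup>2" using r1(4) th by (simp add: pos_le_divide_eq)
    then have sq: "8 * sqrt (r * \<theta>) \<le> \<delta> / 8" using delta real_sqrt_le_mono[of "r * \<theta>" "(\<delta> / 64)\<^sup>2"] by simp
    have r2B: "r \<le> 2 * B" using r1(1) B_ge by linarith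
    define S where "S = max_energy r"
    define e1 where "e1 = 2 * \<theta>\<^sup>2 / r + L * \<theta> + \<theta> * (1 - ln r)"
    define e2 where "e2 = (2 * B + 1) * (2 * \<theta> / r + L)"
    define Bad where "Bad N = {l \<in> particle_configs \<theta> N.
         \<bar>(\<Sum>i\<in>{1..N}. f (l i / real N)) / real N - (\<integral>x. f x * \<rho> x \<partial>?M)\<bar> > \<epsilon>}" for N
    have lim0: "(\<lambda>N. c / real N) \<longlonglongrightarrow> 0" for c :: real by (rule lim_const_over_n)
    have evle: "\<forall>\<^sub>F N in sequentially. c / real N < a" if "a > 0" for a c :: real
      using order_tendstoD(2)[OF lim0 that] .
    have "(\<lambda>N. measure (beta_ensemble \<theta> V N) (Bad N)) \<longlonglongrightarrow> 0"
    proof (rule far_from_maximum_negligible[OF delta, of _ S])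
      show "\<forall>\<^sub>F N in sequentially. Bad N \<subseteq> {l \<in> particle_configs \<theta> N. disc_energy \<theta> V N (\<lambda>i. l i / real N) \<le> S - \<delta>}"
        using evle[OF delta, of e1] evle[OF eps4, of "Lf * \<theta>"] eventually_gt_at_top[of 0]
      proof eventually_elim
        case (elim N)
        show ?case
        proof (rule subsetI)
          fix l assume l: "l \<in> Bad N"
          then have lA: "l \<in> particle_configs \<theta> N" by (simp add: Bad_def)
          have "disc_energy \<theta> V N (\<lambda>i. l i / real N) \<le> S - \<delta>"
          proof (rule ccontr)
            assume "\<not> ?thesis"
            then have big: "S - \<delta> < disc_energy \<theta> V N (\<lambda>i. l i / real N)" by simp
            have lipB: "\<bar>V x - V y\<bar> \<le> L * \<bar>x - y\<bar>" if "x \<in> {-B..B}" "y \<in> {-B..B}" for x y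
              using that by (intro V_lip) auto
            show False
            proof (rule density_of_config[OF th K B_def r(1) r1(1) V_cont lipB V_near V_far elim(3)
                particle_configs_separated[OF lA]])
              fix \<rho>' p
              assume rp: "admissible \<theta> B \<rho>'" "0 \<le> p" "p \<le> 1"
                "disc_energy \<theta> V N (\<lambda>i. l i / real N) + p
                  \<le> energy \<theta> V r B \<rho>' + (2 * \<theta>\<^sup>2 / r + L * \<theta> + \<theta> * (1 - ln r)) / real N"
                "\<And>f Lf Mf. (\<And>x y. \<bar>f x - f y\<bar> \<le> Lf * \<bar>x - y\<bar>) \<Longrightarrow> (\<And>x. \<bar>f x\<bar> \<le> Mf) \<Longrightarrow>
                  \<bar>(\<integral>x. f x * \<rho>' x \<partial>?M) - (\<Sum>i\<in>{1..N}. f (l i / real N)) / real N\<bar> \<le> Lf * (\<theta> / real N) + 2 * Mf * p"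
              have "energy \<theta> V r B \<rho>' \<le> S" unfolding S_def by (rule energy_le_max[OF r(1) r1(1) rp(1)])
              then have p: "p \<le> 2 * \<delta>" using rp(4)[folded e1_def] big elim(1) by linarith
              have en: "S - t \<le> energy \<theta> V r B \<rho>'" using rp(2) rp(4)[folded e1_def] big elim(1) d1 by linarith
              have en2: "S - t \<le> energy \<theta> V r B \<rho>" using rho(2) r1(2) unfolding S_def by linarith
              have A: "\<bar>(\<integral>x. f x * \<rho>' x \<partial>?M) - (\<integral>x. f x * \<rho> x \<partial>?M)\<bar> \<le> \<epsilon> / 2"
                by (rule t(2)[OF r(1) r2B _ rp(1) rho(1) en en2])
                   (auto simp: S_def intro: energy_le_max[OF r(1) r1(1)])
              have "2 * Mf * p \<le> 2 * Mf * (2 * \<delta>)" using p Mf0 by (intro mult_left_mono) auto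
              also have "\<dots> = 4 * Mf * \<delta>" by simp
              finally have "2 * Mf * p \<le> \<epsilon> / 4" using d2 by (rule order_trans)
              moreover have "Lf * (\<theta> / real N) < \<epsilon> / 4" using elim(2) by simp
              moreover have "a + b < \<epsilon> / 2" if "b \<le> \<epsilon> / 4" "a < \<epsilon> / 4" for a b :: real using that by simp
              ultimately have "Lf * (\<theta> / real N) + 2 * Mf * p < \<epsilon> / 2" by blast
              then have "\<bar>(\<integral>x. f x * \<rho>' x \<partial>?M) - (\<Sum>i\<in>{1..N}. f (l i / real N)) / real N\<bar> < \<epsilon> / 2"
                using rp(5)[OF lip Mf] by linarith
              with A have "\<bar>(\<Sum>i\<in>{1..N}. f (l i / real N)) / real N - (\<integral>x. f x * \<rho> x \<partial>?M)\<bar> \<le> \<epsilon>" by linarith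
              then show False using l by (simp add: Bad_def)
            qed assumption+
          qed
          with lA show "l \<in> {l \<in> particle_configs \<theta> N. disc_energy \<theta> V N (\<lambda>i. l i / real N) \<le> S - \<delta>}" by simp
        qed
      qed
      show "\<forall>\<^sub>F N in sequentially. \<exists>l\<in>particle_configs \<theta> N. S - \<delta> / 2 \<le> disc_energy \<theta> V N (\<lambda>i. l i / real N)"
        using evle[OF delta4, of e2] eventually_gt_at_top[of 0]
      proof eventually_elim
        case (elim N)
        show ?case
        proof (rule config_of_density[OF th B_pos elim(2) r(1) r1(1) V_lip rho(1)])
          fix l
          assume l: "l \<in> particle_configs \<theta> N"
            "energy \<theta> V r B \<rho> - 8 * sqrt (r * \<theta>) - (2 * B + 1) * (2 * \<theta> / r + L) / real N
              \<le> disc_energy \<theta> V N (\<lambda>i. l i / real N)"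
          have "S - \<delta> / 2 \<le> disc_energy \<theta> V N (\<lambda>i. l i / real N)"
            using l(2)[folded e2_def] rho(2) sq r1(3) elim(1) delta unfolding S_def by simp
          with l(1) show ?case by blast
        qed assumption+
      qed
    qed
    then show "(\<lambda>N. measure (beta_ensemble \<theta> V N) {l \<in> particle_configs \<theta> N.
         \<bar>(\<Sum>i\<in>{1..N}. f (l i / real N)) / real N - (\<integral>x. f x * \<rho> x \<partial>?M)\<bar> > \<epsilon>}) \<longlonglongrightarrow> 0"
      unfolding Bad_def .
  qed
qed

end

section \<open>The limiting density\<close>

text \<open>
  The indicator of an open set is the increasing limit of the continuous functions
  \<open>min 1 (n * infdist x (- U))\<close>.
\<close>

lemma open_mass_le:
  assumes M: "real_distribution M" and U: "open U" "U \<noteq> UNIV" and C: "C \<ge> 0"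
    and le: "\<And>g. (\<And>x. isCont g x) \<Longrightarrow> (\<And>x. 0 \<le> g x) \<Longrightarrow> (\<And>x. g x \<le> indicator U x) \<Longrightarrow> (\<integral>x. g x \<partial>M) \<le> C"
  shows "measure M U \<le> C"
proof -
  interpret real_distribution M by fact
  have ne: "- U \<noteq> {}" using U by auto
  define g where "g n x = min 1 (real n * infdist x (- U))" for n x
  have gc: "isCont (g n) x" for n x unfolding g_def by (intro continuous_intros)
  have g0: "0 \<le> g n x" for n x unfolding g_def by (simp add: infdist_nonneg)
  have g1: "g n x \<le> indicator U x" for n x by (auto simp: g_def indicator_def)
  have gm: "g n \<in> borel_measurable borel" for n
    by (intro borel_measurable_continuous_onI continuous_at_imp_continuous_on ballI gc)
  have lim: "(\<lambda>n. g n x) \<longlonglongrightarrow> indicator U x" for x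
  proof (cases "x \<in> U")
    case True
    have "infdist x (- U) > 0"
      using True U ne infdist_pos_not_in_closed[of "- U" x] by (auto simp: closed_Compl)
    then have "\<forall>\<^sub>F n in sequentially. 1 \<le> real n * infdist x (- U)" by real_asymp
    then have "\<forall>\<^sub>F n in sequentially. g n x = indicator U x"
      by eventually_elim (use True in \<open>auto simp: g_def\<close>)
    then show ?thesis by (rule tendsto_eventually)
  next
    case False
    then show ?thesis by (simp add: g_def)
  qed
  have "(\<lambda>n. \<integral>x. g n x \<partial>M) \<longlonglongrightarrow> (\<integral>x. indicator U x \<partial>M)"
  proof (rule integral_dominated_convergence[where w="\<lambda>_. 1"])
    show "AE x in M. norm (g n x) \<le> 1" for n
      using g0 by (intro AE_I2) (simp add: g_def)
  qed (use gm U lim in auto)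
  moreover have "(\<integral>x. indicator U x \<partial>M) = measure M U" by simp
  ultimately have "(\<lambda>n. \<integral>x. g n x \<partial>M) \<longlonglongrightarrow> measure M U" by simp
  then show ?thesis
    by (rule LIMSEQ_le_const2) (use le[OF gc g0 g1] in auto)
qed

text \<open>
  A Radon-Nikodym derivative of \<open>M\<close> exceeds \<open>1/\<theta>\<close> on \<open>[-B, B]\<close> only on a null set, since otherwise
  that set would have too much mass; it vanishes almost everywhere outside. Truncating it changes it on a
  null set only and makes the bounds hold everywhere.
\<close>

lemma density_of_bounded_mass:
  assumes M: "real_distribution M" and th: "\<theta> > 0"
    and le: "\<And>X. X \<in> sets borel \<Longrightarrow> measure M X \<le> measure lborel (X \<inter> {-B..B}) / \<theta>"
  obtains \<rho> where "\<rho> \<in> borel_measurable borel" "\<And>x. 0 \<le> \<rho> x \<and> \<rho> x \<le> 1 / \<theta>"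
    "\<And>x. x \<notin> {-B..B} \<Longrightarrow> \<rho> x = 0" "M = density lborel (\<lambda>x. ennreal (\<rho> x))"
proof -
  interpret real_distribution M by fact
  let ?I = "{-B..B} :: real set"
  have ac: "absolutely_continuous lborel M"
    unfolding absolutely_continuous_def
  proof
    fix X assume X: "X \<in> null_sets (lborel :: real measure)"
    then have Xb: "X \<in> sets borel" by auto
    have "emeasure lborel (X \<inter> ?I) \<le> emeasure lborel X" using Xb by (intro emeasure_mono) auto
    then have "emeasure lborel (X \<inter> ?I) = 0" using null_setsD1[OF X] by simp
    then have "measure lborel (X \<inter> ?I) = 0" by (simp add: measure_def)
    then have "measure M X = 0" using le[OF Xb] measure_nonneg[of M X] by simp
    then show "X \<in> null_sets M"
      using Xb by (intro null_setsI) (simp_all add: emeasure_eq_measure)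
  qed
  define D where "D = RN_deriv lborel M"
  have Dm [measurable]: "D \<in> borel_measurable borel" unfolding D_def by simp
  have MD: "density lborel D = M"
    unfolding D_def by (rule sigma_finite_measure.density_RN_deriv[OF sigma_finite_lborel ac]) simp
  have em: "(\<integral>\<^sup>+x. D x * indicator X x \<partial>lborel) = emeasure M X" if "X \<in> sets borel" for X
    unfolding MD[symmetric] using that by (subst emeasure_density) auto
  have outside: "AE x in lborel. x \<notin> ?I \<longrightarrow> D x = 0"
  proof -
    have "measure M (- ?I) \<le> 0" using le[of "- ?I"] by simp
    then have "emeasure M (- ?I) = 0"
      using measure_nonneg[of M "- ?I"] by (simp add: emeasure_eq_measure)
    then have "(\<integral>\<^sup>+x. D x * indicator (- ?I) x \<partial>lborel) = 0" by (subst em) auto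
    then have "AE x in lborel. D x * indicator (- ?I) x = 0"
      by (subst (asm) nn_integral_0_iff_AE) auto
    then show ?thesis by eventually_elim (auto simp: indicator_def split: if_splits)
  qed
  have bound: "AE x in lborel. x \<in> ?I \<longrightarrow> D x \<le> ennreal (1 / \<theta>)"
  proof -
    define Y where "Y = {x \<in> ?I. ennreal (1 / \<theta>) < D x}"
    have Ym [measurable]: "Y \<in> sets borel" unfolding Y_def by measurable
    have YI: "Y \<inter> ?I = Y" unfolding Y_def by auto
    have fin: "emeasure lborel Y < \<infinity>"
    proof -
      have "emeasure lborel Y \<le> emeasure lborel ?I" by (intro emeasure_mono) (auto simp: Y_def)
      also have "\<dots> < \<infinity>" by (simp add: emeasure_lborel_Icc_eq)
      finally show ?thesis .
    qed
    have G: "(\<integral>\<^sup>+x. ennreal (1 / \<theta>) * indicator Y x \<partial>lborel) = ennreal (measure lborel Y / \<theta>)"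
      using fin th by (simp add: nn_integral_cmult_indicator emeasure_eq_ennreal_measure ennreal_mult[symmetric])
    have "(\<integral>\<^sup>+x. (D x * indicator Y x - ennreal (1 / \<theta>) * indicator Y x) \<partial>lborel)
      = (\<integral>\<^sup>+x. D x * indicator Y x \<partial>lborel) - (\<integral>\<^sup>+x. ennreal (1 / \<theta>) * indicator Y x \<partial>lborel)"
    proof (rule nn_integral_diff)
      show "AE x in lborel. ennreal (1 / \<theta>) * indicator Y x \<le> D x * indicator Y x"
        by (intro AE_I2) (auto simp: Y_def indicator_def)
    qed (use G in auto)
    also have "\<dots> = ennreal (measure M Y) - ennreal (measure lborel Y / \<theta>)"
      unfolding G em[OF Ym] by (simp add: emeasure_eq_measure)
    also have "\<dots> = 0" using le[OF Ym] th unfolding YI by (simp add: ennreal_minus ennreal_neg)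
    finally have "AE x in lborel. D x * indicator Y x - ennreal (1 / \<theta>) * indicator Y x = 0"
      by (subst (asm) nn_integral_0_iff_AE) auto
    then show ?thesis
    proof eventually_elim
      case (elim x)
      show ?case
      proof (intro impI, rule ccontr)
        assume x: "x \<in> ?I" "\<not> D x \<le> ennreal (1 / \<theta>)"
        then have "x \<in> Y" by (simp add: Y_def)
        with elim have "D x - ennreal (1 / \<theta>) = 0" by simp
        then have "D x \<le> ennreal (1 / \<theta>)"
          by (metis diff_gr0_ennreal less_irrefl x(2) not_le)
        with x show False by simp
      qed
    qed
  qed
  define \<rho> where "\<rho> x = indicator ?I x * min (1 / \<theta>) (enn2real (D x))" for x
  have rm [measurable]: "\<rho> \<in> borel_measurable borel" unfolding \<rho>_def by measurable
  have "AE x in lborel. D x = ennreal (\<rho> x)"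
    using outside bound
  proof eventually_elim
    case (elim x)
    show ?case
    proof (cases "x \<in> ?I")
      case True
      then have "D x \<le> ennreal (1 / \<theta>)" using elim by auto
      then have "D x = ennreal (enn2real (D x))" "enn2real (D x) \<le> 1 / \<theta>"
        using th by (auto simp: ennreal_enn2real_if top_unique enn2real_leI)
      then show ?thesis using True by (simp add: \<rho>_def min_def)
    next
      case False
      then show ?thesis using elim by (simp add: \<rho>_def)
    qed
  qed
  then have "density lborel D = density lborel (\<lambda>x. ennreal (\<rho> x))" by (intro density_cong) auto
  moreover have "0 \<le> \<rho> x \<and> \<rho> x \<le> 1 / \<theta>" for x
    using th by (auto simp: \<rho>_def indicator_def)
  moreover have "\<rho> x = 0" if "x \<notin> ?I" for x
    using that by (simp add: \<rho>_def)
  ultimately show thesis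
    using MD by (intro that[OF rm]) auto
qed

text \<open>
  All masses live on \<open>[-B, B]\<close>, so Helly's theorem applies. The bound \<open>\<bar>X \<inter> [-B, B]\<bar> / \<theta>\<close> on the mass
  passes to the weak limit for open sets, by testing with continuous functions, and then to Borel sets by
  outer regularity of Lebesgue measure.
\<close>

lemma limit_density_exists:
  assumes th: "\<theta> > 0" and B: "B > 0" and adm: "\<And>n. admissible \<theta> B (\<rho>s n)"
  obtains \<rho> s where "strict_mono (s :: nat \<Rightarrow> nat)"
    "\<rho> \<in> borel_measurable borel" "\<And>x. 0 \<le> \<rho> x \<and> \<rho> x \<le> 1 / \<theta>" "\<And>x. x \<notin> {-B..B} \<Longrightarrow> \<rho> x = 0"
    "prob_space (density lborel (\<lambda>x. ennreal (\<rho> x)))"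
    "\<And>f C. (\<And>x. isCont f x) \<Longrightarrow> (\<And>x. \<bar>f x\<bar> \<le> C) \<Longrightarrow>
       (\<lambda>k. \<integral>x. f x * \<rho>s (s k) x \<partial>lebesgue_Icc (-B) B) \<longlonglongrightarrow> (\<integral>x. f x * \<rho> x \<partial>lborel)"
proof -
  let ?I = "{-B..B} :: real set"
  have rm [measurable]: "\<rho>s n \<in> borel_measurable borel" and b: "0 \<le> \<rho>s n x" "\<rho>s n x \<le> 1 / \<theta>"
    and mass: "(\<integral>x. \<rho>s n x \<partial>lebesgue_Icc (-B) B) = 1" for n x
    using adm[of n] by (auto simp: admissible_def)
  define d where "d n x = indicator ?I x * \<rho>s n x" for n x
  have dm [measurable]: "d n \<in> borel_measurable borel" for n unfolding d_def by measurable
  have d0: "0 \<le> d n x" for n x using b by (simp add: d_def)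
  define \<mu> where "\<mu> n = density lborel (\<lambda>x. ennreal (d n x))" for n
  have int_d: "integrable lborel (d n)" for n
  proof (rule ccontr)
    assume "\<not> ?thesis"
    then have "(\<integral>x. d n x \<partial>lborel) = 0" by (rule not_integrable_integral_eq)
    then show False using mass[of n] by (simp add: integral_lebesgue_Icc_lborel d_def)
  qed
  have md: "(\<integral>x. d n x \<partial>lborel) = 1" for n
    using mass[of n] by (simp add: integral_lebesgue_Icc_lborel d_def)
  have prob: "prob_space (\<mu> n)" for n
  proof (rule prob_spaceI)
    have "emeasure (\<mu> n) (space (\<mu> n)) = (\<integral>\<^sup>+x. ennreal (d n x) \<partial>lborel)"
      unfolding \<mu>_def by (subst emeasure_density) auto
    also have "\<dots> = 1" using int_d d0 md by (subst nn_integral_eq_integral) auto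
    finally show "emeasure (\<mu> n) (space (\<mu> n)) = 1" .
  qed
  have rd: "real_distribution (\<mu> n)" for n
    unfolding real_distribution_def real_distribution_axioms_def using prob by (simp add: \<mu>_def)
  have int\<mu>: "(\<integral>x. f x \<partial>\<mu> n) = (\<integral>x. f x * \<rho>s n x \<partial>lebesgue_Icc (-B) B)"
    if "f \<in> borel_measurable borel" for f n
    unfolding \<mu>_def using that d0
    by (subst integral_density) (auto simp: integral_lebesgue_Icc_lborel d_def mult_ac)
  have "tight \<mu>"
    unfolding tight_def
  proof (intro conjI allI impI rd)
    fix e :: real assume e: "e > 0"
    have "measure (\<mu> n) {-B - 1<..B} = 1" for n
    proof -
      have "emeasure (\<mu> n) {-B - 1<..B} = (\<integral>\<^sup>+x. ennreal (d n x) * indicator {-B - 1<..B} x \<partial>lborel)"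
        unfolding \<mu>_def by (subst emeasure_density) auto
      also have "\<dots> = (\<integral>\<^sup>+x. ennreal (d n x) \<partial>lborel)"
        by (intro nn_integral_cong) (auto simp: d_def indicator_def)
      also have "\<dots> = 1" using int_d d0 md by (subst nn_integral_eq_integral) auto
      finally show ?thesis by (simp add: measure_def)
    qed
    then show "\<exists>a b. a < b \<and> (\<forall>n. 1 - e < measure (\<mu> n) {a<..b})"
      using e B by (intro exI[of _ "-B - 1"] exI[of _ B]) auto
  qed
  from tight_imp_convergent_subsubsequence[OF this strict_mono_id]
  obtain s M where s: "strict_mono (s :: nat \<Rightarrow> nat)" and M: "real_distribution M"
    and wc: "weak_conv_m (\<mu> \<circ> id \<circ> s) M" by blast
  have conv: "(\<lambda>k. \<integral>x. f x * \<rho>s (s k) x \<partial>lebesgue_Icc (-B) B) \<longlonglongrightarrow> (\<integral>x. f x \<partial>M)"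
    if "\<And>x. isCont f x" "\<And>x. \<bar>f x\<bar> \<le> C" for f :: "real \<Rightarrow> real" and C
  proof -
    have "(\<lambda>k. \<integral>x. f x \<partial>(\<mu> \<circ> id \<circ> s) k) \<longlonglongrightarrow> (\<integral>x. f x \<partial>M)"
      using that by (intro weak_conv_imp_integral_bdd_continuous_conv[OF _ M wc, of f C]) (auto intro: rd)
    moreover have "f \<in> borel_measurable borel"
      by (intro borel_measurable_continuous_onI continuous_at_imp_continuous_on ballI that)
    ultimately show ?thesis by (simp add: int\<mu>)
  qed
  interpret M: real_distribution M by fact
  have open_le: "measure M U \<le> measure lborel (U \<inter> ?I) / \<theta>" if U: "open U" "U \<noteq> UNIV" for U
  proof (rule open_mass_le[OF M U])
    show "0 \<le> measure lborel (U \<inter> ?I) / \<theta>" using th by simp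
    fix g :: "real \<Rightarrow> real" assume g: "\<And>x. isCont g x" "\<And>x. 0 \<le> g x" "\<And>x. g x \<le> indicator U x"
    have gm: "g \<in> borel_measurable borel"
      by (intro borel_measurable_continuous_onI continuous_at_imp_continuous_on ballI g)
    have g1: "g x \<le> 1" for x by (rule order_trans[OF g(3)]) (simp add: indicator_def)
    have Ub: "U \<in> sets borel" using U by simp
    have "(\<integral>x. g x * \<rho>s n x \<partial>lebesgue_Icc (-B) B) \<le> measure lborel (U \<inter> ?I) / \<theta>" for n
    proof -
      have i: "integrable (lebesgue_Icc (-B) B) (\<lambda>x. indicator U x * (1 / \<theta>))"
        using th Ub by (intro integrable_lebesgue_Icc[where C="1 / \<theta>"]) (auto simp: indicator_def)
      have "(\<integral>x. g x * \<rho>s n x \<partial>lebesgue_Icc (-B) B) \<le> (\<integral>x. indicator U x * (1 / \<theta>) \<partial>lebesgue_Icc (-B) B)"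
      proof (rule integral_mono[OF _ i])
        show "g x * \<rho>s n x \<le> indicator U x * (1 / \<theta>)" for x
          using g b by (intro mult_mono) auto
        show "integrable (lebesgue_Icc (-B) B) (\<lambda>x. g x * \<rho>s n x)"
        proof (rule integrable_lebesgue_Icc)
          show "\<bar>g x * \<rho>s n x\<bar> \<le> 1 * (1 / \<theta>)" for x
            unfolding abs_mult using g(2)[of x] g1[of x] b[of n x] by (intro mult_mono) auto
        qed (use gm in measurable)
      qed
      also have "\<dots> = (\<integral>x. indicator (U \<inter> ?I) x * (1 / \<theta>) \<partial>lborel)"
        unfolding integral_lebesgue_Icc_lborel
        by (intro Bochner_Integration.integral_cong) (auto simp: indicator_def)
      also have "\<dots> = measure lborel (U \<inter> ?I) / \<theta>" by simp
      finally show ?thesis .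
    qed
    then show "(\<integral>x. g x \<partial>M) \<le> measure lborel (U \<inter> ?I) / \<theta>"
      using g g1 by (intro LIMSEQ_le_const2[OF conv[of g 1]]) auto
  qed
  have set_le: "measure M X \<le> measure lborel (X \<inter> ?I) / \<theta>" if X: "X \<in> sets borel" for X
  proof -
    have "0 \<notin> - ?I" using B by simp
    then have "- ?I \<noteq> UNIV" by blast
    then have out: "measure M (- ?I) = 0"
      using open_le[of "- ?I"] measure_nonneg[of M "- ?I"] by (simp add: open_Compl)
    have in_le: "measure M (X \<inter> ?I) \<le> measure lborel (X \<inter> ?I) / \<theta> + e" if e: "e > 0" for e
    proof -
      have e': "\<theta> * e > 0" using th e by simp
      obtain U where U: "open U" "X \<subseteq> U" "emeasure lborel (U - X) < ennreal (\<theta> * e)"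
        using outer_regular_lborel[OF X e'] by blast
      \<comment> \<open>cutting off \<open>U\<close> makes its complement nonempty without changing it on \<open>[-B, B]\<close>\<close>
      define W where "W = U \<inter> {-B - 1<..<B + 1}"
      have W: "open W" "W \<noteq> UNIV" unfolding W_def using U by (auto intro: open_Int)
      have WI: "W \<inter> ?I = U \<inter> ?I" unfolding W_def by auto
      have fm: "A \<in> fmeasurable lborel" if "A \<in> sets borel" "A \<subseteq> ?I" for A
      proof (rule fmeasurableI2[of ?I])
        show "?I \<in> fmeasurable lborel" by (auto simp: fmeasurable_def emeasure_lborel_Icc_eq)
      qed (use that in auto)
      have Ub: "U \<in> sets borel" using U by simp
      have "measure lborel (U \<inter> ?I) \<le> measure lborel ((X \<inter> ?I) \<union> ((U - X) \<inter> ?I))"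
        using X Ub U(2) by (intro measure_mono_fmeasurable fm) auto
      also have "\<dots> \<le> measure lborel (X \<inter> ?I) + measure lborel ((U - X) \<inter> ?I)"
        using X Ub by (intro measure_Un_le) auto
      also have "measure lborel ((U - X) \<inter> ?I) \<le> \<theta> * e"
      proof -
        have "emeasure lborel ((U - X) \<inter> ?I) \<le> emeasure lborel (U - X)"
          using X Ub by (intro emeasure_mono) auto
        also have "\<dots> \<le> ennreal (\<theta> * e)" using U by simp
        finally show ?thesis using e' by (simp add: measure_def enn2real_leI)
      qed
      finally have UX: "measure lborel (U \<inter> ?I) \<le> measure lborel (X \<inter> ?I) + \<theta> * e" by simp
      have "measure M (X \<inter> ?I) \<le> measure M W"
        using W X U(2) by (intro M.finite_measure_mono) (auto simp: W_def)
      also have "\<dots> \<le> measure lborel (U \<inter> ?I) / \<theta>" using open_le[OF W] WI by simp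
      also have "\<dots> \<le> (measure lborel (X \<inter> ?I) + \<theta> * e) / \<theta>" using UX th by (intro divide_right_mono) auto
      also have "\<dots> = measure lborel (X \<inter> ?I) / \<theta> + e" using th by (simp add: field_simps)
      finally show ?thesis .
    qed
    have "measure M X \<le> measure M ((X \<inter> ?I) \<union> (- ?I))" using X by (intro M.finite_measure_mono) auto
    also have "\<dots> \<le> measure M (X \<inter> ?I) + measure M (- ?I)" using X by (intro measure_Un_le) auto
    also have "\<dots> = measure M (X \<inter> ?I)" using out by simp
    also have "\<dots> \<le> measure lborel (X \<inter> ?I) / \<theta>" using in_le by (rule field_le_epsilon)
    finally show ?thesis .
  qed
  obtain \<rho> where rho: "\<rho> \<in> borel_measurable borel" "\<And>x. 0 \<le> \<rho> x \<and> \<rho> x \<le> 1 / \<theta>"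
    "\<And>x. x \<notin> {-B..B} \<Longrightarrow> \<rho> x = 0" "M = density lborel (\<lambda>x. ennreal (\<rho> x))"
    using density_of_bounded_mass[OF M th set_le] by blast
  show thesis
  proof (rule that[OF s rho(1,2,3)])
    show "prob_space (density lborel (\<lambda>x. ennreal (\<rho> x)))" using M.prob_space_axioms rho(4) by simp
    fix f :: "real \<Rightarrow> real" and C assume f: "\<And>x. isCont f x" "\<And>x. \<bar>f x\<bar> \<le> C"
    have fm: "f \<in> borel_measurable borel"
      by (intro borel_measurable_continuous_onI continuous_at_imp_continuous_on ballI f)
    have "(\<integral>x. f x \<partial>M) = (\<integral>x. f x * \<rho> x \<partial>lborel)"
      unfolding rho(4) using rho(1,2) fm by (subst integral_density) (auto simp: mult.commute)
    then show "(\<lambda>k. \<integral>x. f x * \<rho>s (s k) x \<partial>lebesgue_Icc (-B) B) \<longlonglongrightarrow> (\<integral>x. f x * \<rho> x \<partial>lborel)"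
      using conv[OF f] by simp
  qed (use rho in auto)
qed

lemma integral_empirical_measure:
  assumes "f \<in> borel_measurable borel"
  shows "(\<integral>x. f x \<partial>empirical_measure N l) = (\<Sum>i\<in>{1..N}. f (l i / real N)) / real N"
proof -
  have "(\<lambda>i. l i / real N) \<in> uniform_count_measure {1..N} \<rightarrow>\<^sub>M borel"
    by (simp add: uniform_count_measure_def)
  then have "(\<integral>x. f x \<partial>empirical_measure N l) = (\<integral>i. f (l i / real N) \<partial>uniform_count_measure {1..N})"
    unfolding empirical_measure_def using assms by (rule integral_distr)
  then show ?thesis by (simp add: integral_uniform_count_measure)
qed

context confining_potential
begin

text \<open>
  For the given \<open>\<epsilon>\<close> one member of the subsequence suffices: far enough along it, the integral of \<open>f\<close> is
  within \<open>\<epsilon>/2\<close> of its limit and the truncation parameter is small enough for concentration within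
  \<open>\<epsilon>/2\<close>.
\<close>

lemma law_of_large_numbers:
  obtains \<rho> where "\<rho> \<in> borel_measurable borel" "\<And>x. 0 \<le> \<rho> x \<and> \<rho> x \<le> 1 / \<theta>"
    "\<And>x. x \<notin> {-B..B} \<Longrightarrow> \<rho> x = 0" "prob_space (density lborel (\<lambda>x. ennreal (\<rho> x)))"
    "\<And>f Lf Mf. (\<And>x y. \<bar>f x - f y\<bar> \<le> Lf * \<bar>x - y\<bar>) \<Longrightarrow> (\<And>x. \<bar>f x\<bar> \<le> Mf) \<Longrightarrow>
      converges_in_probability (beta_ensemble \<theta> V) (\<lambda>N l. \<integral>x. f x \<partial>(empirical_measure N l))
        (\<integral>x. f x * \<rho> x \<partial>lborel)"
proof -
  let ?M = "lebesgue_Icc (-B) B"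
  define r where "r n = 1 / (real n + 1)" for n :: nat
  have r: "0 < r n" "r n \<le> 1" for n by (auto simp: r_def)
  have "\<exists>\<rho>. admissible \<theta> B \<rho> \<and> max_energy (r n) - r n \<le> energy \<theta> V (r n) B \<rho>" for n
    using near_maximizer_exists[OF r(1,2) r(1), of n n] by blast
  then obtain \<rho>s where rs: "\<And>n. admissible \<theta> B (\<rho>s n)"
    "\<And>n. max_energy (r n) - r n \<le> energy \<theta> V (r n) B (\<rho>s n)" by metis
  obtain \<rho> s where s: "strict_mono (s :: nat \<Rightarrow> nat)" and rho: "\<rho> \<in> borel_measurable borel"
    "\<And>x. 0 \<le> \<rho> x \<and> \<rho> x \<le> 1 / \<theta>" "\<And>x. x \<notin> {-B..B} \<Longrightarrow> \<rho> x = 0"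
    "prob_space (density lborel (\<lambda>x. ennreal (\<rho> x)))"
    and conv: "\<And>f C. (\<And>x. isCont f x) \<Longrightarrow> (\<And>x. \<bar>f x\<bar> \<le> C) \<Longrightarrow>
       (\<lambda>k. \<integral>x. f x * \<rho>s (s k) x \<partial>?M) \<longlonglongrightarrow> (\<integral>x. f x * \<rho> x \<partial>lborel)"
    by (rule limit_density_exists[where \<rho>s=\<rho>s, OF th B_pos rs(1)]) blast
  have space_be: "space (beta_ensemble \<theta> V N) = particle_configs \<theta> N"
    and sets_be: "sets (beta_ensemble \<theta> V N) = Pow (particle_configs \<theta> N)" for N
    by (simp_all add: beta_ensemble_def space_point_measure sets_point_measure)
  have prob: "\<forall>\<^sub>F N in sequentially. prob_space (beta_ensemble \<theta> V N)"
  proof -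
    have "\<forall>\<^sub>F N in sequentially. 2 \<le> \<kappa> * real N" using kappa by real_asymp
    then show ?thesis using eventually_gt_at_top[of 0]
      by eventually_elim (rule beta_ensemble_summable(1)[OF th config_weight_summable])
  qed
  show thesis
  proof (rule that[OF rho])
    fix f :: "real \<Rightarrow> real" and Lf Mf
    assume lip: "\<And>x y. \<bar>f x - f y\<bar> \<le> Lf * \<bar>x - y\<bar>" and Mf: "\<And>x. \<bar>f x\<bar> \<le> Mf"
    have fm: "f \<in> borel_measurable borel" by (rule lipschitz_measurable_bounded(2)[OF lip])
    have fc: "isCont f x" for x
      using lipschitz_measurable_bounded(4)[OF lip] continuous_on_eq_continuous_at[OF open_UNIV] by blast
    define I where "I = (\<integral>x. f x * \<rho> x \<partial>lborel)"
    define X where "X N l = (\<integral>x. f x \<partial>empirical_measure N l)" for N and l :: "nat \<Rightarrow> real"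
    have "(\<lambda>N. measure (beta_ensemble \<theta> V N) {l \<in> space (beta_ensemble \<theta> V N). \<bar>X N l - I\<bar> > \<epsilon>}) \<longlonglongrightarrow> 0"
      if eps: "\<epsilon> > 0" for \<epsilon>
    proof -
      have eps2: "\<epsilon> / 2 > 0" using eps by simp
      obtain r0 where r0: "r0 > 0" "r0 \<le> 1" and conc:
        "\<And>r \<rho>. 0 < r \<Longrightarrow> r \<le> r0 \<Longrightarrow> admissible \<theta> B \<rho> \<Longrightarrow> max_energy r - r \<le> energy \<theta> V r B \<rho> \<Longrightarrow>
          (\<lambda>N. measure (beta_ensemble \<theta> V N) {l \<in> particle_configs \<theta> N.
            \<bar>(\<Sum>i\<in>{1..N}. f (l i / real N)) / real N - (\<integral>x. f x * \<rho> x \<partial>?M)\<bar> > \<epsilon> / 2}) \<longlonglongrightarrow> 0"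
        using empirical_concentration[OF lip Mf eps2] by blast
      have "\<forall>\<^sub>F k in sequentially. dist (\<integral>x. f x * \<rho>s (s k) x \<partial>?M) I < \<epsilon> / 2"
        unfolding I_def by (rule tendstoD[OF conv[OF fc Mf] eps2])
      moreover have "\<forall>\<^sub>F k in sequentially. r (s k) < r0"
      proof -
        have "r \<longlonglongrightarrow> 0" unfolding r_def by real_asymp
        then have "(\<lambda>k. r (s k)) \<longlonglongrightarrow> 0" using LIMSEQ_subseq_LIMSEQ[OF _ s] by (auto simp: o_def)
        then show ?thesis using r0 by (intro order_tendstoD(2))
      qed
      ultimately have "\<forall>\<^sub>F k in sequentially. dist (\<integral>x. f x * \<rho>s (s k) x \<partial>?M) I < \<epsilon> / 2 \<and> r (s k) < r0"
        by (rule eventually_conj)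
      then obtain k where k: "dist (\<integral>x. f x * \<rho>s (s k) x \<partial>?M) I < \<epsilon> / 2" "r (s k) < r0"
        using eventually_happens'[OF sequentially_bot] by blast
      define n where "n = s k"
      have lim: "(\<lambda>N. measure (beta_ensemble \<theta> V N) {l \<in> particle_configs \<theta> N.
            \<bar>(\<Sum>i\<in>{1..N}. f (l i / real N)) / real N - (\<integral>x. f x * \<rho>s n x \<partial>?M)\<bar> > \<epsilon> / 2}) \<longlonglongrightarrow> 0"
        using k(2) by (intro conc[OF r(1) _ rs]) (auto simp: n_def)
      show ?thesis
      proof (rule tendsto_sandwich[OF _ _ tendsto_const lim])
        show "\<forall>\<^sub>F N in sequentially. measure (beta_ensemble \<theta> V N) {l \<in> space (beta_ensemble \<theta> V N). \<bar>X N l - I\<bar> > \<epsilon>}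
          \<le> measure (beta_ensemble \<theta> V N) {l \<in> particle_configs \<theta> N.
            \<bar>(\<Sum>i\<in>{1..N}. f (l i / real N)) / real N - (\<integral>x. f x * \<rho>s n x \<partial>?M)\<bar> > \<epsilon> / 2}"
          using prob
        proof eventually_elim
          case (elim N)
          interpret prob_space "beta_ensemble \<theta> V N" by fact
          show ?case
          proof (rule finite_measure_mono)
            show "{l \<in> space (beta_ensemble \<theta> V N). \<bar>X N l - I\<bar> > \<epsilon>} \<subseteq> {l \<in> particle_configs \<theta> N.
              \<bar>(\<Sum>i\<in>{1..N}. f (l i / real N)) / real N - (\<integral>x. f x * \<rho>s n x \<partial>?M)\<bar> > \<epsilon> / 2}"
            proof clarify
              fix l assume l: "l \<in> space (beta_ensemble \<theta> V N)" "\<bar>X N l - I\<bar> > \<epsilon>"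
              have "\<bar>(\<integral>x. f x * \<rho>s n x \<partial>?M) - I\<bar> < \<epsilon> / 2" using k(1) by (simp add: dist_real_def n_def)
              moreover have "\<epsilon> / 2 < \<bar>u - v\<bar>" if "\<bar>v - I\<bar> < \<epsilon> / 2" "\<epsilon> < \<bar>u - I\<bar>" for u v
                using that by linarith
              ultimately show "l \<in> particle_configs \<theta> N \<and>
                \<epsilon> / 2 < \<bar>(\<Sum>i\<in>{1..N}. f (l i / real N)) / real N - (\<integral>x. f x * \<rho>s n x \<partial>?M)\<bar>"
                using l unfolding X_def integral_empirical_measure[OF fm] space_be by blast
            qed
          qed (auto simp: sets_be)
        qed
      qed auto
    qed
    then show "converges_in_probability (beta_ensemble \<theta> V) (\<lambda>N l. \<integral>x. f x \<partial>(empirical_measure N l))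
        (\<integral>x. f x * \<rho> x \<partial>lborel)"
      unfolding converges_in_probability_def I_def X_def
      using prob by (auto elim!: eventually_mono simp: beta_ensemble_def)
  qed
qed

end

section \<open>Real-analytic potentials\<close>

text \<open>
  A convergent power series is continuously differentiable, and a continuous derivative is bounded on
  compact intervals.
\<close>

lemma real_analytic_lipschitz:
  assumes an: "real_analytic_on V UNIV"
  shows "continuous_on UNIV V"
    and "\<exists>L. \<forall>x\<in>{-R..R}. \<forall>y\<in>{-R..R}. \<bar>V x - V y\<bar> \<le> L * \<bar>x - y\<bar>"
proof -
  have loc: "\<exists>r g. r > 0 \<and> (\<forall>y. \<bar>y - x\<bar> < r \<longrightarrow> (V has_real_derivative g (y - x)) (at y) \<and> isCont g (y - x))" for x
  proof -
    obtain a r where r: "r > 0" and sums: "\<And>y. \<bar>y - x\<bar> < r \<Longrightarrow> (\<lambda>n. a n * (y - x) ^ n) sums V y"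
      using an unfolding real_analytic_on_def by blast
    define f where "f z = (\<Sum>n. a n * z ^ n)" for z
    define g where "g z = (\<Sum>n. diffs a n * z ^ n)" for z
    have summ: "summable (\<lambda>n. a n * z ^ n)" if "\<bar>z\<bar> < r" for z
      using sums[of "x + z"] that by (auto simp: sums_iff)
    have "(V has_real_derivative g (y - x)) (at y) \<and> isCont g (y - x)" if y: "\<bar>y - x\<bar> < r" for y
    proof
      define k where "k = (\<bar>y - x\<bar> + r) / 2"
      have k: "\<bar>y - x\<bar> < k" "k < r" using y by (auto simp: k_def)
      have "DERIV f (y - x) :> g (y - x)"
        unfolding f_def g_def using k by (intro termdiffs_strong[of a k] summ) auto
      then have "((\<lambda>y. f (y - x)) has_real_derivative g (y - x) * 1) (at y)"
        by (intro DERIV_chain2[where f=f]) (auto intro!: derivative_eq_intros)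
      moreover have "\<forall>\<^sub>F z in nhds y. f (z - x) = V z"
      proof -
        have "\<forall>\<^sub>F z in nhds y. z \<in> {z. \<bar>z - x\<bar> < r}"
          using y by (intro eventually_nhds_in_open open_Collect_less continuous_intros) auto
        then show ?thesis by eventually_elim (use sums in \<open>auto simp: f_def sums_iff\<close>)
      qed
      ultimately show "(V has_real_derivative g (y - x)) (at y)"
        using DERIV_cong_ev[OF refl, of "\<lambda>z. f (z - x)" V y "g (y - x)" "g (y - x)"] by simp
      show "isCont g (y - x)"
        unfolding g_def
      proof (rule isCont_powser[of _ k])
        show "summable (\<lambda>n. diffs a n * k ^ n)"
          using k by (intro termdiff_converges[where K=r] summ) auto
      qed (use k in auto)
    qed
    then show ?thesis using r by blast
  qed
  have der: "(V has_real_derivative deriv V x) (at x)" for x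
  proof -
    obtain r g where "r > 0" "\<forall>y. \<bar>y - x\<bar> < r \<longrightarrow> (V has_real_derivative g (y - x)) (at y) \<and> isCont g (y - x)"
      using loc[of x] by blast
    then have "(V has_real_derivative g (x - x)) (at x)" by (metis abs_zero diff_self)
    then show ?thesis using DERIV_imp_deriv by metis
  qed
  show Vc: "continuous_on UNIV V"
    using der DERIV_isCont continuous_at_imp_continuous_on by blast
  have "isCont (deriv V) x" for x
  proof -
    obtain r g where rg: "r > 0" "\<forall>y. \<bar>y - x\<bar> < r \<longrightarrow> (V has_real_derivative g (y - x)) (at y) \<and> isCont g (y - x)"
      using loc[of x] by blast
    then have "isCont g (x - x)" by (metis abs_zero diff_self)
    moreover have "isCont (\<lambda>y. y - x) x" by (intro continuous_intros)
    ultimately have "isCont (\<lambda>y. g (y - x)) x"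
      using isCont_o2[where f="\<lambda>y. y - x" and g=g and a=x] by simp
    moreover have "\<forall>\<^sub>F y in nhds x. g (y - x) = deriv V y"
    proof -
      have "\<forall>\<^sub>F z in nhds x. z \<in> {z. \<bar>z - x\<bar> < r}"
        using rg(1) by (intro eventually_nhds_in_open open_Collect_less continuous_intros) auto
      then show ?thesis by eventually_elim (use rg(2) in \<open>auto intro!: DERIV_imp_deriv[symmetric]\<close>)
    qed
    ultimately show ?thesis by (subst (asm) isCont_cong) auto
  qed
  then have "continuous_on UNIV (deriv V)" by (simp add: continuous_at_imp_continuous_on)
  then obtain L where L: "\<And>x. x \<in> {-R..R} \<Longrightarrow> \<bar>deriv V x\<bar> \<le> L"
    using continuous_bounded_on_Icc by blast
  have "\<bar>V x - V y\<bar> \<le> L * \<bar>x - y\<bar>" if "x \<in> {-R..R}" "y \<in> {-R..R}" for x y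
  proof -
    have "norm (V x - V y) \<le> L * norm (x - y)"
      using that L
      by (intro field_differentiable_bound[where S="{-R..R}" and f'="deriv V"])
         (auto intro: DERIV_subset[OF der])
    then show ?thesis by simp
  qed
  then show "\<exists>L. \<forall>x\<in>{-R..R}. \<forall>y\<in>{-R..R}. \<bar>V x - V y\<bar> \<le> L * \<bar>x - y\<bar>" by blast
qed

text \<open>
  With \<open>c > 2 * \<theta>\<close> half of the difference serves as margin \<open>\<kappa>\<close>. Far out \<open>(c - 2 * \<theta>) * ln \<bar>y\<bar>\<close> exceeds any
  constant, which determines \<open>K\<close>.
\<close>

lemma confining_potential_exists:
  assumes th: "\<theta> > 0" and an: "real_analytic_on V UNIV" and c: "c > 2 * \<theta>"
    and ev: "\<forall>\<^sub>F z in at_infinity. V z > c * ln \<bar>z\<bar>"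
  obtains \<kappa> Cl K B L Vm where "confining_potential \<theta> \<kappa> Cl K B L Vm V"
proof -
  have Vc: "continuous_on UNIV V" by (rule real_analytic_lipschitz(1)[OF an])
  obtain Vm where Vm: "\<And>x. x \<in> {-\<theta>..\<theta>} \<Longrightarrow> \<bar>V x\<bar> \<le> Vm"
    using continuous_bounded_on_Icc[OF Vc] by blast
  obtain R0 where R0: "\<And>z. R0 \<le> \<bar>z\<bar> \<Longrightarrow> c * ln \<bar>z\<bar> < V z"
    using ev unfolding eventually_at_infinity by auto
  define R where "R = max R0 1"
  define \<kappa> where "\<kappa> = (c - 2 * \<theta>) / 2"
  have kappa: "\<kappa> > 0" "2 * \<theta> + \<kappa> \<le> c" using c by (auto simp: \<kappa>_def field_simps)
  obtain CV where CV0: "CV \<ge> 0" and CV: "\<And>x. x \<in> {-R..R} \<Longrightarrow> \<bar>V x\<bar> \<le> CV"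
    using continuous_bounded_on_Icc[OF Vc] by blast
  define q where "q = (2 * \<theta> * ln 2 + 9 + Vm) / (c - 2 * \<theta>)"
  \<comment> \<open>\<open>\<bar>y\<bar> > exp q\<close> is exactly what the requirement on far particles needs once \<open>V\<close> is above \<open>c * ln\<close>\<close>
  define K where "K = max (max R0 1) (exp q)"
  define B where "B = K + \<theta>"
  obtain L where L: "\<And>x y. x \<in> {-(B+1)..B+1} \<Longrightarrow> y \<in> {-(B+1)..B+1} \<Longrightarrow> \<bar>V x - V y\<bar> \<le> L * \<bar>x - y\<bar>"
    using real_analytic_lipschitz(2)[OF an, of "B + 1"] by blast
  define Cl where "Cl = (2 * \<theta> + \<kappa>) * ln (1 + R) + (2 * \<theta> + \<kappa>) * ln 2 + CV"
  have R1: "R \<ge> 1" "R \<ge> R0" by (auto simp: R_def)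
  have pos: "0 \<le> (2 * \<theta> + \<kappa>) * ln (1 + R)" "0 \<le> (2 * \<theta> + \<kappa>) * ln 2"
    using th kappa R1 by (auto intro!: mult_nonneg_nonneg)
  have "confining_potential \<theta> \<kappa> Cl K B L Vm V"
  proof
    show "\<theta> > 0" "\<kappa> > 0" by fact+
    show "K \<ge> 1" by (simp add: K_def)
    show "B = K + \<theta>" by (rule B_def)
    show "continuous_on UNIV V" by (rule Vc)
    show "\<bar>V x - V y\<bar> \<le> L * \<bar>x - y\<bar>" if "x \<in> {-(B+1)..B+1}" "y \<in> {-(B+1)..B+1}" for x y
      by (rule L[OF that])
    show "\<bar>V x\<bar> \<le> Vm" if "\<bar>x\<bar> \<le> \<theta>" for x using that by (intro Vm) auto
    show "2 * \<theta> * ln (2 * \<bar>y\<bar>) + 9 + Vm \<le> V y" if y: "\<bar>y\<bar> > K" for y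
    proof -
      have yK: "\<bar>y\<bar> \<ge> R0" "\<bar>y\<bar> > 0" "exp q \<le> \<bar>y\<bar>" using y by (auto simp: K_def)
      have "q \<le> ln \<bar>y\<bar>" using yK by (simp add: ln_ge_iff)
      then have "2 * \<theta> * ln 2 + 9 + Vm \<le> (c - 2 * \<theta>) * ln \<bar>y\<bar>"
        using c unfolding q_def by (simp add: pos_divide_le_eq mult.commute)
      moreover have "ln (2 * \<bar>y\<bar>) = ln 2 + ln \<bar>y\<bar>" using yK by (intro ln_mult_pos) auto
      ultimately show ?thesis using R0[OF yK(1)] by (simp add: algebra_simps)
    qed
    show "(2 * \<theta> + \<kappa>) * ln (1 + \<bar>z\<bar>) - Cl \<le> V z" for z
    proof (cases "\<bar>z\<bar> \<le> R")
      case True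
      then have "(2 * \<theta> + \<kappa>) * ln (1 + \<bar>z\<bar>) \<le> (2 * \<theta> + \<kappa>) * ln (1 + R)"
        using th kappa by (intro mult_left_mono) (auto intro!: ln_mono add_pos_nonneg)
      moreover have "- CV \<le> V z" using CV[of z] True by (auto simp: abs_le_iff)
      ultimately show ?thesis using pos unfolding Cl_def by linarith
    next
      case False
      then have z: "\<bar>z\<bar> \<ge> R0" "\<bar>z\<bar> \<ge> 1" using R1 by auto
      have "ln (1 + \<bar>z\<bar>) \<le> ln (2 * \<bar>z\<bar>)" using z by (intro ln_mono) auto
      also have "\<dots> = ln 2 + ln \<bar>z\<bar>" using z by (intro ln_mult_pos) auto
      finally have "(2 * \<theta> + \<kappa>) * ln (1 + \<bar>z\<bar>) \<le> (2 * \<theta> + \<kappa>) * (ln 2 + ln \<bar>z\<bar>)"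
        using th kappa by (intro mult_left_mono) auto
      also have "\<dots> = (2 * \<theta> + \<kappa>) * ln 2 + (2 * \<theta> + \<kappa>) * ln \<bar>z\<bar>" by (rule distrib_left)
      finally have 1: "(2 * \<theta> + \<kappa>) * ln (1 + \<bar>z\<bar>) \<le> (2 * \<theta> + \<kappa>) * ln 2 + (2 * \<theta> + \<kappa>) * ln \<bar>z\<bar>" .
      have "(2 * \<theta> + \<kappa>) * ln \<bar>z\<bar> \<le> c * ln \<bar>z\<bar>" using kappa z by (intro mult_right_mono) auto
      then show ?thesis using 1 R0[OF z(1)] pos CV0 unfolding Cl_def by linarith
    qed
  qed
  then show thesis by (rule that)
qed

theorem theorem1p2:
  fixes \<theta> c :: real and V :: "real \<Rightarrow> real"
  assumes "\<theta> > 0"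
    and "real_analytic_on V UNIV"
    and "\<exists>R. (mono_on {R..} V \<or> antimono_on {R..} V) \<and> (mono_on {..-R} V \<or> antimono_on {..-R} V)"
    and "c > 2 * \<theta>"
    and "\<forall>\<^sub>F z in at_infinity. V z > c * ln \<bar>z\<bar>"
  shows "\<exists>\<rho> :: real \<Rightarrow> real.
    \<rho> \<in> borel_measurable borel \<and>
    (\<forall>x. 0 \<le> \<rho> x \<and> \<rho> x \<le> 1 / \<theta>) \<and>
    (\<exists>K. compact K \<and> (\<forall>x. x \<notin> K \<longrightarrow> \<rho> x = 0)) \<and>
    prob_space (density lborel (\<lambda>x. ennreal (\<rho> x))) \<and>
    (\<forall>f :: real \<Rightarrow> real.
       (\<exists>L. L-lipschitz_on UNIV f) \<and> (\<exists>K. compact K \<and> (\<forall>x. x \<notin> K \<longrightarrow> f x = 0)) \<longrightarrow>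
       converges_in_probability (beta_ensemble \<theta> V)
         (\<lambda>N l. \<integral>x. f x \<partial>(empirical_measure N l))
         (\<integral>x. f x * \<rho> x \<partial>lborel))"
proof -
  obtain \<kappa> Cl K B L Vm where "confining_potential \<theta> \<kappa> Cl K B L Vm V"
    using confining_potential_exists[OF assms(1,2,4,5)] by blast
  then interpret confining_potential \<theta> \<kappa> Cl K B L Vm V .
  obtain \<rho> where rho: "\<rho> \<in> borel_measurable borel" "\<And>x. 0 \<le> \<rho> x \<and> \<rho> x \<le> 1 / \<theta>"
    "\<And>x. x \<notin> {-B..B} \<Longrightarrow> \<rho> x = 0" "prob_space (density lborel (\<lambda>x. ennreal (\<rho> x)))"
    and conv: "\<And>f Lf Mf. (\<And>x y. \<bar>f x - f y\<bar> \<le> Lf * \<bar>x - y\<bar>) \<Longrightarrow> (\<And>x. \<bar>f x\<bar> \<le> Mf) \<Longrightarrow>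
      converges_in_probability (beta_ensemble \<theta> V) (\<lambda>N l. \<integral>x. f x \<partial>(empirical_measure N l))
        (\<integral>x. f x * \<rho> x \<partial>lborel)"
    by (rule law_of_large_numbers) blast
  have "converges_in_probability (beta_ensemble \<theta> V) (\<lambda>N l. \<integral>x. f x \<partial>(empirical_measure N l))
      (\<integral>x. f x * \<rho> x \<partial>lborel)"
    if lip: "L'-lipschitz_on UNIV f" and K': "compact K'" "\<And>x. x \<notin> K' \<Longrightarrow> f x = 0" for f :: "real \<Rightarrow> real" and L' K'
  proof -
    have "compact (f ` K')"
      using lipschitz_on_continuous_on[OF lip] continuous_on_subset K'(1)
      by (blast intro: compact_continuous_image)
    then obtain Mf where "\<forall>x\<in>K'. \<bar>f x\<bar> \<le> Mf"
      by (auto dest!: compact_imp_bounded simp: bounded_iff)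
    then have "\<bar>f x\<bar> \<le> max 0 Mf" for x using K'(2)[of x] by (cases "x \<in> K'") auto
    moreover have "\<bar>f x - f y\<bar> \<le> L' * \<bar>x - y\<bar>" for x y
      using lipschitz_onD[OF lip, of x y] by (simp add: dist_real_def)
    ultimately show ?thesis by (intro conv) auto
  qed
  then have conv': "\<forall>f :: real \<Rightarrow> real.
       (\<exists>L. L-lipschitz_on UNIV f) \<and> (\<exists>K. compact K \<and> (\<forall>x. x \<notin> K \<longrightarrow> f x = 0)) \<longrightarrow>
       converges_in_probability (beta_ensemble \<theta> V)
         (\<lambda>N l. \<integral>x. f x \<partial>(empirical_measure N l))
         (\<integral>x. f x * \<rho> x \<partial>lborel)" by blast
  show ?thesis
  proof (intro exI conjI)
    show "\<forall>f :: real \<Rightarrow> real.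
       (\<exists>L. L-lipschitz_on UNIV f) \<and> (\<exists>K. compact K \<and> (\<forall>x. x \<notin> K \<longrightarrow> f x = 0)) \<longrightarrow>
       converges_in_probability (beta_ensemble \<theta> V)
         (\<lambda>N l. \<integral>x. f x \<partial>(empirical_measure N l))
         (\<integral>x. f x * \<rho> x \<partial>lborel)" by (rule conv')
    show "\<rho> \<in> borel_measurable borel" "prob_space (density lborel (\<lambda>x. ennreal (\<rho> x)))" by (rule rho)+
    show "\<forall>x. 0 \<le> \<rho> x \<and> \<rho> x \<le> 1 / \<theta>" using rho(2) by blast
    show "compact {-B..B}" by simp
    show "\<forall>x. x \<notin> {-B..B} \<longrightarrow> \<rho> x = 0" using rho(3) by blast
  qed
qed

end
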